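(* Let $f=\sum_{k\geq0}a_kh^k\in\mathbb{C}[[h]]$. Then $H_f$ is a Hopf subalgebra of $(H_{\mathrm{CK}},m,\Delta_{\mathrm{CK}})$ if, and only if, $a_0=0$ or, for every $i\geq0$, $a_i=0\Rightarrow a_{i+1}=0$. If all the $a_i$ are nonzero, then $H_f=\mathrm{Im}(\Psi)$.
   Context: Work over $\mathbb{C}$. $H_{\mathrm{CK}}$ is the polynomial algebra on the set $\mathcal{T}$ of rooted trees (basis: rooted forests, product: disjoint union); $B^+$ sends a forest $F$ to the tree obtained by grafting the roots of $F$ on a new root; $\Delta_{\mathrm{CK}}$ is the multiplicative coproduct determined by $\Delta_{\mathrm{CK}}(B^+(F))=1\otimes B^+(F)+(B^+\otimes\mathrm{Id})\Delta_{\mathrm{CK}}(F)$ (admissible cuts). Let $(X_i)_{i\in\mathbb{N}}$ be commuting formal variables, $\Lambda$ the set of nonzero finitely supported sequences $\alpha$ in $\mathbb{N}$, $X^\alpha=\prod X_i^{\alpha_i}$. The equation $\mathcal{F}=B^+\big(\sum_{i\geq0}a_iX_i\mathcal{F}^i\big)$ in $H_{\mathrm{CK}}[[X_i\mid i\in\mathbb{N}]]$ ($B^+$ extended coefficientwise) has a unique solution $\mathcal{F}=\sum_{\alpha\in\Lambda}T_\alpha X^\alpha$; $H_f$ is the subalgebra of $H_{\mathrm{CK}}$ generated by the $T_\alpha$. The map $\Psi$: let $(x_i)$ be commuting indeterminates, $x^\alpha=\prod x_i^{\alpha_i}$, $\alpha!=\prod\alpha_i!$; pair $H_{\mathrm{CK}}$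 with itself by $\langle F,G\rangle=s_F\delta_{F,G}$ ($s_F$ = number of automorphisms); pair $\mathbb{K}[x_i]_+$ with $\mathbb{K}[X_i]_+$ by $\langle x^\alpha,X^\beta\rangle=\alpha!\delta_{\alpha,\beta}$, extended to symmetric algebras (product $|$) by $\langle P_1|\cdots|P_k,Q_1|\cdots|Q_l\rangle=\delta_{k,l}\sum_\sigma\prod\langle P_i,Q_{\sigma(i)}\rangle$; for a tree $T$ let $N(T)=\prod_vX_{f_T(v)}$ with $f_T(v)$ the number of children of $v$; $\Theta(T_1\cdots T_k)=N(T_1)|\cdots|N(T_k)$; and $\Psi:S(\mathbb{C}[x_i]_+)\to H_{\mathrm{CK}}$ is defined by $\langle\Psi(a),F\rangle=\langle a,\Theta(F)\rangle$ for all forests $F$. *)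

theory Defs
  imports
    Complex_Main
    "HOL-Library.Multiset"
    "HOL-Library.Poly_Mapping"
    "HOL-Library.Product_Plus"
    "HOL-Combinatorics.Permutations"
    "HOL-Computational_Algebra.Formal_Power_Series"
begin

section \<open>Free vector spaces over the complex numbers\<close>

text \<open>
  The type \<open>'k \<Rightarrow>\<^sub>0 complex\<close> is the complex vector space with basis \<open>'k\<close>, the basis vector of \<open>k\<close>
  being \<open>Poly_Mapping.single k 1\<close>. If \<open>'k\<close> is a commutative monoid (written additively), then the
  library multiplication on this type is the monoid algebra product.
\<close>

definition pscale :: "complex \<Rightarrow> ('k \<Rightarrow>\<^sub>0 complex) \<Rightarrow> ('k \<Rightarrow>\<^sub>0 complex)" where
  "pscale c p = Poly_Mapping.map ((*) c) p"

lemma lookup_pscale [simp]: "Poly_Mapping.lookup (pscale c p) k = c * Poly_Mapping.lookup p k"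
  by (simp add: pscale_def Poly_Mapping.map.rep_eq when_def)

interpretation pscale: vector_space "pscale :: complex \<Rightarrow> ('k \<Rightarrow>\<^sub>0 complex) \<Rightarrow> ('k \<Rightarrow>\<^sub>0 complex)"
  by unfold_locales (rule poly_mapping_eqI; simp add: lookup_add algebra_simps)+

definition basis :: "'k \<Rightarrow> ('k \<Rightarrow>\<^sub>0 complex)" where
  "basis k = Poly_Mapping.single k 1"

definition lin_ext :: "('k \<Rightarrow> ('l \<Rightarrow>\<^sub>0 complex)) \<Rightarrow> ('k \<Rightarrow>\<^sub>0 complex) \<Rightarrow> ('l \<Rightarrow>\<^sub>0 complex)" where
  "lin_ext g p = (\<Sum>k\<in>Poly_Mapping.keys p. pscale (Poly_Mapping.lookup p k) (g k))"

definition bilin_ext ::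
  "('k \<Rightarrow> 'l \<Rightarrow> complex) \<Rightarrow> ('k \<Rightarrow>\<^sub>0 complex) \<Rightarrow> ('l \<Rightarrow>\<^sub>0 complex) \<Rightarrow> complex" where
  "bilin_ext b p q = (\<Sum>k\<in>Poly_Mapping.keys p. \<Sum>l\<in>Poly_Mapping.keys q.
      Poly_Mapping.lookup p k * Poly_Mapping.lookup q l * b k l)"

text \<open>
  The tensor product of the spaces with bases \<open>'k\<close> and \<open>'l\<close> is the space with basis \<open>'k \<times> 'l\<close>. For
  monoids \<open>'k\<close>, \<open>'l\<close> the monoid algebra product on it is the tensor product algebra structure.
\<close>

definition tensor ::
  "('k \<Rightarrow>\<^sub>0 complex) \<Rightarrow> ('l \<Rightarrow>\<^sub>0 complex) \<Rightarrow> ('k \<times> 'l \<Rightarrow>\<^sub>0 complex)" where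
  "tensor p q = (\<Sum>k\<in>Poly_Mapping.keys p. \<Sum>l\<in>Poly_Mapping.keys q.
      Poly_Mapping.single (k, l) (Poly_Mapping.lookup p k * Poly_Mapping.lookup q l))"

definition tensor_map ::
  "(('k \<Rightarrow>\<^sub>0 complex) \<Rightarrow> ('m \<Rightarrow>\<^sub>0 complex)) \<Rightarrow> (('l \<Rightarrow>\<^sub>0 complex) \<Rightarrow> ('n \<Rightarrow>\<^sub>0 complex)) \<Rightarrow>
   ('k \<times> 'l \<Rightarrow>\<^sub>0 complex) \<Rightarrow> ('m \<times> 'n \<Rightarrow>\<^sub>0 complex)" where
  "tensor_map g h = lin_ext (\<lambda>(k, l). tensor (g (basis k)) (h (basis l)))"

text \<open>The image of \<open>A \<otimes> A\<close> in the tensor square of the ambient space.\<close>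

definition tensor_square :: "('k \<Rightarrow>\<^sub>0 complex) set \<Rightarrow> ('k \<times> 'k \<Rightarrow>\<^sub>0 complex) set" where
  "tensor_square A = pscale.span {tensor p q | p q. p \<in> A \<and> q \<in> A}"

definition subalgebra :: "('k::comm_monoid_add \<Rightarrow>\<^sub>0 complex) set \<Rightarrow> bool" where
  "subalgebra A \<longleftrightarrow> pscale.subspace A \<and> 1 \<in> A \<and> (\<forall>p\<in>A. \<forall>q\<in>A. p * q \<in> A)"


section \<open>The Connes-Kreimer Hopf algebra\<close>

text \<open>Non-planar rooted trees: a tree is given by the multiset of the subtrees at its root.\<close>

datatype rtree = Node "rtree multiset"

type_synonym forest = "rtree multiset"

type_synonym hck = "forest \<Rightarrow>\<^sub>0 complex"

definition Bplus :: "hck \<Rightarrow> hck" where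
  "Bplus = lin_ext (\<lambda>F. basis {#Node F#})"

text \<open>
  The coproduct on trees: \<open>M\<close> is the forest with \<open>Node M = B\<^sup>+(M)\<close>, and the product over the trees of
  \<open>M\<close>, taken in the tensor square, is the value of the coproduct on \<open>M\<close>.
\<close>

primrec coproduct_tree :: "rtree \<Rightarrow> (forest \<times> forest \<Rightarrow>\<^sub>0 complex)" where
  "coproduct_tree (Node M) =
     tensor 1 (basis {#Node M#}) +
     tensor_map Bplus id (prod_mset (image_mset coproduct_tree M))"

definition coproduct :: "hck \<Rightarrow> (forest \<times> forest \<Rightarrow>\<^sub>0 complex)" where
  "coproduct = lin_ext (\<lambda>F. prod_mset (image_mset coproduct_tree F))"

definition counit :: "hck \<Rightarrow> complex" where
  "counit p = Poly_Mapping.lookup p {#}"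

definition mult_map :: "(forest \<times> forest \<Rightarrow>\<^sub>0 complex) \<Rightarrow> hck" where
  "mult_map = lin_ext (\<lambda>(F, G). basis F * basis G)"

definition is_antipode :: "(hck \<Rightarrow> hck) \<Rightarrow> bool" where
  "is_antipode S \<longleftrightarrow> Vector_Spaces.linear pscale pscale S \<and>
     (\<forall>p. mult_map (tensor_map S id (coproduct p)) = pscale (counit p) 1) \<and>
     (\<forall>p. mult_map (tensor_map id S (coproduct p)) = pscale (counit p) 1)"

text \<open>
  A Hopf subalgebra is a subalgebra and subcoalgebra that is stable under the antipode. The antipode
  is unique, being the convolution inverse of the identity.
\<close>

definition hopf_subalgebra :: "hck set \<Rightarrow> bool" where
  "hopf_subalgebra A \<longleftrightarrow> subalgebra A \<and> coproduct ` A \<subseteq> tensor_square A \<and>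
     (\<exists>S. is_antipode S \<and> S ` A \<subseteq> A)"


section \<open>The subalgebra generated by the solution of the Dyson-Schwinger equation\<close>

text \<open>
  A finitely supported sequence of naturals, written \<open>nat \<Rightarrow>\<^sub>0 nat\<close>, is the exponent of a monomial in
  the variables \<open>X\<^sub>i\<close>. A power series in all the \<open>X\<^sub>i\<close> is its family of coefficients.
\<close>

type_synonym exponent = "nat \<Rightarrow>\<^sub>0 nat"

type_synonym series = "exponent \<Rightarrow> hck"

definition Lambda :: "exponent set" where
  "Lambda = {\<alpha>. \<alpha> \<noteq> 0}"

definition var :: "nat \<Rightarrow> series" where
  "var i = (\<lambda>\<alpha>. if \<alpha> = Poly_Mapping.single i 1 then 1 else 0)"

definition series_mult :: "series \<Rightarrow> series \<Rightarrow> series" where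
  "series_mult P Q = (\<lambda>\<alpha>. \<Sum>(\<beta>, \<gamma>) | \<beta> + \<gamma> = \<alpha>. P \<beta> * Q \<gamma>)"

primrec series_power :: "series \<Rightarrow> nat \<Rightarrow> series" where
  "series_power P 0 = (\<lambda>\<alpha>. if \<alpha> = 0 then 1 else 0)"
| "series_power P (Suc n) = series_mult P (series_power P n)"

text \<open>The index set of the sum in \<^const>\<open>series_mult\<close> is finite.\<close>

lemma finite_exponent_splits: "finite {(\<beta>, \<gamma>). \<beta> + \<gamma> = (\<alpha> :: exponent)}"
proof -
  let ?S = "{(\<beta>, \<gamma>). \<beta> + \<gamma> = \<alpha>}"
  let ?K = "Poly_Mapping.keys \<alpha>"
  let ?m = "\<Sum>i\<in>?K. Poly_Mapping.lookup \<alpha> i"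
  let ?B = "{g. \<forall>i. (i \<in> ?K \<longrightarrow> g i \<in> {..?m}) \<and> (i \<notin> ?K \<longrightarrow> g i = 0)}"
  have fin: "finite ?B"
    by (rule finite_set_of_finite_funs) simp_all
  have "(Poly_Mapping.lookup \<circ> fst) s \<in> ?B" if "s \<in> ?S" for s
  proof -
    have "Poly_Mapping.lookup \<alpha> i = Poly_Mapping.lookup (fst s) i + Poly_Mapping.lookup (snd s) i" for i
      using that by (auto simp: lookup_add)
    then have le: "Poly_Mapping.lookup (fst s) i \<le> Poly_Mapping.lookup \<alpha> i" for i
      by simp
    have bound: "Poly_Mapping.lookup (fst s) i \<le> ?m" if "i \<in> ?K" for i
      using le[of i] member_le_sum[OF that, of "Poly_Mapping.lookup \<alpha>"] by simp
    have zero: "Poly_Mapping.lookup (fst s) i = 0" if "i \<notin> ?K" for i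
      using le[of i] that by (simp add: in_keys_iff)
    show ?thesis
      using bound zero by simp
  qed
  then have "finite ((Poly_Mapping.lookup \<circ> fst) ` ?S)"
    by (intro finite_subset[OF _ fin] image_subsetI)
  moreover have "inj_on (Poly_Mapping.lookup \<circ> fst) ?S"
    by (rule inj_onI) (auto simp: lookup_inject)
  ultimately show ?thesis
    by (rule finite_imageD)
qed

text \<open>
  The sum over all \<open>i\<close> is taken coefficientwise; the \<open>i\<close>-th summand contributes to the coefficient of
  \<open>X\<^sup>\<alpha>\<close> only if \<open>i\<close> lies in the support of \<open>\<alpha>\<close>, so \<^const>\<open>Sum_any\<close> is applied to finite supports.
\<close>

definition dse_rhs :: "complex fps \<Rightarrow> series \<Rightarrow> series" where
  "dse_rhs f F = (\<lambda>\<alpha>. Bplus (Sum_any (\<lambda>i.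
      pscale (fps_nth f i) (series_mult (var i) (series_power F i) \<alpha>))))"

definition dse_solution :: "complex fps \<Rightarrow> series" where
  "dse_solution f = (THE F. F = dse_rhs f F)"

definition H_sub :: "complex fps \<Rightarrow> hck set" where
  "H_sub f = subalgebra hull (dse_solution f ` Lambda)"


section \<open>The map \<open>\<Psi>\<close>\<close>

definition list_of_mset :: "'k multiset \<Rightarrow> 'k list" where
  "list_of_mset M = (SOME xs. mset xs = M)"

text \<open>
  Vertices are encoded as addresses: the root of a tree is the empty list, and after the choice of
  an enumeration of the trees of a forest, the vertex with address \<open>p\<close> in the \<open>i\<close>-th tree has address
  \<open>i # p\<close> in the forest. Thus the children of a vertex \<open>v\<close> are the vertices of the form \<open>v @ [i]\<close>.
\<close>

definition disjoint_vertices :: "nat list set multiset \<Rightarrow> nat list set" where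
  "disjoint_vertices M =
     (let Vs = list_of_mset M in {i # p | i p. i < length Vs \<and> p \<in> Vs ! i})"

primrec tree_vertices :: "rtree \<Rightarrow> nat list set" where
  "tree_vertices (Node M) = insert [] (disjoint_vertices (image_mset tree_vertices M))"

definition forest_vertices :: "forest \<Rightarrow> nat list set" where
  "forest_vertices F = disjoint_vertices (image_mset tree_vertices F)"

definition child_of :: "nat list \<Rightarrow> nat list \<Rightarrow> bool" where
  "child_of u v \<longleftrightarrow> (\<exists>i. u = v @ [i])"

text \<open>
  Automorphisms of a rooted forest: permutations of the vertices that preserve the child relation
  in both directions (hence map roots to roots).
\<close>

definition forest_automorphisms :: "forest \<Rightarrow> (nat list \<Rightarrow> nat list) set" where
  "forest_automorphisms F = {\<sigma>. \<sigma> permutes forest_vertices F \<and>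
     (\<forall>u\<in>forest_vertices F. \<forall>v\<in>forest_vertices F. child_of (\<sigma> u) (\<sigma> v) \<longleftrightarrow> child_of u v)}"

definition sym_factor :: "forest \<Rightarrow> nat" where
  "sym_factor F = card (forest_automorphisms F)"

definition forest_pairing :: "hck \<Rightarrow> hck \<Rightarrow> complex" where
  "forest_pairing = bilin_ext (\<lambda>F G. if F = G then of_nat (sym_factor F) else 0)"

text \<open>
  The monomials \<open>x\<^sup>\<alpha>\<close> with \<open>\<alpha> \<in> \<Lambda>\<close> form a basis of the space of polynomials without constant term.
  Therefore the symmetric algebra of that space has as basis the multisets of elements of \<open>\<Lambda>\<close>, where
  \<open>{#\<alpha>\<^sub>1, \<dots>, \<alpha>\<^sub>k#}\<close> stands for \<open>x\<^bsup>\<alpha>\<^sub>1\<^esup> | \<dots> | x\<^bsup>\<alpha>\<^sub>k\<^esup>\<close>. The symmetric algebra over the dual variables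
  \<open>X\<^sub>i\<close> is encoded in the same way.
\<close>

type_synonym sym_alg = "exponent multiset \<Rightarrow>\<^sub>0 complex"

definition Sym_plus :: "sym_alg set" where
  "Sym_plus = {a. \<forall>M\<in>Poly_Mapping.keys a. set_mset M \<subseteq> Lambda}"

definition monomial_pairing :: "exponent \<Rightarrow> exponent \<Rightarrow> complex" where
  "monomial_pairing \<alpha> \<beta> =
     (if \<alpha> = \<beta> then (\<Prod>i\<in>Poly_Mapping.keys \<alpha>. fact (Poly_Mapping.lookup \<alpha> i)) else 0)"

text \<open>The value below does not depend on the chosen enumerations of the two multisets.\<close>

definition multiset_pairing :: "exponent multiset \<Rightarrow> exponent multiset \<Rightarrow> complex" where
  "multiset_pairing M N =
     (let P = list_of_mset M; Q = list_of_mset N in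
      if length P = length Q
      then \<Sum>\<sigma> | \<sigma> permutes {..<length P}. \<Prod>i<length P. monomial_pairing (P ! i) (Q ! \<sigma> i)
      else 0)"

definition sym_pairing :: "sym_alg \<Rightarrow> sym_alg \<Rightarrow> complex" where
  "sym_pairing = bilin_ext multiset_pairing"

definition fertility :: "rtree \<Rightarrow> nat list \<Rightarrow> nat" where
  "fertility T v = card {u \<in> tree_vertices T. child_of u v}"

definition N_exponent :: "rtree \<Rightarrow> exponent" where
  "N_exponent T = (\<Sum>v\<in>tree_vertices T. Poly_Mapping.single (fertility T v) 1)"

definition Theta :: "hck \<Rightarrow> sym_alg" where
  "Theta = lin_ext (\<lambda>F. basis (image_mset N_exponent F))"

definition Psi :: "sym_alg \<Rightarrow> hck" where
  "Psi a = (THE p. \<forall>F. forest_pairing p (basis F) = sym_pairing a (Theta (basis F)))"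

end

theory Submission
  imports Defs "HOL-Combinatorics.Multiset_Permutations" "HOL-Library.FuncSet"
begin

text \<open>
  The solution of the Dyson-Schwinger equation has the components
  \<open>T\<^sub>\<alpha> = (\<Prod>i. (i! a\<^sub>i)\<^bsup>\<alpha>\<^sub>i\<^esup>) t\<^sub>\<alpha>\<close>, where \<open>t\<^sub>\<alpha>\<close> is the sum of \<open>T / s\<^sub>T\<close> over all trees \<open>T\<close> with
  \<open>N(T) = X\<^sup>\<alpha>\<close>. So \<open>H\<^sub>f\<close> is generated by the \<open>t\<^sub>\<alpha>\<close> with \<open>\<alpha>\<close> supported in \<open>I = {i. a\<^sub>i \<noteq> 0}\<close>.

  Truncate the variables to \<open>X\<^sub>0, \<dots>, X\<^sub>m\<close>, let \<open>A\<close> be the series of the \<open>1 \<otimes> t\<^sub>\<alpha>\<close> and put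
  \<open>G\<^sub>j = \<Sum>k. X\<^bsub>j+k\<^esub> A\<^sup>k / k!\<close>. The cocycle equation for \<open>B\<^sup>+\<close> and Taylor expansion show that the series
  of the \<open>\<Delta>(t\<^sub>\<alpha>) - 1 \<otimes> t\<^sub>\<alpha>\<close> satisfies the equation that is obtained from the one of the series of the
  \<open>t\<^sub>\<alpha> \<otimes> 1\<close> by substituting \<open>G\<^sub>j\<close> for \<open>X\<^sub>j\<close>; hence it equals \<open>\<Sum>\<beta>. (t\<^sub>\<beta> \<otimes> 1) G\<^sup>\<beta>\<close>. If \<open>I\<close> is an
  initial segment of \<open>\<nat>\<close>, all its coefficients lie in \<open>H\<^sub>f \<otimes> H\<^sub>f\<close>. Conversely, if \<open>0, i + 1 \<in> I\<close>, then the
  coproduct of the corolla with \<open>i + 1\<close> leaves contains the corolla with \<open>i\<close> leaves, tensored with a leaf,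
  which forces \<open>i \<in> I\<close>. The antipode exists and preserves every sub-bialgebra because it is a locally
  finite geometric series for the convolution product.

  Finally \<open>\<Psi>(x\<^bsup>\<alpha>\<^sub>1\<^esup> | \<dots> | x\<^bsup>\<alpha>\<^sub>k\<^esup>)\<close> is the product of the \<open>\<alpha>\<^sub>i! t\<^bsub>\<alpha>\<^sub>i\<^esub>\<close>, since the number of automorphisms of a
  forest is \<open>\<Prod>T. m\<^sub>T! s\<^sub>T\<^bsup>m\<^sub>T\<^esup>\<close>, where \<open>m\<^sub>T\<close> is the multiplicity of \<open>T\<close>.
\<close>

section \<open>Linear and bilinear extension\<close>

text \<open>The weights \<open>1 / s_T\<close> make sums over trees obey functional equations: a
  multiset \<open>M\<close> of \<open>k\<close> trees has \<open>k! / mfact M\<close> orderings, so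
  the sum over all \<open>Node M\<close> with \<open>size M = k\<close> is \<open>1 / k!\<close>
  times an operator applied to the \<open>k\<close>-th power of the whole series.
  \<open>tree_sum_exponential\<close> states this for an arbitrary linear operator; it is used with
  \<open>Bplus\<close> for the Dyson-Schwinger equation, where the \<open>i!\<close> in the
  coefficients cancels the \<open>1 / k!\<close>, and with \<open>tensor_map Bplus id\<close> for
  the coproduct. Taylor expansion works because that second operator is linear over the elements
  \<open>1 \<otimes> h\<close>, so powers of \<open>A\<close> leave it. The right-hand sides of all
  equations gain a degree, whence solutions are unique. The truncation makes \<open>G j\<close> a
  finite sum, and zero for \<open>j > m\<close>, so that only generators with indices up to
  \<open>m\<close> occur. When \<open>a_0 = 0\<close> the algebra consists of scalars: every tree
  has a leaf, hence \<open>t_\<alpha>\<close> is zero for every \<alpha> supported in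
  \<open>I\<close>. In the converse nothing can cancel, as for \<open>n > 0\<close> the corolla with
  \<open>n\<close> leaves is the only tree with its fertilities.\<close>

abbreviation plinear :: "(('k \<Rightarrow>\<^sub>0 complex) \<Rightarrow> ('l \<Rightarrow>\<^sub>0 complex)) \<Rightarrow> bool" where
  "plinear \<equiv> Vector_Spaces.linear pscale pscale"

lemma plinearI:
  assumes "\<And>p q. \<phi> (p + q) = \<phi> p + \<phi> q" "\<And>c p. \<phi> (pscale c p) = pscale c (\<phi> p)"
  shows "plinear \<phi>"
  by unfold_locales (use assms in auto)

lemma plinear_add: "plinear \<phi> \<Longrightarrow> \<phi> (p + q) = \<phi> p + \<phi> q"
  by (simp add: linear_iff_module_hom module_hom.add)

lemma plinear_pscale: "plinear \<phi> \<Longrightarrow> \<phi> (pscale c p) = pscale c (\<phi> p)"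
  by (simp add: linear_iff_module_hom module_hom.scale)

lemma plinear_zero: "plinear \<phi> \<Longrightarrow> \<phi> 0 = 0"
  by (simp add: linear_iff_module_hom module_hom.zero)

lemma plinear_sum: "plinear \<phi> \<Longrightarrow> \<phi> (sum g A) = (\<Sum>x\<in>A. \<phi> (g x))"
  by (simp add: linear_iff_module_hom module_hom.sum)

lemma plinear_id: "plinear id" "plinear (\<lambda>p. p)"
  by (auto intro: plinearI)

lemma plinear_comp: "plinear \<phi> \<Longrightarrow> plinear \<psi> \<Longrightarrow> plinear (\<lambda>p. \<phi> (\<psi> p))"
  by (rule plinearI) (simp_all add: plinear_add plinear_pscale)

lemma plinear_minus: "plinear \<phi> \<Longrightarrow> plinear \<psi> \<Longrightarrow> plinear (\<lambda>p. \<phi> p - \<psi> p)"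
  by (rule plinearI) (simp_all add: plinear_add plinear_pscale pscale.scale_right_diff_distrib)

lemma lookup_basis: "Poly_Mapping.lookup (basis k) l = (if k = l then 1 else 0)"
  by (simp add: basis_def lookup_single when_def)

lemma basis_zero: "basis 0 = 1"
  by (simp add: basis_def)

lemma keys_basis [simp]: "Poly_Mapping.keys (basis k) = {k}"
  by (simp add: basis_def)

lemma basis_mult: "basis k * basis l = basis (k + l)"
  by (simp add: basis_def mult_single)

lemma pscale_conv_mult: "pscale c p = Poly_Mapping.single 0 c * p"
  by (simp add: pscale_def mult_map_scale_conv_mult)

lemma pscale_mult_left: "pscale c p * q = pscale c (p * q)"
  by (simp add: pscale_conv_mult mult.assoc)

lemma pscale_mult_right: "p * pscale c q = pscale c (p * (q :: 'k::comm_monoid_add \<Rightarrow>\<^sub>0 complex))"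
  by (simp add: pscale_conv_mult mult.left_commute)

lemma poly_mapping_superset_sum:
  assumes "finite A" "Poly_Mapping.keys p \<subseteq> A"
  shows "p = (\<Sum>k\<in>A. pscale (Poly_Mapping.lookup p k) (basis k))"
proof (rule poly_mapping_eqI)
  fix k
  have "Poly_Mapping.lookup (\<Sum>k\<in>A. pscale (Poly_Mapping.lookup p k) (basis k)) k =
      (\<Sum>l\<in>A. if l = k then Poly_Mapping.lookup p l else 0)"
    by (auto simp: lookup_sum lookup_basis intro!: sum.cong)
  also have "\<dots> = Poly_Mapping.lookup p k"
    using assms by (auto simp: in_keys_iff)
  finally show "Poly_Mapping.lookup p k = Poly_Mapping.lookup (\<Sum>k\<in>A. pscale (Poly_Mapping.lookup p k) (basis k)) k"
    by simp
qed

lemma poly_mapping_basis_sum: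
  "p = (\<Sum>k\<in>Poly_Mapping.keys p. pscale (Poly_Mapping.lookup p k) (basis k))"
  by (rule poly_mapping_superset_sum) auto

lemma basis_induct [case_names zero add scale basis]:
  assumes "P 0" "\<And>p q. P p \<Longrightarrow> P q \<Longrightarrow> P (p + q)" "\<And>c p. P p \<Longrightarrow> P (pscale c p)" "\<And>k. P (basis k)"
  shows "P p"
proof -
  have "P (\<Sum>k\<in>A. pscale (Poly_Mapping.lookup p k) (basis k))" if "finite A" for A
    using that by induction (auto intro: assms)
  then show ?thesis
    by (subst poly_mapping_basis_sum) simp
qed

lemma plinear_eqI:
  assumes "plinear \<phi>" "plinear \<psi>" "\<And>k. \<phi> (basis k) = \<psi> (basis k)"
  shows "\<phi> p = \<psi> p"
  by (induction p rule: basis_induct) (use assms in \<open>simp_all add: plinear_add plinear_pscale plinear_zero\<close>)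

lemma lin_ext_superset:
  assumes "finite A" "Poly_Mapping.keys p \<subseteq> A"
  shows "lin_ext g p = (\<Sum>k\<in>A. pscale (Poly_Mapping.lookup p k) (g k))"
  unfolding lin_ext_def by (rule sum.mono_neutral_left) (use assms in \<open>auto simp: in_keys_iff\<close>)

lemma plinear_lin_ext: "plinear (lin_ext g)"
proof (rule plinearI)
  fix p q :: "'a \<Rightarrow>\<^sub>0 complex"
  let ?A = "Poly_Mapping.keys p \<union> Poly_Mapping.keys q"
  have "lin_ext g (p + q) = (\<Sum>k\<in>?A. pscale (Poly_Mapping.lookup (p + q) k) (g k))"
    by (rule lin_ext_superset) (simp_all add: keys_add)
  also have "\<dots> = lin_ext g p + lin_ext g q"
    by (simp add: lin_ext_superset[of ?A p] lin_ext_superset[of ?A q] lookup_add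
        pscale.scale_left_distrib sum.distrib)
  finally show "lin_ext g (p + q) = lin_ext g p + lin_ext g q" .
next
  fix c and p :: "'a \<Rightarrow>\<^sub>0 complex"
  have "lin_ext g (pscale c p) = (\<Sum>k\<in>Poly_Mapping.keys p. pscale (Poly_Mapping.lookup (pscale c p) k) (g k))"
    by (rule lin_ext_superset) (auto simp: in_keys_iff)
  then show "lin_ext g (pscale c p) = pscale c (lin_ext g p)"
    by (simp add: lin_ext_def pscale.scale_sum_right)
qed

lemma lin_ext_basis [simp]: "lin_ext g (basis k) = g k"
  by (simp add: lin_ext_def lookup_basis)

lemma lookup_lin_ext:
  "Poly_Mapping.lookup (lin_ext g p) l =
     (\<Sum>k\<in>Poly_Mapping.keys p. Poly_Mapping.lookup p k * Poly_Mapping.lookup (g k) l)"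
  by (simp add: lin_ext_def lookup_sum)

text \<open>The product is bilinear, so multiplicativity on basis vectors suffices. The coproduct,
  both iterated coproducts, the counit projections and \<open>Psi\<close> become algebra morphisms
  this way.\<close>

lemma lin_ext_mult:
  fixes g :: "'k::comm_monoid_add \<Rightarrow> ('l::comm_monoid_add \<Rightarrow>\<^sub>0 complex)"
  assumes "\<And>k l. g (k + l) = g k * g l"
  shows "lin_ext g (p * q) = lin_ext g p * lin_ext g q"
proof (induction p rule: basis_induct)
  case (basis k)
  show ?case
    by (induction q rule: basis_induct)
      (simp_all add: plinear_add[OF plinear_lin_ext] plinear_pscale[OF plinear_lin_ext]
        plinear_zero[OF plinear_lin_ext] distrib_left pscale_mult_right basis_mult assms)
qed (simp_all add: plinear_add[OF plinear_lin_ext] plinear_pscale[OF plinear_lin_ext]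
      plinear_zero[OF plinear_lin_ext] distrib_right pscale_mult_left)

lemma lookup_tensor [simp]:
  "Poly_Mapping.lookup (tensor p q) (k, l) = Poly_Mapping.lookup p k * Poly_Mapping.lookup q l"
proof -
  have "Poly_Mapping.lookup (tensor p q) (k, l) =
      (\<Sum>k'\<in>Poly_Mapping.keys p. \<Sum>l'\<in>Poly_Mapping.keys q.
        if k' = k \<and> l' = l then Poly_Mapping.lookup p k' * Poly_Mapping.lookup q l' else 0)"
    by (auto simp: tensor_def lookup_sum lookup_single when_def intro!: sum.cong)
  also have "\<dots> = (\<Sum>k'\<in>Poly_Mapping.keys p. if k' = k then
        (\<Sum>l'\<in>Poly_Mapping.keys q. if l' = l then Poly_Mapping.lookup p k' * Poly_Mapping.lookup q l' else 0) else 0)"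
    by (intro sum.cong) auto
  also have "\<dots> = Poly_Mapping.lookup p k * Poly_Mapping.lookup q l"
    by (auto simp: in_keys_iff)
  finally show ?thesis .
qed

lemma tensor_add_left: "tensor (p + p') q = tensor p q + tensor p' q"
  by (rule poly_mapping_eqI) (auto simp: lookup_add algebra_simps)

lemma tensor_add_right: "tensor p (q + q') = tensor p q + tensor p q'"
  by (rule poly_mapping_eqI) (auto simp: lookup_add algebra_simps)

lemma tensor_pscale_left: "tensor (pscale c p) q = pscale c (tensor p q)"
  by (rule poly_mapping_eqI) auto

lemma tensor_pscale_right: "tensor p (pscale c q) = pscale c (tensor p q)"
  by (rule poly_mapping_eqI) auto

lemma tensor_zero_left [simp]: "tensor 0 q = 0"
  by (rule poly_mapping_eqI) auto

lemma tensor_zero_right [simp]: "tensor p 0 = 0"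
  by (rule poly_mapping_eqI) auto

lemma plinear_tensor_left: "plinear (\<lambda>p. tensor p q)"
  by (rule plinearI) (simp_all add: tensor_add_left tensor_pscale_left)

lemma plinear_tensor_right: "plinear (\<lambda>q. tensor p q)"
  by (rule plinearI) (simp_all add: tensor_add_right tensor_pscale_right)

lemma tensor_basis: "tensor (basis k) (basis l) = basis (k, l)"
  by (rule poly_mapping_eqI) (auto simp: lookup_basis split: if_splits)

lemma tensor_one: "tensor 1 1 = 1"
  unfolding basis_zero[symmetric] tensor_basis by (simp add: zero_prod_def)

lemma plinear_mult_left: "plinear (\<lambda>q. (p :: 'k::comm_monoid_add \<Rightarrow>\<^sub>0 complex) * q)"
  by (rule plinearI) (simp_all add: distrib_left pscale_mult_right)

lemma plinear_mult_right: "plinear (\<lambda>p. p * (q :: 'k::comm_monoid_add \<Rightarrow>\<^sub>0 complex))"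
  by (rule plinearI) (simp_all add: distrib_right pscale_mult_left)

text \<open>Both sides are linear in each of the four arguments; the steps \<open>1\<close>,
  \<open>2\<close>, \<open>3\<close> and the last one free \<open>p\<close>, \<open>q\<close>,
  \<open>p'\<close> and \<open>q'\<close> in turn from being basis vectors.\<close>

lemma tensor_mult:
  fixes p p' :: "'k::comm_monoid_add \<Rightarrow>\<^sub>0 complex" and q q' :: "'l::comm_monoid_add \<Rightarrow>\<^sub>0 complex"
  shows "tensor p q * tensor p' q' = tensor (p * p') (q * q')"
proof -
  note simps = tensor_add_left tensor_add_right tensor_pscale_left tensor_pscale_right
    distrib_left distrib_right pscale_mult_left pscale_mult_right
  have 1: "tensor p (basis l) * tensor (basis k') (basis l') =
      tensor (p * basis k') (basis l * basis l')" for k' :: 'k and l l' :: 'l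
    by (induction p rule: basis_induct) (simp_all add: simps tensor_basis basis_mult)
  have 2: "tensor p q * tensor (basis k') (basis l') =
      tensor (p * basis k') (q * basis l')" for k' :: 'k and l' :: 'l
    by (induction q rule: basis_induct) (simp_all add: simps 1)
  have 3: "tensor p q * tensor p' (basis l') = tensor (p * p') (q * basis l')" for l' :: 'l
    by (induction p' rule: basis_induct) (simp_all add: simps 2)
  show ?thesis
    by (induction q' rule: basis_induct) (simp_all add: simps 3)
qed

lemma plinear_tensor_map: "plinear (tensor_map g h)"
  unfolding tensor_map_def by (rule plinear_lin_ext)

lemma tensor_map_basis: "tensor_map g h (basis (k, l)) = tensor (g (basis k)) (h (basis l))"
  by (simp add: tensor_map_def)

text \<open>\<open>tensor_map\<close> looks at \<open>g\<close> and \<open>h\<close> on basis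
  vectors only; linearity extends the formula to all pure tensors.\<close>

lemma tensor_map_tensor:
  assumes "plinear g" "plinear h"
  shows "tensor_map g h (tensor p q) = tensor (g p) (h q)"
proof -
  note simps = tensor_add_left tensor_add_right tensor_pscale_left tensor_pscale_right
    plinear_add[OF plinear_tensor_map] plinear_pscale[OF plinear_tensor_map] plinear_zero[OF plinear_tensor_map]
  have 1: "tensor_map g h (tensor p (basis l)) = tensor (g p) (h (basis l))" for l
    by (induction p rule: basis_induct)
      (simp_all add: simps plinear_add[OF assms(1)] plinear_pscale[OF assms(1)] plinear_zero[OF assms(1)]
        tensor_basis tensor_map_basis)
  show ?thesis
    by (induction q rule: basis_induct)
      (simp_all add: simps plinear_add[OF assms(2)] plinear_pscale[OF assms(2)] plinear_zero[OF assms(2)] 1)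
qed

lemma plinear_image_span:
  assumes "plinear \<phi>" "\<And>p. p \<in> S \<Longrightarrow> \<phi> p \<in> W" "pscale.subspace W" "p \<in> pscale.span S"
  shows "\<phi> p \<in> W"
  using assms(4)
proof (induction rule: pscale.span_induct_alt)
  case base
  then show ?case using assms(1,3) by (simp add: plinear_zero pscale.subspace_0)
next
  case (step c x y)
  then show ?case using assms
    by (simp add: plinear_add plinear_pscale pscale.subspace_add pscale.subspace_scale)
qed


section \<open>Subalgebras and tensor squares\<close>

lemma subspace_tensor_square: "pscale.subspace (tensor_square A)"
  by (simp add: tensor_square_def)

lemma tensor_in_tensor_square: "p \<in> A \<Longrightarrow> q \<in> A \<Longrightarrow> tensor p q \<in> tensor_square A"
  unfolding tensor_square_def by (auto intro: pscale.span_base)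

text \<open>Products of pure tensors are pure tensors of products. The span is entered in one factor
  at a time: the right factor varies while the left one is pure, and afterwards the left one
  varies.\<close>

lemma subalgebra_tensor_square:
  fixes A :: "('k::comm_monoid_add \<Rightarrow>\<^sub>0 complex) set"
  assumes "subalgebra A"
  shows "subalgebra (tensor_square A)"
  unfolding subalgebra_def
proof (intro conjI ballI subspace_tensor_square)
  show "1 \<in> tensor_square A"
    using assms tensor_in_tensor_square[of 1 A 1] by (simp add: subalgebra_def tensor_one)
  fix x y assume x: "x \<in> tensor_square A" and y: "y \<in> tensor_square A"
  have *: "tensor p q * y \<in> tensor_square A" if "p \<in> A" "q \<in> A" for p q
    using y unfolding tensor_square_def
    by (rule plinear_image_span[OF plinear_mult_left, rotated 2])
      (use assms that in \<open>auto simp: tensor_mult subalgebra_def tensor_square_def[symmetric]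
        subspace_tensor_square intro!: tensor_in_tensor_square\<close>)
  show "x * y \<in> tensor_square A"
    using x unfolding tensor_square_def
    by (rule plinear_image_span[OF plinear_mult_right, rotated 2])
      (use * in \<open>auto simp: tensor_square_def[symmetric] subspace_tensor_square\<close>)
qed

lemma subalgebra_hull: "subalgebra (subalgebra hull S)"
  by (rule hull_in) (auto simp: subalgebra_def intro!: pscale.subspace_Inter)

lemma subalgebra_add: "subalgebra A \<Longrightarrow> p \<in> A \<Longrightarrow> q \<in> A \<Longrightarrow> p + q \<in> A"
  by (simp add: subalgebra_def pscale.subspace_add)

lemma subalgebra_diff: "subalgebra A \<Longrightarrow> p \<in> A \<Longrightarrow> q \<in> A \<Longrightarrow> p - q \<in> A"
  by (simp add: subalgebra_def pscale.subspace_diff)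

lemma subalgebra_pscale: "subalgebra A \<Longrightarrow> p \<in> A \<Longrightarrow> pscale c p \<in> A"
  by (simp add: subalgebra_def pscale.subspace_scale)

lemma subalgebra_zero: "subalgebra A \<Longrightarrow> 0 \<in> A"
  by (simp add: subalgebra_def pscale.subspace_0)

lemma subalgebra_one: "subalgebra A \<Longrightarrow> 1 \<in> A"
  by (simp add: subalgebra_def)

lemma subalgebra_mult: "subalgebra A \<Longrightarrow> p \<in> A \<Longrightarrow> q \<in> A \<Longrightarrow> p * q \<in> A"
  by (simp add: subalgebra_def)

lemma subalgebra_sum: "subalgebra A \<Longrightarrow> (\<And>x. x \<in> S \<Longrightarrow> g x \<in> A) \<Longrightarrow> sum g S \<in> A"
  unfolding subalgebra_def by (auto intro: pscale.subspace_sum)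

text \<open>Together with \<open>hull_minimal\<close> this carries a property of an algebra morphism
  from generators to the subalgebra they generate.\<close>

lemma subalgebra_vimage:
  fixes \<phi> :: "('k::comm_monoid_add \<Rightarrow>\<^sub>0 complex) \<Rightarrow> ('l::comm_monoid_add \<Rightarrow>\<^sub>0 complex)"
  assumes "plinear \<phi>" "\<phi> 1 = 1" "\<And>p q. \<phi> (p * q) = \<phi> p * \<phi> q" "subalgebra B"
  shows "subalgebra (\<phi> -` B)"
  using assms unfolding subalgebra_def pscale.subspace_def
  by (auto simp: plinear_zero plinear_add plinear_pscale)


section \<open>Coassociativity and the antipode of the Connes-Kreimer algebra\<close>

definition cop :: "forest \<Rightarrow> (forest \<times> forest \<Rightarrow>\<^sub>0 complex)" where
  "cop F = prod_mset (image_mset coproduct_tree F)"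

lemma coproduct_eq_lin_ext: "coproduct = lin_ext cop"
  by (simp add: coproduct_def cop_def[abs_def])

lemma coproduct_basis [simp]: "coproduct (basis F) = cop F"
  by (simp add: coproduct_eq_lin_ext)

lemma cop_simps [simp]: "cop {#} = 1" "cop {#t#} = coproduct_tree t" "cop (F + G) = cop F * cop G"
  by (simp_all add: cop_def)

lemma plinear_coproduct: "plinear coproduct"
  unfolding coproduct_eq_lin_ext by (rule plinear_lin_ext)

lemma coproduct_mult: "coproduct (p * q) = coproduct p * coproduct q"
  unfolding coproduct_eq_lin_ext by (rule lin_ext_mult) simp

lemma coproduct_one: "coproduct 1 = 1"
  unfolding basis_zero[symmetric] coproduct_basis by (simp add: basis_zero)

lemma Bplus_basis [simp]: "Bplus (basis F) = basis {#Node F#}"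
  by (simp add: Bplus_def)

lemma plinear_Bplus: "plinear Bplus"
  unfolding Bplus_def by (rule plinear_lin_ext)

lemma coproduct_tree_Node:
  "coproduct_tree (Node M) = tensor 1 (basis {#Node M#}) + tensor_map Bplus id (cop M)"
  by (simp add: cop_def)

declare coproduct_tree.simps [simp del]

text \<open>The two iterated coproducts take values over differently nested triples; this is the
  associator between them.\<close>

definition reassoc :: "(('a \<times> 'b) \<times> 'c \<Rightarrow>\<^sub>0 complex) \<Rightarrow> ('a \<times> 'b \<times> 'c \<Rightarrow>\<^sub>0 complex)" where
  "reassoc = lin_ext (\<lambda>((a, b), c). basis (a, b, c))"

lemma reassoc_basis: "reassoc (basis ((a, b), c)) = basis (a, b, c)"
  by (simp add: reassoc_def)

lemma plinear_reassoc: "plinear reassoc"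
  unfolding reassoc_def by (rule plinear_lin_ext)

lemma reassoc_mult:
  "reassoc (p * q) = reassoc p * (reassoc q :: 'a::comm_monoid_add \<times> 'b::comm_monoid_add \<times> 'c::comm_monoid_add \<Rightarrow>\<^sub>0 complex)"
  unfolding reassoc_def by (rule lin_ext_mult) (auto simp: basis_mult)

lemma reassoc_tensor: "reassoc (tensor (tensor p q) r) = tensor p (tensor q r)"
proof -
  note simps = tensor_add_left tensor_add_right tensor_pscale_left tensor_pscale_right
    plinear_add[OF plinear_reassoc] plinear_pscale[OF plinear_reassoc] plinear_zero[OF plinear_reassoc]
  have 1: "reassoc (tensor (tensor p (basis b)) (basis c)) = tensor p (tensor (basis b) (basis c))" for b c
    by (induction p rule: basis_induct) (simp_all add: simps tensor_basis, simp add: reassoc_def)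
  have 2: "reassoc (tensor (tensor p q) (basis c)) = tensor p (tensor q (basis c))" for c
    by (induction q rule: basis_induct) (simp_all add: simps 1)
  show ?thesis
    by (induction r rule: basis_induct) (simp_all add: simps 2)
qed

text \<open>The map \<open>\<Delta> \<otimes> id\<close>, moved to right-nested triples;
  \<open>cop_right\<close> is \<open>id \<otimes> \<Delta>\<close>.\<close>

definition cop_left :: "(forest \<times> forest \<Rightarrow>\<^sub>0 complex) \<Rightarrow> (forest \<times> forest \<times> forest \<Rightarrow>\<^sub>0 complex)" where
  "cop_left = lin_ext (\<lambda>(k, l). reassoc (tensor (cop k) (basis l)))"

definition cop_right :: "(forest \<times> forest \<Rightarrow>\<^sub>0 complex) \<Rightarrow> (forest \<times> forest \<times> forest \<Rightarrow>\<^sub>0 complex)" where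
  "cop_right = lin_ext (\<lambda>(k, l). tensor (basis k) (cop l))"

lemma cop_left_basis: "cop_left (basis (k, l)) = reassoc (tensor (cop k) (basis l))"
  by (simp add: cop_left_def)

lemma plinear_cop_left: "plinear cop_left"
  unfolding cop_left_def by (rule plinear_lin_ext)

lemma plinear_cop_right: "plinear cop_right"
  unfolding cop_right_def by (rule plinear_lin_ext)

lemma cop_left_mult: "cop_left (p * q) = cop_left p * cop_left q"
  unfolding cop_left_def
  by (rule lin_ext_mult) (auto simp: reassoc_mult[symmetric] tensor_mult basis_mult)

lemma cop_right_mult: "cop_right (p * q) = cop_right p * cop_right q"
  unfolding cop_right_def
  by (rule lin_ext_mult) (auto simp: tensor_mult basis_mult)

lemma cop_left_one: "cop_left 1 = 1"
proof -
  have "cop_left (basis ({#}, {#})) = reassoc (tensor (tensor 1 1) 1)"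
    by (simp add: cop_left_def basis_zero tensor_one)
  also have "\<dots> = 1"
    by (subst reassoc_tensor) (simp add: tensor_one)
  finally show ?thesis
    by (simp add: basis_zero flip: zero_prod_def)
qed

lemma cop_right_one: "cop_right 1 = 1"
proof -
  have "cop_right (basis ({#}, {#})) = tensor 1 1"
    by (simp add: cop_right_def basis_zero)
  then show ?thesis
    by (simp add: tensor_one basis_zero flip: zero_prod_def)
qed

text \<open>With \<open>?B\<close> grafting in the first of three tensor legs, the cocycle equation
  turns both iterated coproducts of \<open>Node M\<close> into
  \<open>1 \<otimes> \<Delta>(Node M)\<close> plus \<open>?B\<close> of an iterated coproduct of
  \<open>M\<close>; these agree by induction and multiplicativity.\<close>

lemma cop_coassoc_tree: "cop_left (coproduct_tree t) = cop_right (coproduct_tree t)"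
proof (induction t)
  case (Node M)
  let ?B = "lin_ext (\<lambda>(a, r :: forest \<times> forest). basis ({#Node a#}, r))"
  have B_tensor: "?B (tensor p (tensor (basis b) (basis c))) = tensor (Bplus p) (tensor (basis b) (basis c))" for p b c
    by (induction p rule: basis_induct)
      (simp_all add: tensor_add_left tensor_pscale_left plinear_add[OF plinear_lin_ext]
        plinear_add[OF plinear_Bplus] plinear_pscale[OF plinear_Bplus] plinear_zero[OF plinear_Bplus]
        plinear_pscale[OF plinear_lin_ext] plinear_zero[OF plinear_lin_ext] tensor_basis)
  have B_reassoc: "?B (reassoc (tensor q (basis c))) = reassoc (tensor (tensor_map Bplus id q) (basis c))" for q c
  proof (induction q rule: basis_induct)
    case (basis k)
    then show ?case
      by (cases k) (simp add: tensor_map_basis tensor_basis reassoc_basis)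
  qed (simp_all add: tensor_add_left tensor_pscale_left plinear_add[OF plinear_lin_ext]
      plinear_add[OF plinear_tensor_map] plinear_pscale[OF plinear_tensor_map] plinear_zero[OF plinear_tensor_map]
      plinear_add[OF plinear_reassoc] plinear_pscale[OF plinear_reassoc] plinear_zero[OF plinear_reassoc]
      plinear_pscale[OF plinear_lin_ext] plinear_zero[OF plinear_lin_ext])
  have B_tensor': "?B (tensor (basis a) r) = tensor (basis {#Node a#}) r" for a r
    by (induction r rule: basis_induct)
      (auto simp: tensor_add_right tensor_pscale_right plinear_add[OF plinear_lin_ext]
        plinear_pscale[OF plinear_lin_ext] plinear_zero[OF plinear_lin_ext] tensor_basis)
  note simps = plinear_add[OF plinear_lin_ext] plinear_pscale[OF plinear_lin_ext] plinear_zero[OF plinear_lin_ext]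
      plinear_add[OF plinear_tensor_map] plinear_pscale[OF plinear_tensor_map] plinear_zero[OF plinear_tensor_map]
      plinear_add[OF plinear_cop_left] plinear_pscale[OF plinear_cop_left] plinear_zero[OF plinear_cop_left]
      plinear_add[OF plinear_cop_right] plinear_pscale[OF plinear_cop_right] plinear_zero[OF plinear_cop_right]
      tensor_add_right tensor_pscale_right tensor_add_left tensor_pscale_left
      plinear_add[OF plinear_reassoc] plinear_pscale[OF plinear_reassoc]
  have left: "cop_left (tensor_map Bplus id q) = tensor 1 (tensor_map Bplus id q) + ?B (cop_left q)" for q
  proof (induction q rule: basis_induct)
    case (basis k)
    obtain a b where [simp]: "k = (a, b)" by (cases k)
    have "cop_left (tensor_map Bplus id (basis (a, b))) = reassoc (tensor (coproduct_tree (Node a)) (basis b))"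
      by (simp add: tensor_map_basis tensor_basis cop_left_def)
    also have "\<dots> = reassoc (tensor (tensor 1 (basis {#Node a#})) (basis b)) + ?B (reassoc (tensor (cop a) (basis b)))"
      by (simp only: coproduct_tree_Node tensor_add_left plinear_add[OF plinear_reassoc] B_reassoc)
    also have "reassoc (tensor (tensor 1 (basis {#Node a#})) (basis b)) = tensor 1 (tensor_map Bplus id (basis (a, b)))"
      by (simp add: reassoc_tensor tensor_map_basis)
    finally show ?case
      by (simp only: \<open>k = (a, b)\<close> cop_left_basis)
  qed (simp_all add: simps pscale.scale_right_distrib)
  have right: "cop_right (tensor_map Bplus id q) = ?B (cop_right q)" for q
  proof (induction q rule: basis_induct)
    case (basis k)
    obtain a b where [simp]: "k = (a, b)" by (cases k)
    show ?case
      by (simp add: tensor_map_basis tensor_basis cop_right_def B_tensor')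
  qed (simp_all add: simps)
  have IH: "cop_left (cop M) = cop_right (cop M)"
    using Node
    by (induction M)
      (simp_all add: cop_left_one cop_right_one cop_left_mult cop_right_mult cop_def)
  have "cop_left (tensor 1 (basis {#Node M#})) = tensor 1 (tensor 1 (basis {#Node M#}))"
    unfolding basis_zero[symmetric] tensor_basis
    by (simp add: cop_left_def tensor_one[symmetric] reassoc_tensor)
      (simp add: tensor_basis basis_zero[symmetric])
  moreover have "cop_right (tensor 1 (basis {#Node M#})) = tensor 1 (coproduct_tree (Node M))"
    unfolding basis_zero[symmetric] tensor_basis by (simp add: cop_right_def)
  ultimately show ?case
    by (simp add: coproduct_tree_Node simps left right IH add.assoc)
qed

lemma cop_coassoc: "cop_left (cop F) = cop_right (cop F)"
  by (induction F)
    (simp_all add: cop_left_one cop_right_one cop_left_mult cop_right_mult cop_coassoc_tree cop_def)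

section \<open>Convolution and its neutral element\<close>

definition conv :: "(hck \<Rightarrow> hck) \<Rightarrow> (hck \<Rightarrow> hck) \<Rightarrow> hck \<Rightarrow> hck" where
  "conv \<phi> \<psi> p = mult_map (tensor_map \<phi> \<psi> (coproduct p))"

lemma plinear_mult_map: "plinear mult_map"
  unfolding mult_map_def by (rule plinear_lin_ext)

lemma mult_map_tensor: "mult_map (tensor p q) = p * q"
proof -
  note simps = tensor_add_left tensor_add_right tensor_pscale_left tensor_pscale_right
    plinear_add[OF plinear_mult_map] plinear_pscale[OF plinear_mult_map] plinear_zero[OF plinear_mult_map]
    distrib_left distrib_right pscale_mult_left pscale_mult_right
  have 1: "mult_map (tensor p (basis b)) = p * basis b" for b
    by (induction p rule: basis_induct) (simp_all add: simps tensor_basis, simp add: mult_map_def)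
  show ?thesis
    by (induction q rule: basis_induct) (simp_all add: simps 1)
qed

lemma plinear_conv: "plinear (conv \<phi> \<psi>)"
  unfolding conv_def by (intro plinear_comp[OF plinear_mult_map] plinear_comp[OF plinear_tensor_map] plinear_coproduct)

lemma conv_basis:
  "conv \<phi> \<psi> (basis F) = (\<Sum>(a, b)\<in>Poly_Mapping.keys (cop F).
     pscale (Poly_Mapping.lookup (cop F) (a, b)) (\<phi> (basis a) * \<psi> (basis b)))"
  unfolding conv_def tensor_map_def coproduct_basis
  by (simp add: lin_ext_def plinear_sum[OF plinear_mult_map] plinear_pscale[OF plinear_mult_map]
      case_prod_unfold mult_map_tensor)

text \<open>\<open>?m\<close> applies \<phi>, \<psi>, \<chi> to the three legs and multiplies. Both
  bracketings are \<open>?m\<close> after an iterated coproduct, so coassociativity identifies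
  them.\<close>

lemma conv_assoc:
  assumes "plinear \<phi>" "plinear \<psi>" "plinear \<chi>"
  shows "conv (conv \<phi> \<psi>) \<chi> p = conv \<phi> (conv \<psi> \<chi>) p"
proof -
  let ?m = "lin_ext (\<lambda>(a, b, c). \<phi> (basis a) * \<psi> (basis b) * \<chi> (basis c))"
  note simps = plinear_add[OF plinear_lin_ext] plinear_pscale[OF plinear_lin_ext] plinear_zero[OF plinear_lin_ext]
      plinear_add[OF plinear_tensor_map] plinear_pscale[OF plinear_tensor_map] plinear_zero[OF plinear_tensor_map]
      plinear_add[OF plinear_cop_left] plinear_pscale[OF plinear_cop_left] plinear_zero[OF plinear_cop_left]
      plinear_add[OF plinear_cop_right] plinear_pscale[OF plinear_cop_right] plinear_zero[OF plinear_cop_right]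
      tensor_add_right tensor_pscale_right tensor_add_left tensor_pscale_left
      plinear_add[OF plinear_reassoc] plinear_pscale[OF plinear_reassoc] plinear_zero[OF plinear_reassoc]
      plinear_add[OF plinear_mult_map] plinear_pscale[OF plinear_mult_map] plinear_zero[OF plinear_mult_map]
      distrib_left distrib_right pscale_mult_left pscale_mult_right
  have 1: "mult_map (tensor_map \<phi> \<psi> r) * \<chi> (basis c) = ?m (reassoc (tensor r (basis c)))" for r c
  proof (induction r rule: basis_induct)
    case (basis k)
    obtain a b where [simp]: "k = (a, b)" by (cases k)
    show ?case
      by (simp add: tensor_map_basis mult_map_tensor tensor_basis reassoc_basis)
  qed (simp_all add: simps)
  have 2: "\<phi> (basis a) * mult_map (tensor_map \<psi> \<chi> r) = ?m (tensor (basis a) r)" for r a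
  proof (induction r rule: basis_induct)
    case (basis k)
    obtain b c where [simp]: "k = (b, c)" by (cases k)
    show ?case
      by (simp add: tensor_map_basis mult_map_tensor tensor_basis mult.assoc)
  qed (simp_all add: simps)
  have left: "mult_map (tensor_map (conv \<phi> \<psi>) \<chi> q) = ?m (cop_left q)" for q
  proof (induction q rule: basis_induct)
    case (basis k)
    obtain a b where [simp]: "k = (a, b)" by (cases k)
    show ?case
      by (simp add: tensor_map_basis mult_map_tensor cop_left_def 1[symmetric]) (simp add: conv_def)
  qed (simp_all add: simps)
  have right: "mult_map (tensor_map \<phi> (conv \<psi> \<chi>) q) = ?m (cop_right q)" for q
  proof (induction q rule: basis_induct)
    case (basis k)
    obtain a b where [simp]: "k = (a, b)" by (cases k)
    show ?case
      by (simp add: tensor_map_basis mult_map_tensor cop_right_def 2[symmetric]) (simp add: conv_def)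
  qed (simp_all add: simps)
  have "conv (conv \<phi> \<psi>) \<chi> (basis F) = conv \<phi> (conv \<psi> \<chi>) (basis F)" for F
    unfolding conv_def[of "conv \<phi> \<psi>"] conv_def[of \<phi> "conv \<psi> \<chi>"] left right coproduct_basis cop_coassoc ..
  then show ?thesis
    by (rule plinear_eqI[of "conv (conv \<phi> \<psi>) \<chi>" "conv \<phi> (conv \<psi> \<chi>)", OF plinear_conv plinear_conv])
qed

text \<open>The neutral element of the convolution product.\<close>

definition unit_counit :: "hck \<Rightarrow> hck" where
  "unit_counit p = pscale (counit p) 1"

lemma plinear_unit_counit: "plinear unit_counit"
  unfolding unit_counit_def counit_def
  by (rule plinearI) (simp_all add: lookup_add pscale.scale_left_distrib)

lemma unit_counit_basis: "unit_counit (basis F) = (if F = {#} then 1 else 0)"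
  by (simp add: unit_counit_def counit_def lookup_basis)

text \<open>\<open>?E\<close> is \<open>id \<otimes> counit\<close>. It is an algebra morphism,
  commutes with grafting and kills \<open>1 \<otimes> T\<close>, so induction on trees gives the
  counit axiom \<open>?E (cop F) = basis F\<close>.\<close>

lemma conv_unit_right:
  assumes "plinear \<phi>"
  shows "conv \<phi> unit_counit p = \<phi> p"
proof -
  let ?E = "lin_ext (\<lambda>(k :: forest, l :: forest). if l = {#} then basis k else 0)"
  note simps = plinear_add[OF plinear_lin_ext] plinear_pscale[OF plinear_lin_ext] plinear_zero[OF plinear_lin_ext]
      plinear_add[OF plinear_tensor_map] plinear_pscale[OF plinear_tensor_map] plinear_zero[OF plinear_tensor_map]
      plinear_add[OF plinear_mult_map] plinear_pscale[OF plinear_mult_map] plinear_zero[OF plinear_mult_map]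
      plinear_add[OF plinear_Bplus] plinear_pscale[OF plinear_Bplus] plinear_zero[OF plinear_Bplus]
      plinear_add[OF assms] plinear_pscale[OF assms] plinear_zero[OF assms]
  have E_mult: "?E (p * q) = ?E p * ?E q" for p q
    by (rule lin_ext_mult) (auto simp: basis_mult)
  have E_one: "?E 1 = 1"
    unfolding basis_zero[symmetric] lin_ext_basis by (simp add: zero_prod_def)
  have E_B: "?E (tensor_map Bplus id q) = Bplus (?E q)" for q
  proof (induction q rule: basis_induct)
    case (basis k)
    then show ?case
      by (cases k) (simp add: tensor_map_basis tensor_basis simps)
  qed (simp_all add: simps)
  have E_tree: "?E (coproduct_tree t) = basis {#t#}" for t
  proof (induction t)
    case (Node M)
    have "?E (cop M) = basis M"
      using Node
      by (induction M)
        (simp_all add: E_one E_mult basis_zero cop_def basis_mult flip: add_mset_add_single)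
    moreover have "?E (tensor 1 (basis {#Node M#})) = 0"
      unfolding basis_zero[symmetric] tensor_basis by simp
    ultimately show ?case
      by (simp add: coproduct_tree_Node plinear_add[OF plinear_lin_ext] E_B)
  qed
  have E_cop: "?E (cop F) = basis F" for F
    by (induction F) (simp_all add: E_one E_mult basis_zero cop_def basis_mult E_tree)
  have "mult_map (tensor_map \<phi> unit_counit q) = \<phi> (?E q)" for q
  proof (induction q rule: basis_induct)
    case (basis k)
    then show ?case
      by (cases k) (simp add: tensor_map_basis mult_map_tensor unit_counit_basis simps)
  qed (simp_all add: simps)
  then have "conv \<phi> unit_counit (basis F) = \<phi> (basis F)" for F
    by (simp add: conv_def E_cop)
  then show ?thesis
    by (rule plinear_eqI[of "conv \<phi> unit_counit" \<phi>, OF plinear_conv assms])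
qed

text \<open>Here \<open>?E\<close> is \<open>counit \<otimes> id\<close>: the grafted part has a
  nonempty left leg and is killed, while \<open>1 \<otimes> T\<close> survives.\<close>

lemma conv_unit_left:
  assumes "plinear \<phi>"
  shows "conv unit_counit \<phi> p = \<phi> p"
proof -
  let ?E = "lin_ext (\<lambda>(k :: forest, l :: forest). if k = {#} then basis l else 0)"
  note simps = plinear_add[OF plinear_lin_ext] plinear_pscale[OF plinear_lin_ext] plinear_zero[OF plinear_lin_ext]
      plinear_add[OF plinear_tensor_map] plinear_pscale[OF plinear_tensor_map] plinear_zero[OF plinear_tensor_map]
      plinear_add[OF plinear_mult_map] plinear_pscale[OF plinear_mult_map] plinear_zero[OF plinear_mult_map]
      plinear_add[OF assms] plinear_pscale[OF assms] plinear_zero[OF assms]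
  have E_mult: "?E (p * q) = ?E p * ?E q" for p q
    by (rule lin_ext_mult) (auto simp: basis_mult)
  have E_one: "?E 1 = 1"
    unfolding basis_zero[symmetric] lin_ext_basis by (simp add: zero_prod_def)
  have E_B: "?E (tensor_map Bplus id q) = 0" for q
  proof (induction q rule: basis_induct)
    case (basis k)
    then show ?case
      by (cases k) (simp add: tensor_map_basis tensor_basis simps)
  qed (simp_all add: simps)
  have "?E (tensor 1 (basis {#t#})) = basis {#t#}" for t
    unfolding basis_zero[symmetric] tensor_basis by simp
  then have E_tree: "?E (coproduct_tree t) = basis {#t#}" for t
    by (cases t) (simp add: coproduct_tree_Node plinear_add[OF plinear_lin_ext] E_B)
  have E_cop: "?E (cop F) = basis F" for F
    by (induction F) (simp_all add: E_one E_mult basis_zero cop_def basis_mult E_tree)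
  have "mult_map (tensor_map unit_counit \<phi> q) = \<phi> (?E q)" for q
  proof (induction q rule: basis_induct)
    case (basis k)
    then show ?case
      by (cases k) (simp add: tensor_map_basis mult_map_tensor unit_counit_basis simps)
  qed (simp_all add: simps)
  then have "conv unit_counit \<phi> (basis F) = \<phi> (basis F)" for F
    by (simp add: conv_def E_cop)
  then show ?thesis
    by (rule plinear_eqI[of "conv unit_counit \<phi>" \<phi>, OF plinear_conv assms])
qed

section \<open>The grading by the number of vertices\<close>

primrec nodes :: "rtree \<Rightarrow> nat" where
  "nodes (Node M) = Suc (sum_mset (image_mset nodes M))"

definition fnodes :: "forest \<Rightarrow> nat" where
  "fnodes F = sum_mset (image_mset nodes F)"

lemma fnodes_simps [simp]: "fnodes {#} = 0" "fnodes {#t#} = nodes t" "fnodes (F + G) = fnodes F + fnodes G"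
  by (simp_all add: fnodes_def)

lemma nodes_pos: "nodes t > 0"
  by (cases t) simp

lemma fnodes_eq_0_iff [simp]: "fnodes F = 0 \<longleftrightarrow> F = {#}"
proof (cases "F = {#}")
  case False
  then obtain t G where "F = add_mset t G" by (auto dest: multi_nonempty_split)
  then show ?thesis using nodes_pos[of t] by (simp add: fnodes_def)
qed simp

text \<open>A cut distributes the vertices over its two sides. \<open>h n q\<close> says that
  \<open>q\<close> is homogeneous of degree \<open>n\<close>; this is multiplicative, and grafting
  adds one vertex to the left leg.\<close>

lemma keys_cop_fnodes: "(a, b) \<in> Poly_Mapping.keys (cop F) \<Longrightarrow> fnodes a + fnodes b = fnodes F"
proof -
  define h where "h n q \<longleftrightarrow> (\<forall>a b. (a, b) \<in> Poly_Mapping.keys q \<longrightarrow> fnodes a + fnodes b = n)"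
    for n and q :: "forest \<times> forest \<Rightarrow>\<^sub>0 complex"
  have h_mult: "h (m + n) (p * q)" if "h m p" "h n q" for m n p q
    unfolding h_def
  proof (intro allI impI)
    fix a b assume "(a, b) \<in> Poly_Mapping.keys (p * q)"
    with keys_mult[of p q] obtain a1 b1 a2 b2 where
      "(a1, b1) \<in> Poly_Mapping.keys p" "(a2, b2) \<in> Poly_Mapping.keys q" "a = a1 + a2" "b = b1 + b2"
      by fastforce
    with that show "fnodes a + fnodes b = m + n"
      unfolding h_def by fastforce
  qed
  have h_one: "h 0 1"
    by (simp add: h_def zero_prod_def)
  have h_forest: "h (fnodes F) (cop F)" if "\<forall>t\<in>#F. h (nodes t) (coproduct_tree t)" for F
    using that by (induction F) (simp_all add: h_one h_mult cop_def fnodes_def)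
  have h_tree: "h (nodes t) (coproduct_tree t)" for t
  proof (induction t)
    case (Node M)
    then have *: "h (fnodes M) (cop M)" by (simp add: h_forest)
    show ?case
      unfolding h_def
    proof (intro allI impI)
      fix a b assume "(a, b) \<in> Poly_Mapping.keys (coproduct_tree (Node M))"
      then have "(a, b) \<in> Poly_Mapping.keys (tensor 1 (basis {#Node M#}) :: forest \<times> forest \<Rightarrow>\<^sub>0 complex) \<or>
          (a, b) \<in> Poly_Mapping.keys (tensor_map Bplus id (cop M))"
        unfolding coproduct_tree_Node by (blast dest: subsetD[OF keys_add])
      then show "fnodes a + fnodes b = nodes (Node M)"
      proof
        assume "(a, b) \<in> Poly_Mapping.keys (tensor 1 (basis {#Node M#}) :: forest \<times> forest \<Rightarrow>\<^sub>0 complex)"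
        then show ?thesis
          by (auto simp: in_keys_iff lookup_one lookup_basis when_def split: if_splits)
      next
        assume "(a, b) \<in> Poly_Mapping.keys (tensor_map Bplus id (cop M))"
        then have "(\<Sum>x\<in>Poly_Mapping.keys (cop M). Poly_Mapping.lookup (cop M) x *
            Poly_Mapping.lookup (tensor (basis {#Node (fst x)#}) (basis (snd x))) (a, b)) \<noteq> 0"
          unfolding tensor_map_def in_keys_iff lookup_lin_ext by (simp add: case_prod_unfold)
        then obtain x where "x \<in> Poly_Mapping.keys (cop M)" "Poly_Mapping.lookup (cop M) x *
            Poly_Mapping.lookup (tensor (basis {#Node (fst x)#}) (basis (snd x))) (a, b) \<noteq> 0"
          by (rule sum.not_neutral_contains_not_neutral)
        moreover obtain k l where "x = (k, l)" by (cases x)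
        ultimately have "(k, l) \<in> Poly_Mapping.keys (cop M)"
          "Poly_Mapping.lookup (tensor (basis {#Node k#}) (basis l)) (a, b) \<noteq> (0 :: complex)"
          by auto
        then show ?thesis
          using * by (auto simp: lookup_basis h_def fnodes_def split: if_splits)
      qed
    qed
  qed
  assume "(a, b) \<in> Poly_Mapping.keys (cop F)"
  then show ?thesis
    using h_forest[of F] h_tree by (auto simp: h_def)
qed

section \<open>The antipode as a convolution inverse\<close>

definition augment :: "hck \<Rightarrow> hck" where
  "augment p = p - unit_counit p"

lemma plinear_augment: "plinear augment"
  unfolding augment_def by (intro plinear_minus plinear_id plinear_unit_counit)

primrec augment_power :: "nat \<Rightarrow> hck \<Rightarrow> hck" where
  "augment_power 0 = unit_counit"
| "augment_power (Suc n) = conv (augment_power n) augment"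

lemma plinear_augment_power: "plinear (augment_power n)"
  by (cases n) (simp_all add: plinear_unit_counit plinear_conv)

text \<open>The recursion splits off a factor on the right; associativity gives the splitting on the
  left, which the right inverse property uses.\<close>

lemma augment_power_Suc: "augment_power (Suc n) p = conv augment (augment_power n) p"
proof (induction n arbitrary: p)
  case 0
  then show ?case by (simp add: conv_unit_left conv_unit_right plinear_augment)
next
  case (Suc n)
  have *: "augment_power (Suc n) = conv augment (augment_power n)"
    by (rule ext) (rule Suc.IH)
  have "augment_power (Suc (Suc n)) p = conv (conv augment (augment_power n)) augment p"
    unfolding augment_power.simps(2)[of "Suc n"] * ..
  then show ?case
    by (simp add: conv_assoc plinear_augment plinear_augment_power)
qed

text \<open>\<open>augment\<close> kills the empty forest, so each further factor takes at least one
  vertex of \<open>F\<close>.\<close>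

lemma augment_power_vanish: "fnodes F < n \<Longrightarrow> augment_power n (basis F) = 0"
proof (induction n arbitrary: F)
  case (Suc n)
  have "augment_power n (basis a) * augment (basis b) = 0" if "(a, b) \<in> Poly_Mapping.keys (cop F)" for a b
  proof (cases "b = {#}")
    case True
    have "augment (basis {#}) = 0"
      unfolding augment_def unit_counit_basis by (simp add: basis_zero)
    with True show ?thesis by simp
  next
    case False
    then have "fnodes b \<noteq> 0" by simp
    with keys_cop_fnodes[OF that] Suc.prems have "fnodes a < n" by linarith
    then show ?thesis by (simp add: Suc.IH)
  qed
  then show ?case
    by (auto simp: conv_basis intro!: sum.neutral)
qed simp

definition alternating_sum :: "nat \<Rightarrow> hck \<Rightarrow> hck" where
  "alternating_sum N p = (\<Sum>k\<le>N. pscale ((-1) ^ k) (augment_power k p))"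

text \<open>The inverse of the identity is the geometric series of \<open>id = unit_counit + augment\<close> for the
  convolution product.\<close>

definition antipode :: "hck \<Rightarrow> hck" where
  "antipode = lin_ext (\<lambda>F. alternating_sum (fnodes F) (basis F))"

lemma plinear_antipode: "plinear antipode"
  unfolding antipode_def by (rule plinear_lin_ext)

lemma plinear_alternating_sum: "plinear (alternating_sum N)"
  unfolding alternating_sum_def
  by (rule plinearI) (simp_all add: plinear_add[OF plinear_augment_power] plinear_pscale[OF plinear_augment_power]
      pscale.scale_right_distrib sum.distrib pscale.scale_sum_right mult.commute)

text \<open>Terms beyond the number of vertices vanish, so any larger cutoff gives the same value;
  this permits one cutoff for several forests.\<close>

lemma antipode_basis: "fnodes F \<le> N \<Longrightarrow> antipode (basis F) = alternating_sum N (basis F)"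
  unfolding antipode_def lin_ext_basis alternating_sum_def
  by (rule sum.mono_neutral_left) (auto simp: augment_power_vanish)

lemma antipode_eq_alternating_sum:
  assumes "\<And>F. F \<in> Poly_Mapping.keys p \<Longrightarrow> fnodes F \<le> N"
  shows "antipode p = alternating_sum N p"
proof -
  let ?s = "\<Sum>F\<in>Poly_Mapping.keys p. pscale (Poly_Mapping.lookup p F) (basis F)"
  have "antipode ?s = alternating_sum N ?s"
    unfolding plinear_sum[OF plinear_antipode] plinear_sum[OF plinear_alternating_sum]
      plinear_pscale[OF plinear_antipode] plinear_pscale[OF plinear_alternating_sum]
    by (intro sum.cong refl) (simp add: antipode_basis assms)
  then show ?thesis
    by (simp flip: poly_mapping_basis_sum)
qed

lemma alternating_sum_telescope:
  fixes g :: "nat \<Rightarrow> ('k \<Rightarrow>\<^sub>0 complex)"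
  shows "(\<Sum>k\<le>N. pscale ((-1) ^ k) (g (Suc k))) + (\<Sum>k\<le>N. pscale ((-1) ^ k) (g k)) =
     g 0 + pscale ((-1) ^ N) (g (Suc N))"
  by (induction N) (simp_all add: algebra_simps)

text \<open>Legs of the coproduct have at most as many vertices as \<open>F\<close>. This allows
  \<open>antipode\<close> to be replaced by one finite alternating sum under the
  convolution.\<close>

lemma conv_cong_left:
  assumes "\<And>a. fnodes a \<le> fnodes F \<Longrightarrow> \<phi> (basis a) = \<phi>' (basis a)"
  shows "conv \<phi> \<psi> (basis F) = conv \<phi>' \<psi> (basis F)"
  unfolding conv_basis using keys_cop_fnodes[of _ _ F] assms
  by (intro sum.cong) (auto, metis le_add1)

lemma conv_cong_right:
  assumes "\<And>a. fnodes a \<le> fnodes F \<Longrightarrow> \<psi> (basis a) = \<psi>' (basis a)"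
  shows "conv \<phi> \<psi> (basis F) = conv \<phi> \<psi>' (basis F)"
  unfolding conv_basis using keys_cop_fnodes[of _ _ F] assms
  by (intro sum.cong) (auto, metis le_add2)

lemma conv_sum_left:
  "conv (\<lambda>p. \<Sum>k\<in>A. pscale (c k) (g k p)) \<psi> (basis F) = (\<Sum>k\<in>A. pscale (c k) (conv (g k) \<psi> (basis F)))"
proof -
  have "conv (\<lambda>p. \<Sum>k\<in>A. pscale (c k) (g k p)) \<psi> (basis F) = (\<Sum>x\<in>Poly_Mapping.keys (cop F). \<Sum>k\<in>A.
     pscale (Poly_Mapping.lookup (cop F) x) (pscale (c k) (g k (basis (fst x)) * \<psi> (basis (snd x)))))"
    unfolding conv_basis
    by (simp add: case_prod_unfold sum_distrib_right pscale_mult_left pscale.scale_sum_right del: pscale.scale_scale)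
  also have "\<dots> = (\<Sum>k\<in>A. pscale (c k) (conv (g k) \<psi> (basis F)))"
    unfolding conv_basis
    by (subst sum.swap) (simp add: case_prod_unfold pscale.scale_sum_right mult.commute)
  finally show ?thesis .
qed

lemma conv_sum_right:
  "conv \<phi> (\<lambda>p. \<Sum>k\<in>A. pscale (c k) (g k p)) (basis F) = (\<Sum>k\<in>A. pscale (c k) (conv \<phi> (g k) (basis F)))"
proof -
  have "conv \<phi> (\<lambda>p. \<Sum>k\<in>A. pscale (c k) (g k p)) (basis F) = (\<Sum>x\<in>Poly_Mapping.keys (cop F). \<Sum>k\<in>A.
     pscale (Poly_Mapping.lookup (cop F) x) (pscale (c k) (\<phi> (basis (fst x)) * g k (basis (snd x)))))"
    unfolding conv_basis
    by (simp add: case_prod_unfold sum_distrib_left pscale_mult_right pscale.scale_sum_right del: pscale.scale_scale)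
  also have "\<dots> = (\<Sum>k\<in>A. pscale (c k) (conv \<phi> (g k) (basis F)))"
    unfolding conv_basis
    by (subst sum.swap) (simp add: case_prod_unfold pscale.scale_sum_right mult.commute)
  finally show ?thesis .
qed

text \<open>In \<open>id = augment + unit_counit\<close> the first summand shifts the index of the
  alternating sum and the second keeps it. The sum telescopes, as the power
  \<open>fnodes F + 1\<close> of \<open>augment\<close> vanishes on \<open>F\<close>.\<close>

lemma conv_antipode_left: "conv antipode id p = unit_counit p"
proof -
  have "conv antipode id (basis F) = unit_counit (basis F)" for F
  proof -
    let ?N = "fnodes F"
    have "conv antipode id (basis F) = conv antipode augment (basis F) + conv antipode unit_counit (basis F)"
      unfolding conv_basis
      by (simp add: case_prod_unfold augment_def algebra_simps pscale.scale_right_distrib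
          pscale.scale_right_diff_distrib flip: sum.distrib)
    also have "conv antipode augment (basis F) = conv (alternating_sum ?N) augment (basis F)"
      by (rule conv_cong_left) (rule antipode_basis)
    also have "\<dots> = (\<Sum>k\<le>?N. pscale ((-1) ^ k) (augment_power (Suc k) (basis F)))"
      by (simp add: alternating_sum_def[abs_def] conv_sum_left)
    also have "conv antipode unit_counit (basis F) = (\<Sum>k\<le>?N. pscale ((-1) ^ k) (augment_power k (basis F)))"
      by (simp add: conv_unit_right plinear_antipode antipode_basis[of F ?N] alternating_sum_def)
    also have "(\<Sum>k\<le>?N. pscale ((-1) ^ k) (augment_power (Suc k) (basis F))) +
        (\<Sum>k\<le>?N. pscale ((-1) ^ k) (augment_power k (basis F))) = unit_counit (basis F)"
      using alternating_sum_telescope[of "\<lambda>k. augment_power k (basis F)" ?N] augment_power_vanish[of F "Suc ?N"]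
      by simp
    finally show ?thesis .
  qed
  then show ?thesis
    by (rule plinear_eqI[of "conv antipode id" unit_counit, OF plinear_conv plinear_unit_counit])
qed

lemma conv_antipode_right: "conv id antipode p = unit_counit p"
proof -
  have "conv id antipode (basis F) = unit_counit (basis F)" for F
  proof -
    let ?N = "fnodes F"
    have "conv id antipode (basis F) = conv augment antipode (basis F) + conv unit_counit antipode (basis F)"
      unfolding conv_basis
      by (simp add: case_prod_unfold augment_def algebra_simps pscale.scale_right_distrib
          pscale.scale_right_diff_distrib flip: sum.distrib)
    also have "conv augment antipode (basis F) = conv augment (alternating_sum ?N) (basis F)"
      by (rule conv_cong_right) (rule antipode_basis)
    also have "\<dots> = (\<Sum>k\<le>?N. pscale ((-1) ^ k) (augment_power (Suc k) (basis F)))"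
      by (simp add: alternating_sum_def[abs_def] conv_sum_right augment_power_Suc del: augment_power.simps)
    also have "conv unit_counit antipode (basis F) = (\<Sum>k\<le>?N. pscale ((-1) ^ k) (augment_power k (basis F)))"
      by (simp add: conv_unit_left plinear_antipode antipode_basis[of F ?N] alternating_sum_def)
    also have "(\<Sum>k\<le>?N. pscale ((-1) ^ k) (augment_power (Suc k) (basis F))) +
        (\<Sum>k\<le>?N. pscale ((-1) ^ k) (augment_power k (basis F))) = unit_counit (basis F)"
      using alternating_sum_telescope[of "\<lambda>k. augment_power k (basis F)" ?N] augment_power_vanish[of F "Suc ?N"]
      by simp
    finally show ?thesis .
  qed
  then show ?thesis
    by (rule plinear_eqI[of "conv id antipode" unit_counit, OF plinear_conv plinear_unit_counit])
qed

lemma is_antipode_antipode: "is_antipode antipode"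
  using plinear_antipode conv_antipode_left conv_antipode_right
  by (simp add: is_antipode_def conv_def unit_counit_def)

lemma conv_mem:
  assumes "subalgebra A" "coproduct ` A \<subseteq> tensor_square A" "plinear \<phi>" "plinear \<psi>"
    "\<phi> ` A \<subseteq> A" "\<psi> ` A \<subseteq> A" "p \<in> A"
  shows "conv \<phi> \<psi> p \<in> A"
proof -
  have "coproduct p \<in> pscale.span {tensor p q |p q. p \<in> A \<and> q \<in> A}"
    using assms(2,7) by (auto simp: tensor_square_def)
  then show ?thesis
    unfolding conv_def
    by (rule plinear_image_span[of "\<lambda>q. mult_map (tensor_map \<phi> \<psi> q)", rotated 3])
      (use assms in \<open>auto simp: tensor_map_tensor mult_map_tensor subalgebra_def image_subset_iff
        intro!: plinear_comp[OF plinear_mult_map plinear_tensor_map]\<close>)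
qed

text \<open>On a given element the antipode is a finite combination of convolution powers of
  \<open>augment\<close>, and each of these preserves a subalgebra that is also a
  subcoalgebra.\<close>

theorem hopf_subalgebra_iff:
  assumes "subalgebra A"
  shows "hopf_subalgebra A \<longleftrightarrow> coproduct ` A \<subseteq> tensor_square A"
proof
  assume A: "coproduct ` A \<subseteq> tensor_square A"
  have unit: "unit_counit p \<in> A" for p
    using assms by (simp add: unit_counit_def subalgebra_one subalgebra_pscale)
  then have aug: "augment ` A \<subseteq> A"
    using assms by (auto simp: augment_def intro: subalgebra_diff)
  have pow: "augment_power k ` A \<subseteq> A" for k
    by (induction k) (use assms A unit aug in \<open>auto intro!: conv_mem[OF assms A] plinear_augment_power plinear_augment\<close>)
  have "antipode p \<in> A" if "p \<in> A" for p
  proof -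
    \<comment> \<open>One cutoff for all forests in \<open>p\<close>. For \<open>p = 0\<close> the
      maximum over the empty set is unspecified, but then the bound is vacuous.\<close>
    have "antipode p = alternating_sum (Max (fnodes ` Poly_Mapping.keys p)) p"
      by (rule antipode_eq_alternating_sum) simp
    then show ?thesis
      using pow that by (auto simp: alternating_sum_def intro!: subalgebra_sum subalgebra_pscale assms)
  qed
  then show "hopf_subalgebra A"
    using assms A is_antipode_antipode by (auto simp: hopf_subalgebra_def)
qed (simp add: hopf_subalgebra_def)

text \<open>The coproduct is an algebra morphism, so the preimage of the tensor square of the hull
  is a subalgebra; it contains the generators by assumption.\<close>

lemma coproduct_subalgebra_hull:
  assumes "\<And>p. p \<in> S \<Longrightarrow> coproduct p \<in> tensor_square (subalgebra hull S)"
  shows "coproduct ` (subalgebra hull S) \<subseteq> tensor_square (subalgebra hull S)"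
proof -
  have "subalgebra hull S \<subseteq> coproduct -` tensor_square (subalgebra hull S)"
    by (rule hull_minimal)
      (use assms in \<open>auto intro!: subalgebra_vimage plinear_coproduct coproduct_one coproduct_mult
        subalgebra_tensor_square subalgebra_hull\<close>)
  then show ?thesis by auto
qed


section \<open>Symmetry factors and fertilities\<close>

text \<open>The order of the stabiliser of an enumeration of \<open>M\<close> under permutations of
  the positions; hence \<open>M\<close> has \<open>(size M)! / mfact M\<close> orderings.\<close>

definition mfact :: "'a multiset \<Rightarrow> nat" where
  "mfact M = (\<Prod>x\<in>set_mset M. fact (count M x))"

lemma mfact_pos: "mfact M > 0"
  by (simp add: mfact_def prod_pos)

lemma mfact_empty [simp]: "mfact {#} = 1"
  by (simp add: mfact_def)

lemma mfact_superset:
  assumes "finite X" "set_mset M \<subseteq> X"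
  shows "mfact M = (\<Prod>x\<in>X. fact (count M x))"
  unfolding mfact_def by (rule prod.mono_neutral_left) (use assms in \<open>auto simp: not_in_iff\<close>)

lemma mfact_add_mset: "mfact (add_mset x M) = Suc (count M x) * mfact M"
proof -
  let ?X = "insert x (set_mset M)"
  have "mfact (add_mset x M) = (\<Prod>y\<in>?X. (if y = x then Suc (count M x) else 1) * fact (count M y))"
    unfolding mfact_def by (intro prod.cong) auto
  also have "\<dots> = (\<Prod>y\<in>?X. if y = x then Suc (count M x) else 1) * (\<Prod>y\<in>?X. fact (count M y))"
    by (rule prod.distrib)
  also have "(\<Prod>y\<in>?X. if y = x then Suc (count M x) else 1) = Suc (count M x)"
    by (subst prod.delta) auto
  also have "(\<Prod>y\<in>?X. fact (count M y)) = mfact M"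
    by (rule mfact_superset[symmetric]) auto
  finally show ?thesis .
qed

section \<open>Counting label-preserving bijections\<close>

definition bijections :: "'a set \<Rightarrow> 'b set \<Rightarrow> ('a \<Rightarrow> 'b) set" where
  "bijections A B = {\<pi> \<in> extensional A. bij_betw \<pi> A B}"

lemma finite_bijections:
  assumes "finite A" "finite B"
  shows "finite (bijections A B)"
proof (rule finite_subset)
  show "bijections A B \<subseteq> A \<rightarrow>\<^sub>E B"
    by (auto simp: bijections_def bij_betw_def extensional_def)
  show "finite (A \<rightarrow>\<^sub>E B)"
    using assms by (simp add: finite_PiE)
qed

text \<open>Permutations are the identity outside \<open>A\<close>, extensional functions are
  \<open>undefined\<close> there. The second convention also covers bijections between different
  sets and keeps their number finite.\<close>

lemma bij_betw_permutes_bijections: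
  "bij_betw (\<lambda>\<sigma>. restrict \<sigma> A) {\<sigma>. \<sigma> permutes A} (bijections A A)"
proof (rule bij_betw_byWitness[where f' = "\<lambda>\<pi> x. if x \<in> A then \<pi> x else x"])
  show "\<forall>\<sigma>\<in>{\<sigma>. \<sigma> permutes A}. (\<lambda>x. if x \<in> A then restrict \<sigma> A x else x) = \<sigma>"
    by (auto simp: permutes_def)
  show "\<forall>\<pi>\<in>bijections A A. restrict (\<lambda>x. if x \<in> A then \<pi> x else x) A = \<pi>"
    by (auto simp: bijections_def extensional_def restrict_def)
  show "(\<lambda>\<sigma>. restrict \<sigma> A) ` {\<sigma>. \<sigma> permutes A} \<subseteq> bijections A A"
    by (auto simp: bijections_def permutes_imp_bij cong: bij_betw_cong)
  show "(\<lambda>\<pi> x. if x \<in> A then \<pi> x else x) ` bijections A A \<subseteq> {\<sigma>. \<sigma> permutes A}"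
    by (auto simp: bijections_def intro!: bij_imp_permutes cong: bij_betw_cong)
qed

text \<open>Induction on \<open>I\<close>: the new index \<open>a\<close> goes to any
  \<open>j\<close> with the same label, and once \<open>j\<close> is removed the fibre sizes match
  again. The choices for \<open>j\<close> number the fibre size of \<open>P a\<close>, which is the
  factor by which that factorial grows. The fixed set \<open>X\<close> keeps the product over one
  index set.\<close>

lemma card_fibre_bijections:
  assumes "finite I" "finite J" "finite X" "P ` I \<subseteq> X"
    and "\<And>x. card {i \<in> I. P i = x} = card {j \<in> J. Q j = x}"
  shows "card {\<pi> \<in> bijections I J. \<forall>i\<in>I. P i = Q (\<pi> i)} = (\<Prod>x\<in>X. fact (card {i \<in> I. P i = x}))"
  using assms
proof (induction I arbitrary: J rule: finite_induct)
  case empty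
  have "J = {}"
  proof (rule ccontr)
    assume "J \<noteq> {}"
    then obtain j where "j \<in> J" by auto
    moreover have "card {j' \<in> J. Q j' = Q j} = 0"
      using empty.prems(4)[of "Q j"] by simp
    ultimately show False using empty.prems(1) by auto
  qed
  then show ?case by (simp add: bijections_def bij_betw_def)
next
  case (insert a I)
  define S where "S I J = {\<pi> \<in> bijections I J. \<forall>i\<in>I. P i = Q (\<pi> i)}" for I J
  let ?J = "{j \<in> J. Q j = P a}"
  have fin: "finite (S I J')" if "finite J'" for J'
    unfolding S_def by (rule finite_subset[OF _ finite_bijections[OF insert.hyps(1) that]]) auto
  have "bij_betw (\<lambda>\<pi>. (\<pi> a, restrict \<pi> I)) (S (insert a I) J) (Sigma ?J (\<lambda>j. S I (J - {j})))"
  proof (rule bij_betw_byWitness[where f' = "\<lambda>(j, \<pi>). \<pi>(a := j)"])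
    show "\<forall>\<pi>\<in>S (insert a I) J. (\<lambda>(j, \<pi>). \<pi>(a := j)) (\<pi> a, restrict \<pi> I) = \<pi>"
      by (auto simp: S_def bijections_def extensional_def restrict_def fun_eq_iff)
    show "\<forall>x\<in>Sigma ?J (\<lambda>j. S I (J - {j})).
        (((\<lambda>(j, \<pi>). \<pi>(a := j)) x) a, restrict ((\<lambda>(j, \<pi>). \<pi>(a := j)) x) I) = x"
      using insert.hyps
      by (auto simp: S_def bijections_def extensional_def restrict_def fun_eq_iff)
    show "(\<lambda>\<pi>. (\<pi> a, restrict \<pi> I)) ` S (insert a I) J \<subseteq> Sigma ?J (\<lambda>j. S I (J - {j}))"
    proof (clarify)
      fix \<pi> assume \<pi>: "\<pi> \<in> S (insert a I) J"
      then have b: "bij_betw \<pi> (insert a I) J" and e: "\<forall>i\<in>insert a I. P i = Q (\<pi> i)"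
        by (auto simp: S_def bijections_def)
      have "bij_betw \<pi> (insert a I - {a}) (J - {\<pi> a})"
        using b by (rule bij_betw_DiffI) (use b in \<open>auto simp: bij_betw_def\<close>)
      then have "bij_betw \<pi> I (J - {\<pi> a})"
        using insert.hyps by simp
      then show "\<pi> a \<in> ?J \<and> restrict \<pi> I \<in> S I (J - {\<pi> a})"
        using b e by (auto simp: S_def bijections_def bij_betw_def cong: bij_betw_cong)
    qed
    show "(\<lambda>(j, \<pi>). \<pi>(a := j)) ` Sigma ?J (\<lambda>j. S I (J - {j})) \<subseteq> S (insert a I) J"
    proof (clarify)
      fix j \<pi> assume j: "j \<in> J" "Q j = P a" and \<pi>: "\<pi> \<in> S I (J - {j})"
      then have "bij_betw \<pi> I (J - {j})" by (auto simp: S_def bijections_def)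
      then have "bij_betw (\<pi>(a := j)) I (J - {j})"
        using insert.hyps by (subst bij_betw_cong[of I "\<pi>(a := j)" \<pi>]) auto
      then have "bij_betw (\<pi>(a := j)) (insert a I) (insert j (J - {j}))"
        using insert.hyps notIn_Un_bij_betw[of a I "\<pi>(a := j)" "J - {j}"] by simp
      then have "bij_betw (\<pi>(a := j)) (insert a I) J"
        using j by (simp add: insert_absorb)
      then show "\<pi>(a := j) \<in> S (insert a I) J"
        using j \<pi> insert.hyps by (auto simp: S_def bijections_def extensional_def)
    qed
  qed
  then have "card (S (insert a I) J) = card (Sigma ?J (\<lambda>j. S I (J - {j})))"
    by (rule bij_betw_same_card)
  also have "\<dots> = (\<Sum>j\<in>?J. card (S I (J - {j})))"
    using insert.prems(1) fin by (intro card_SigmaI) auto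
  also have "\<dots> = (\<Sum>j\<in>?J. \<Prod>x\<in>X. fact (card {i \<in> I. P i = x}))"
  proof (intro sum.cong refl)
    fix j assume j: "j \<in> ?J"
    show "card (S I (J - {j})) = (\<Prod>x\<in>X. fact (card {i \<in> I. P i = x}))"
      unfolding S_def
    proof (rule insert.IH)
      fix x
      show "card {i \<in> I. P i = x} = card {j' \<in> J - {j}. Q j' = x}"
      proof (cases "x = P a")
        case True
        have 1: "{i \<in> insert a I. P i = x} = insert a {i \<in> I. P i = x}" using True by auto
        have 2: "{j' \<in> J. Q j' = x} = insert j {j' \<in> J - {j}. Q j' = x}" using True j by auto
        show ?thesis
          using insert.prems(4)[of x] insert.hyps insert.prems(1) unfolding 1 2 by simp
      next
        case False
        then have "{i \<in> insert a I. P i = x} = {i \<in> I. P i = x}"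
          "{j' \<in> J. Q j' = x} = {j' \<in> J - {j}. Q j' = x}" using j by auto
        then show ?thesis using insert.prems(4)[of x] by simp
      qed
    qed (use insert in auto)
  qed
  also have "\<dots> = card {i \<in> insert a I. P i = P a} * (\<Prod>x\<in>X. fact (card {i \<in> I. P i = x}))"
    using insert.prems(4)[of "P a"] by simp
  also have "{i \<in> insert a I. P i = P a} = insert a {i \<in> I. P i = P a}" by auto
  also have "card \<dots> * (\<Prod>x\<in>X. fact (card {i \<in> I. P i = x})) =
      (\<Prod>x\<in>X. (if x = P a then Suc (card {i \<in> I. P i = x}) else 1) * fact (card {i \<in> I. P i = x}))"
    using insert.hyps insert.prems by (simp add: prod.distrib)
  also have "\<dots> = (\<Prod>x\<in>X. fact (card {i \<in> insert a I. P i = x}))"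
  proof (intro prod.cong refl)
    fix x
    have "{i \<in> insert a I. P i = x} = (if x = P a then insert a {i \<in> I. P i = x} else {i \<in> I. P i = x})"
      by auto
    then show "(if x = P a then Suc (card {i \<in> I. P i = x}) else 1) * fact (card {i \<in> I. P i = x}) =
        (fact (card {i \<in> insert a I. P i = x}) :: nat)"
      using insert.hyps by simp
  qed
  finally show ?case by (simp add: S_def)
qed

text \<open>A product survives only if \<pi> matches equal entries, and such \<pi> exist precisely
  when the lists are permutations of each other. The same sum computes the pairing of symmetric
  algebras and counts isomorphisms of forests.\<close>

lemma sum_bijections_diagonal:
  fixes w :: "'a \<Rightarrow> 'b::comm_semiring_1"
  shows "(\<Sum>\<pi>\<in>bijections {..<length P} {..<length Q}. \<Prod>i<length P. if P ! i = Q ! \<pi> i then w (P ! i) else 0) =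
    (if mset P = mset Q then of_nat (mfact (mset P)) * prod_mset (image_mset w (mset P)) else 0)"
proof -
  let ?k = "length P" and ?l = "length Q"
  let ?S = "{\<pi> \<in> bijections {..<?k} {..<?l}. \<forall>i\<in>{..<?k}. P ! i = Q ! \<pi> i}"
  have im: "mset R = image_mset ((!) R) (mset_set {..<length R})" for R :: "'a list"
    by (metis map_nth mset_map mset_upt lessThan_atLeast0)
  have "(\<Sum>\<pi>\<in>bijections {..<?k} {..<?l}. \<Prod>i<?k. if P ! i = Q ! \<pi> i then w (P ! i) else 0) =
      (\<Sum>\<pi>\<in>bijections {..<?k} {..<?l}. if \<forall>i\<in>{..<?k}. P ! i = Q ! \<pi> i then \<Prod>i<?k. w (P ! i) else 0)"
  proof (intro sum.cong refl)
    fix \<pi>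
    show "(\<Prod>i<?k. if P ! i = Q ! \<pi> i then w (P ! i) else 0) =
        (if \<forall>i\<in>{..<?k}. P ! i = Q ! \<pi> i then \<Prod>i<?k. w (P ! i) else 0)"
      by (auto intro!: prod.cong prod_zero)
  qed
  also have "\<dots> = (\<Sum>\<pi>\<in>?S. \<Prod>i<?k. w (P ! i))"
    by (rule sum.inter_filter[symmetric]) (simp add: finite_bijections)
  also have "\<dots> = of_nat (card ?S) * (\<Prod>i<?k. w (P ! i))"
    by (rule sum_constant)
  also have "(\<Prod>i<?k. w (P ! i)) = prod_mset (image_mset w (mset P))"
    by (subst im[of P]) (simp add: prod_unfold_prod_mset multiset.map_comp o_def)
  also have "card ?S = (if mset P = mset Q then mfact (mset P) else 0)"
  proof (cases "mset P = mset Q")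
    case True
    have cnt: "card {i \<in> {..<length R}. R ! i = x} = count (mset R) x" for R :: "'a list" and x
    proof -
      have "count (mset R) x = length (filter ((=) x) R)"
        by (simp add: count_mset count_list_eq_length_filter)
      also have "\<dots> = card {i. i < length R \<and> x = R ! i}"
        by (rule length_filter_conv_card)
      also have "{i. i < length R \<and> x = R ! i} = {i \<in> {..<length R}. R ! i = x}"
        by auto
      finally show ?thesis ..
    qed
    have "card ?S = (\<Prod>x\<in>set P. fact (card {i \<in> {..<?k}. P ! i = x}))"
      by (rule card_fibre_bijections) (use True cnt in auto)
    then have "card ?S = mfact (mset P)"
      by (simp only: cnt mfact_def set_mset_mset)
    then show ?thesis
      unfolding if_P[OF True] .
  next
    case False
    have "?S = {}"
    proof (rule ccontr)
      assume "?S \<noteq> {}"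
      then obtain \<pi> where b: "bij_betw \<pi> {..<?k} {..<?l}" and e: "\<forall>i\<in>{..<?k}. P ! i = Q ! \<pi> i"
        by (auto simp: bijections_def)
      have "mset P = image_mset (\<lambda>i. Q ! \<pi> i) (mset_set {..<?k})"
        unfolding im[of P] by (rule image_mset_cong) (use e in auto)
      also have "\<dots> = image_mset ((!) Q) (image_mset \<pi> (mset_set {..<?k}))"
        by (simp add: multiset.map_comp o_def)
      also have "image_mset \<pi> (mset_set {..<?k}) = mset_set {..<?l}"
        using b by (simp add: image_mset_mset_set bij_betw_def)
      finally show False using False im[of Q] by simp
    qed
    then have "card ?S = 0" by (simp only: card.empty)
    then show ?thesis
      unfolding if_not_P[OF False] .
  qed
  finally show ?thesis by simp
qed

lemma mset_list_of_mset [simp]: "mset (list_of_mset M) = M"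
  unfolding list_of_mset_def by (rule someI_ex) (rule ex_mset)

text \<open>Since \<open>monomial_pairing\<close> is diagonal, only permutations that match equal
  exponents contribute; the basis of multisets is orthogonal.\<close>

lemma multiset_pairing_eq:
  "multiset_pairing M N = (if M = N then of_nat (mfact M) *
     prod_mset (image_mset (\<lambda>\<alpha>. monomial_pairing \<alpha> \<alpha>) M) else 0)"
proof (cases "size M = size N")
  case True
  let ?P = "list_of_mset M" and ?Q = "list_of_mset N"
  have len: "length ?P = length ?Q"
    using True by (metis mset_list_of_mset size_mset)
  have "multiset_pairing M N = (\<Sum>\<sigma> | \<sigma> permutes {..<length ?P}. \<Prod>i<length ?P. monomial_pairing (?P ! i) (?Q ! restrict \<sigma> {..<length ?P} i))"
    by (simp add: multiset_pairing_def Let_def len)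
  also have "\<dots> = (\<Sum>\<pi>\<in>bijections {..<length ?P} {..<length ?P}. \<Prod>i<length ?P. monomial_pairing (?P ! i) (?Q ! \<pi> i))"
    by (rule sum.reindex_bij_betw[OF bij_betw_permutes_bijections])
  also have "\<dots> = (\<Sum>\<pi>\<in>bijections {..<length ?P} {..<length ?Q}. \<Prod>i<length ?P.
      if ?P ! i = ?Q ! \<pi> i then monomial_pairing (?P ! i) (?P ! i) else 0)"
    unfolding len by (intro sum.cong prod.cong refl) (simp add: monomial_pairing_def)
  also have "\<dots> = (if mset ?P = mset ?Q then of_nat (mfact (mset ?P)) *
      prod_mset (image_mset (\<lambda>\<alpha>. monomial_pairing \<alpha> \<alpha>) (mset ?P)) else 0)"
    by (rule sum_bijections_diagonal)
  finally show ?thesis by simp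
next
  case False
  then have "length (list_of_mset M) \<noteq> length (list_of_mset N)"
    by (metis mset_list_of_mset size_mset)
  with False show ?thesis
    by (auto simp: multiset_pairing_def Let_def)
qed

section \<open>Vertex sets as sets of addresses\<close>

definition forest_set :: "nat list set list \<Rightarrow> nat list set" where
  "forest_set Vs = {i # p | i p. i < length Vs \<and> p \<in> Vs ! i}"

lemma Cons_in_forest_set [simp]: "i # p \<in> forest_set Vs \<longleftrightarrow> i < length Vs \<and> p \<in> Vs ! i"
  by (auto simp: forest_set_def)

lemma Nil_notin_forest_set [simp]: "[] \<notin> forest_set Vs"
  by (auto simp: forest_set_def)

text \<open>\<open>disjoint_vertices\<close> enumerates the vertex sets, not the trees. Permutations
  of an image multiset are images of permutations, so that enumeration lifts to one of the
  trees.\<close>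

lemma obtain_forest_enumeration:
  obtains Ts where "mset Ts = F" "forest_vertices F = forest_set (map tree_vertices Ts)"
    "tree_vertices (Node F) = insert [] (forest_set (map tree_vertices Ts))"
proof -
  let ?V = "list_of_mset (image_mset tree_vertices F)"
  have "?V \<in> permutations_of_multiset (image_mset tree_vertices F)"
    by (rule permutations_of_multisetI) simp
  then obtain Ts where "Ts \<in> permutations_of_multiset F" "?V = map tree_vertices Ts"
    unfolding permutations_of_multiset_image by auto
  then show ?thesis
    by (intro that[of Ts])
      (auto dest: permutations_of_multisetD simp: forest_vertices_def disjoint_vertices_def Let_def forest_set_def)
qed

text \<open>Abstract form of the vertex set of a tree: closed under passing to the parent. The
  isomorphism counts below use only this and finiteness.\<close>

definition prefix_closed :: "nat list set \<Rightarrow> bool" where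
  "prefix_closed V \<longleftrightarrow> [] \<in> V \<and> (\<forall>p i. p @ [i] \<in> V \<longrightarrow> p \<in> V)"

lemma prefix_closed_Nil: "prefix_closed V \<Longrightarrow> [] \<in> V"
  by (simp add: prefix_closed_def)

lemma prefix_closed_snoc: "prefix_closed V \<Longrightarrow> p @ [i] \<in> V \<Longrightarrow> p \<in> V"
  unfolding prefix_closed_def by blast

lemma forest_set_parent:
  assumes "\<forall>V\<in>set Vs. prefix_closed V" "p @ [i] \<in> forest_set Vs" "p \<noteq> []"
  shows "p \<in> forest_set Vs"
proof (cases p)
  case (Cons j q)
  then show ?thesis
    using assms(2) assms(1)[rule_format, OF nth_mem, of j] by (simp add: prefix_closed_def) blast
qed (use assms in simp)

lemma tree_vertices_finite_prefix_closed: "finite (tree_vertices T) \<and> prefix_closed (tree_vertices T)"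
proof (induction T)
  case (Node M)
  obtain Ts where Ts: "mset Ts = M" "tree_vertices (Node M) = insert [] (forest_set (map tree_vertices Ts))"
    by (rule obtain_forest_enumeration)
  have set_Ts: "finite (tree_vertices T) \<and> prefix_closed (tree_vertices T)" if "T \<in> set Ts" for T
    using Node that Ts(1) by auto
  have "forest_set (map tree_vertices Ts) = (\<Union>i<length Ts. (#) i ` tree_vertices (Ts ! i))"
    by (auto simp: forest_set_def)
  then have "finite (forest_set (map tree_vertices Ts))"
    using set_Ts by auto
  moreover have "prefix_closed (insert [] (forest_set (map tree_vertices Ts)))"
    unfolding prefix_closed_def[of "insert _ _"]
  proof (intro conjI allI impI)
    fix p i assume "p @ [i] \<in> insert [] (forest_set (map tree_vertices Ts))"
    then have "p @ [i] \<in> forest_set (map tree_vertices Ts)" by simp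
    then show "p \<in> insert [] (forest_set (map tree_vertices Ts))"
      using forest_set_parent[of "map tree_vertices Ts" p i] set_Ts by (cases "p = []") simp_all
  qed simp
  ultimately show ?case
    by (simp only: Ts(2) finite_insert simp_thms)
qed

lemmas finite_tree_vertices = tree_vertices_finite_prefix_closed[THEN conjunct1]
  and prefix_closed_tree_vertices = tree_vertices_finite_prefix_closed[THEN conjunct2]

lemma child_of_Cons: "child_of (i # p) (j # q) \<longleftrightarrow> i = j \<and> child_of p q"
  by (auto simp: child_of_def)

lemma not_child_of_Nil [simp]: "\<not> child_of [] v"
  by (simp add: child_of_def)

lemma child_of_snoc [simp]: "child_of (p @ [i]) q \<longleftrightarrow> q = p"
  by (auto simp: child_of_def)

text \<open>A child extends the address of its parent by one letter: the root has the children
  \<open>[i]\<close>, and below it the fertilities are those in the subtrees.\<close>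

lemma N_exponent_Node:
  "N_exponent (Node M) = Poly_Mapping.single (size M) 1 + sum_mset (image_mset N_exponent M)"
proof -
  obtain Ts where Ts: "mset Ts = M" "tree_vertices (Node M) = insert [] (forest_set (map tree_vertices Ts))"
    by (rule obtain_forest_enumeration)
  let ?W = "forest_set (map tree_vertices Ts)" and ?k = "length Ts"
  have W: "?W = (\<lambda>(i, p). i # p) ` Sigma {..<?k} (\<lambda>i. tree_vertices (Ts ! i))"
    by (auto simp: forest_set_def)
  have inj: "inj_on (\<lambda>(i, p). i # p) (Sigma {..<?k} (\<lambda>i. tree_vertices (Ts ! i)))"
    by (auto simp: inj_on_def)
  have fin: "finite ?W"
    unfolding W by (auto intro!: finite_imageI simp: finite_tree_vertices)
  have nil: "[] \<in> tree_vertices T" for T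
    using prefix_closed_tree_vertices[of T] by (simp add: prefix_closed_def)
  have roots: "{u \<in> insert [] ?W. child_of u []} = (\<lambda>i. [i]) ` {..<?k}"
  proof (intro equalityI subsetI)
    fix u assume "u \<in> (\<lambda>i. [i]) ` {..<?k}"
    then show "u \<in> {u \<in> insert [] ?W. child_of u []}"
      by (auto simp: nil child_of_def)
  next
    fix u assume "u \<in> {u \<in> insert [] ?W. child_of u []}"
    then show "u \<in> (\<lambda>i. [i]) ` {..<?k}"
      by (auto simp: child_of_def)
  qed
  have size_M: "?k = size M"
    using Ts(1) by auto
  have root: "fertility (Node M) [] = size M"
    unfolding fertility_def Ts(2) roots by (simp add: card_image inj_on_def size_M)
  have sub: "fertility (Node M) (i # p) = fertility (Ts ! i) p" if "i < ?k" for i p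
  proof -
    have "{u \<in> insert [] ?W. child_of u (i # p)} = (#) i ` {u \<in> tree_vertices (Ts ! i). child_of u p}"
      using that by (auto simp: child_of_def)
    then show ?thesis
      unfolding fertility_def Ts(2) by (simp add: card_image)
  qed
  have "N_exponent (Node M) = Poly_Mapping.single (size M) 1 +
      (\<Sum>v\<in>?W. Poly_Mapping.single (fertility (Node M) v) 1)"
    unfolding N_exponent_def Ts(2) using fin by (simp add: root)
  also have "(\<Sum>v\<in>?W. Poly_Mapping.single (fertility (Node M) v) 1) =
      (\<Sum>(i, p)\<in>Sigma {..<?k} (\<lambda>i. tree_vertices (Ts ! i)). Poly_Mapping.single (fertility (Ts ! i) p) (1::nat))"
    unfolding W by (subst sum.reindex[OF inj]) (auto intro!: sum.cong simp: sub)
  also have "\<dots> = (\<Sum>i<?k. N_exponent (Ts ! i))"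
    unfolding N_exponent_def by (subst sum.Sigma) (auto simp: finite_tree_vertices)
  also have "\<dots> = sum_mset (image_mset N_exponent M)"
    unfolding Ts(1)[symmetric]
    by (simp add: sum_mset_sum_list sum_list_sum_nth lessThan_atLeast0 flip: mset_map)
  finally show ?thesis .
qed

section \<open>Isomorphisms between vertex sets\<close>

definition vertex_isos :: "nat list set \<Rightarrow> nat list set \<Rightarrow> (nat list \<Rightarrow> nat list) set" where
  "vertex_isos V W = {\<sigma> \<in> bijections V W. \<forall>u\<in>V. \<forall>v\<in>V. child_of (\<sigma> u) (\<sigma> v) \<longleftrightarrow> child_of u v}"

lemma finite_vertex_isos: "finite V \<Longrightarrow> finite W \<Longrightarrow> finite (vertex_isos V W)"
  by (rule finite_subset[of _ "bijections V W"]) (simp_all add: finite_bijections vertex_isos_def)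

lemma vertex_isosD:
  assumes "\<sigma> \<in> vertex_isos V W"
  shows "\<sigma> \<in> extensional V" "inj_on \<sigma> V" "\<sigma> ` V = W" "\<And>u. u \<in> V \<Longrightarrow> \<sigma> u \<in> W"
    "\<And>u v. u \<in> V \<Longrightarrow> v \<in> V \<Longrightarrow> child_of (\<sigma> u) (\<sigma> v) \<longleftrightarrow> child_of u v"
  using assms by (auto simp: vertex_isos_def bijections_def bij_betw_def)

lemma vertex_isosI:
  assumes "\<sigma> \<in> extensional V" "inj_on \<sigma> V" "\<sigma> ` V = W"
    "\<And>u v. u \<in> V \<Longrightarrow> v \<in> V \<Longrightarrow> child_of (\<sigma> u) (\<sigma> v) \<longleftrightarrow> child_of u v"
  shows "\<sigma> \<in> vertex_isos V W"
  using assms by (auto simp: vertex_isos_def bijections_def bij_betw_def)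

lemma sym_factor_eq_card_vertex_isos:
  "sym_factor F = card (vertex_isos (forest_vertices F) (forest_vertices F))"
proof -
  let ?V = "forest_vertices F"
  have "bij_betw (\<lambda>\<sigma>. restrict \<sigma> ?V) (forest_automorphisms F) (vertex_isos ?V ?V)"
    using bij_betw_permutes_bijections[of ?V]
  proof (rule bij_betw_subset)
    have "(\<lambda>\<sigma>. restrict \<sigma> ?V) ` forest_automorphisms F =
        (\<lambda>\<sigma>. restrict \<sigma> ?V) ` {\<sigma>. \<sigma> permutes ?V} \<inter>
        {\<sigma>. \<forall>u\<in>?V. \<forall>v\<in>?V. child_of (\<sigma> u) (\<sigma> v) \<longleftrightarrow> child_of u v}"
      by (auto simp: forest_automorphisms_def)
    then show "(\<lambda>\<sigma>. restrict \<sigma> ?V) ` forest_automorphisms F = vertex_isos ?V ?V"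
      using bij_betw_permutes_bijections[of ?V] by (auto simp: vertex_isos_def bij_betw_def)
  qed (auto simp: forest_automorphisms_def)
  then show ?thesis
    by (simp add: sym_factor_def bij_betw_same_card)
qed

text \<open>Parents correspond to parents in both directions, and the roots of a forest are the
  vertices whose parent is missing; hence depth is preserved level by level.\<close>

lemma vertex_isos_length:
  assumes Vs: "\<forall>V\<in>set Vs. prefix_closed V" and Ws: "\<forall>W\<in>set Ws. prefix_closed W"
    and \<sigma>: "\<sigma> \<in> vertex_isos (forest_set Vs) (forest_set Ws)" and u: "u \<in> forest_set Vs"
  shows "length (\<sigma> u) = length u"
  using u
proof (induction u rule: rev_induct)
  case (snoc i p)
  note \<sigma>D = vertex_isosD[OF \<sigma>]
  have w: "\<sigma> (p @ [i]) \<in> forest_set Ws" using snoc.prems by (rule \<sigma>D(4))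
  show ?case
  proof (cases "p = []")
    case False
    then have p: "p \<in> forest_set Vs" using forest_set_parent[OF Vs snoc.prems] by blast
    then have "child_of (\<sigma> (p @ [i])) (\<sigma> p)" using \<sigma>D(5)[OF snoc.prems p] by simp
    with snoc.IH[OF p] show ?thesis by (auto simp: child_of_def)
  next
    case True
    have "\<sigma> (p @ [i]) \<noteq> []" using w by auto
    then obtain q j where q: "\<sigma> (p @ [i]) = q @ [j]" by (metis rev_exhaust)
    \<comment> \<open>If the image of a root were deeper, its parent would lie in the forest, and
      the preimage of that parent would be \<open>[]\<close>, which is not a vertex of a
      forest.\<close>
    have "q = []"
    proof (rule ccontr)
      assume "q \<noteq> []"
      with w q have "q \<in> forest_set Ws" using forest_set_parent[OF Ws, of q j] by simp
      then obtain v where v: "v \<in> forest_set Vs" "\<sigma> v = q" using \<sigma>D(3) by (metis imageE)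
      then have "child_of (p @ [i]) v" using \<sigma>D(5)[OF snoc.prems v(1)] q by simp
      then have "v = p" by simp
      with True v(1) show False by simp
    qed
    with q True show ?thesis by simp
  qed
qed simp

text \<open>The new root is the only vertex that is not a child, so it is fixed and restriction to
  the other vertices loses nothing.\<close>

lemma card_vertex_isos_graft:
  assumes Vs: "\<forall>V\<in>set Vs. prefix_closed V" and Ws: "\<forall>W\<in>set Ws. prefix_closed W"
  shows "card (vertex_isos (insert [] (forest_set Vs)) (insert [] (forest_set Ws))) =
    card (vertex_isos (forest_set Vs) (forest_set Ws))"
proof -
  let ?V = "forest_set Vs" and ?W = "forest_set Ws"
  have root: "\<sigma> [] = []" if \<sigma>: "\<sigma> \<in> vertex_isos (insert [] ?V) (insert [] ?W)" for \<sigma>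
  proof (rule ccontr)
    assume ne: "\<sigma> [] \<noteq> []"
    then obtain q j where q: "\<sigma> [] = q @ [j]" by (metis rev_exhaust)
    have "\<sigma> [] \<in> insert [] ?W" using vertex_isosD(4)[OF \<sigma>] by simp
    then have "q @ [j] \<in> ?W" unfolding q by simp
    then have "q = [] \<or> q \<in> ?W" using forest_set_parent[OF Ws, of q j] by blast
    then have "q \<in> insert [] ?W" by (simp only: insert_iff)
    then have "q \<in> \<sigma> ` insert [] ?V" by (simp only: vertex_isosD(3)[OF \<sigma>])
    then obtain v where v: "v \<in> insert [] ?V" "\<sigma> v = q" by (metis imageE)
    then show False using vertex_isosD(5)[OF \<sigma> _ v(1), of "[]"] q by simp
  qed
  have "bij_betw (\<lambda>\<sigma>. restrict \<sigma> ?V) (vertex_isos (insert [] ?V) (insert [] ?W)) (vertex_isos ?V ?W)"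
  proof (rule bij_betw_byWitness[where f' = "\<lambda>\<tau>. \<tau>([] := [])"])
    show "\<forall>\<sigma>\<in>vertex_isos (insert [] ?V) (insert [] ?W). (restrict \<sigma> ?V)([] := []) = \<sigma>"
    proof
      fix \<sigma> assume \<sigma>: "\<sigma> \<in> vertex_isos (insert [] ?V) (insert [] ?W)"
      show "(restrict \<sigma> ?V)([] := []) = \<sigma>"
        using root[OF \<sigma>] vertex_isosD(1)[OF \<sigma>] by (auto simp: restrict_def extensional_def fun_eq_iff)
    qed
    show "\<forall>\<tau>\<in>vertex_isos ?V ?W. restrict (\<tau>([] := [])) ?V = \<tau>"
      by (auto dest!: vertex_isosD(1) simp: restrict_def extensional_def fun_eq_iff)
    show "(\<lambda>\<sigma>. restrict \<sigma> ?V) ` vertex_isos (insert [] ?V) (insert [] ?W) \<subseteq> vertex_isos ?V ?W"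
    proof (rule image_subsetI)
      fix \<sigma> assume \<sigma>: "\<sigma> \<in> vertex_isos (insert [] ?V) (insert [] ?W)"
      note D = vertex_isosD[OF \<sigma>]
      have "\<sigma> ` (insert [] ?V) = insert [] (\<sigma> ` ?V)" using root[OF \<sigma>] by simp
      moreover have "[] \<notin> \<sigma> ` ?V"
        using D(2) root[OF \<sigma>] Nil_notin_forest_set by (metis image_iff inj_onD insertCI)
      ultimately have "\<sigma> ` ?V = ?W"
        using D(3) Nil_notin_forest_set by (metis insert_ident)
      then show "restrict \<sigma> ?V \<in> vertex_isos ?V ?W"
        using D by (intro vertex_isosI) (auto simp: inj_on_def)
    qed
    show "(\<lambda>\<tau>. \<tau>([] := [])) ` vertex_isos ?V ?W \<subseteq> vertex_isos (insert [] ?V) (insert [] ?W)"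
    proof (rule image_subsetI)
      fix \<tau> assume \<tau>: "\<tau> \<in> vertex_isos ?V ?W"
      note D = vertex_isosD[OF \<tau>]
      \<comment> \<open>An isomorphism extends to the added root only if roots of the forest, the
        addresses of length 1, go to roots.\<close>
      have len: "length (\<tau> u) = length u" if "u \<in> ?V" for u
        using vertex_isos_length[OF Vs Ws \<tau> that] .
      have child_root: "child_of u [] \<longleftrightarrow> length u = 1" for u
        by (auto simp: child_of_def length_Suc_conv)
      have nn: "u \<noteq> []" if "u \<in> ?V" for u using that by auto
      have im: "\<tau>([] := []) ` ?V = ?W" using D(3) nn by (metis Nil_notin_forest_set fun_upd_image)
      show "\<tau>([] := []) \<in> vertex_isos (insert [] ?V) (insert [] ?W)"
      proof (rule vertex_isosI)
        show "\<tau>([] := []) \<in> extensional (insert [] ?V)" using D(1) by (auto simp: extensional_def)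
        have "inj_on (\<tau>([] := [])) ?V"
          using D(2,3) by (intro inj_on_fun_updI) simp_all
        then show "inj_on (\<tau>([] := [])) (insert [] ?V)"
          unfolding inj_on_insert using im by simp
        show "\<tau>([] := []) ` insert [] ?V = insert [] ?W" using im by simp
        fix u v assume uv: "u \<in> insert [] ?V" "v \<in> insert [] ?V"
        show "child_of ((\<tau>([] := [])) u) ((\<tau>([] := [])) v) \<longleftrightarrow> child_of u v"
        proof (cases "u = []")
          case False
          then have u: "u \<in> ?V" using uv(1) by simp
          show ?thesis
          proof (cases "v = []")
            case True
            then show ?thesis using False len[OF u] by (simp add: child_root)
          next
            case v: False
            then have "v \<in> ?V" using uv(2) by simp
            then show ?thesis using D(5)[OF u] False v by simp
          qed
        qed simp
      qed
    qed
  qed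
  then show ?thesis by (rule bij_betw_same_card)
qed

text \<open>An isomorphism of forests amounts to a bijection \<pi> between their trees, read off
  from the roots, and an isomorphism of the \<open>i\<close>-th tree onto the
  \<open>\<pi> i\<close>-th one for each \<open>i\<close>. \<open>?enc\<close> and
  \<open>?dec\<close> translate between both descriptions.\<close>

lemma card_vertex_isos_forest:
  assumes Vs: "\<forall>V\<in>set Vs. prefix_closed V" and Ws: "\<forall>W\<in>set Ws. prefix_closed W"
    and fin: "\<forall>V\<in>set Vs. finite V" "\<forall>W\<in>set Ws. finite W"
  shows "card (vertex_isos (forest_set Vs) (forest_set Ws)) =
    (\<Sum>\<pi>\<in>bijections {..<length Vs} {..<length Ws}. \<Prod>i<length Vs. card (vertex_isos (Vs ! i) (Ws ! \<pi> i)))"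
proof -
  let ?V = "forest_set Vs" and ?W = "forest_set Ws"
  let ?k = "length Vs" and ?l = "length Ws"
  let ?A = "vertex_isos ?V ?W"
  let ?B = "Sigma (bijections {..<?k} {..<?l}) (\<lambda>\<pi>. \<Pi>\<^sub>E i\<in>{..<?k}. vertex_isos (Vs ! i) (Ws ! \<pi> i))"
  let ?enc = "\<lambda>\<tau>. (restrict (\<lambda>i. hd (\<tau> [i])) {..<?k},
    restrict (\<lambda>i. restrict (\<lambda>p. tl (\<tau> (i # p))) (Vs ! i)) {..<?k})"
  let ?dec = "\<lambda>(\<pi>, s). restrict (\<lambda>v. \<pi> (hd v) # s (hd v) (tl v)) ?V"
  have root: "[] \<in> Vs ! i" if "i < ?k" for i
    using Vs[rule_format, OF nth_mem[OF that]] by (rule prefix_closed_Nil)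
  have root': "[] \<in> Ws ! i" if "i < ?l" for i
    using Ws[rule_format, OF nth_mem[OF that]] by (rule prefix_closed_Nil)
  have len: "length (\<tau> u) = length u" if "\<tau> \<in> ?A" "u \<in> ?V" for \<tau> u
    using vertex_isos_length[OF Vs Ws that] .
  \<comment> \<open>All vertices of the \<open>i\<close>-th tree go to the tree that contains the
    image of its root; this follows by walking down from the root.\<close>
  have decomp: "\<tau> (i # p) = hd (\<tau> [i]) # tl (\<tau> (i # p))"
    if \<tau>: "\<tau> \<in> ?A" and "i < ?k" "p \<in> Vs ! i" for \<tau> i p
    using that(3)
  proof (induction p rule: rev_induct)
    case Nil
    have "length (\<tau> [i]) = length [i]"
      using that root by (intro len) auto
    then show ?case by (cases "\<tau> [i]") auto
  next
    case (snoc j p)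
    have p: "p \<in> Vs ! i" using Vs[rule_format, OF nth_mem[OF that(2)]] snoc.prems by (rule prefix_closed_snoc)
    have "child_of (\<tau> (i # p @ [j])) (\<tau> (i # p))"
      using vertex_isosD(5)[OF \<tau>, of "i # p @ [j]" "i # p"] that(2) snoc.prems p
      by (simp add: child_of_Cons)
    then show ?case
      using snoc.IH[OF p] by (auto simp: child_of_def) (metis append_Cons list.sel(1,3))
  qed
  have "bij_betw ?enc ?A ?B"
  proof (rule bij_betw_byWitness[where f' = ?dec])
    show "\<forall>\<tau>\<in>?A. ?dec (?enc \<tau>) = \<tau>"
    proof
      fix \<tau> assume \<tau>: "\<tau> \<in> ?A"
      show "?dec (?enc \<tau>) = \<tau>"
      proof
        fix v show "?dec (?enc \<tau>) v = \<tau> v"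
        proof (cases "v \<in> ?V")
          case True
          then obtain i p where v: "v = i # p" "i < ?k" "p \<in> Vs ! i" by (auto simp: forest_set_def)
          then show ?thesis using decomp[OF \<tau> v(2,3)] True by simp
        next
          case False
          then show ?thesis using vertex_isosD(1)[OF \<tau>] by (simp add: extensional_def)
        qed
      qed
    qed
    show "\<forall>b\<in>?B. ?enc (?dec b) = b"
    proof
      fix b assume "b \<in> ?B"
      then obtain \<pi> s where b: "b = (\<pi>, s)" and \<pi>: "\<pi> \<in> bijections {..<?k} {..<?l}"
        and s: "s \<in> (\<Pi>\<^sub>E i\<in>{..<?k}. vertex_isos (Vs ! i) (Ws ! \<pi> i))"
        by auto
      have "restrict (\<lambda>i. hd (?dec (\<pi>, s) [i])) {..<?k} = \<pi>"
        using \<pi> root by (auto simp: bijections_def extensional_def restrict_def fun_eq_iff)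
      moreover have "restrict (\<lambda>i. restrict (\<lambda>p. tl (?dec (\<pi>, s) (i # p))) (Vs ! i)) {..<?k} = s"
      proof
        fix i
        show "restrict (\<lambda>i. restrict (\<lambda>p. tl (?dec (\<pi>, s) (i # p))) (Vs ! i)) {..<?k} i = s i"
        proof (cases "i < ?k")
          case True
          then have "s i \<in> extensional (Vs ! i)" using s by (auto intro: vertex_isosD(1))
          then show ?thesis using True by (auto simp: extensional_def restrict_def fun_eq_iff)
        next
          case False
          then show ?thesis using s by (auto simp: PiE_def extensional_def)
        qed
      qed
      ultimately show "?enc (?dec b) = b" unfolding b by simp
    qed
    show "?enc ` ?A \<subseteq> ?B"
    proof (rule image_subsetI)
      fix \<tau> assume \<tau>: "\<tau> \<in> ?A"
      note D = vertex_isosD[OF \<tau>]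
      define \<pi> where "\<pi> = (\<lambda>i. hd (\<tau> [i]))"
      define s where "s = (\<lambda>i p. tl (\<tau> (i # p)))"
      have \<tau>_eq: "\<tau> (i # p) = \<pi> i # s i p" if "i < ?k" "p \<in> Vs ! i" for i p
        using decomp[OF \<tau> that] by (simp add: \<pi>_def s_def)
      have \<tau>_root: "\<tau> [i] = [\<pi> i]" if "i < ?k" for i
        using len[OF \<tau>, of "[i]"] \<tau>_eq[OF that root[OF that]] that root by auto
      have \<pi>_less: "\<pi> i < ?l" if "i < ?k" for i
        using D(4)[of "[i]"] that root \<tau>_root by simp
      have \<pi>_inj: "inj_on \<pi> {..<?k}"
      proof (rule inj_onI)
        fix i j assume "i \<in> {..<?k}" "j \<in> {..<?k}" "\<pi> i = \<pi> j"
        then have "\<tau> [i] = \<tau> [j]" "[i] \<in> ?V" "[j] \<in> ?V" by (simp_all add: \<tau>_root root)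
        then show "i = j" using D(2) by (auto dest: inj_onD)
      qed
      have "\<pi> ` {..<?k} = {..<?l}"
      proof (intro equalityI subsetI)
        fix j assume "j \<in> {..<?l}"
        then have "[j] \<in> ?W" using root' by simp
        then obtain u where u: "u \<in> ?V" "\<tau> u = [j]" using D(3) by (metis imageE)
        then obtain i p where "u = i # p" "i < ?k" "p \<in> Vs ! i" by (auto simp: forest_set_def)
        with u \<tau>_eq[of i p] show "j \<in> \<pi> ` {..<?k}" by auto
      qed (use \<pi>_less in auto)
      with \<pi>_inj have "restrict \<pi> {..<?k} \<in> bijections {..<?k} {..<?l}"
        by (simp add: bijections_def bij_betw_def)
      moreover have "restrict (s i) (Vs ! i) \<in> vertex_isos (Vs ! i) (Ws ! \<pi> i)" if i: "i < ?k" for i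
      proof (rule vertex_isosI)
        have "inj_on (s i) (Vs ! i)"
        proof (rule inj_onI)
          fix p q assume "p \<in> Vs ! i" "q \<in> Vs ! i" "s i p = s i q"
          then have "\<tau> (i # p) = \<tau> (i # q)" "i # p \<in> ?V" "i # q \<in> ?V" using i by (simp_all add: \<tau>_eq)
          then show "p = q" using D(2) by (auto dest: inj_onD)
        qed
        then show "inj_on (restrict (s i) (Vs ! i)) (Vs ! i)" by (simp add: inj_on_def)
        have "s i ` (Vs ! i) = Ws ! \<pi> i"
        proof (intro equalityI subsetI)
          fix q assume "q \<in> s i ` (Vs ! i)"
          then obtain p where "p \<in> Vs ! i" "q = s i p" by auto
          then show "q \<in> Ws ! \<pi> i" using D(4)[of "i # p"] i by (simp add: \<tau>_eq)
        next
          fix q assume "q \<in> Ws ! \<pi> i"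
          then have "\<pi> i # q \<in> ?W" using \<pi>_less i by simp
          then obtain u where u: "u \<in> ?V" "\<tau> u = \<pi> i # q" using D(3) by (metis imageE)
          then obtain j p where jp: "u = j # p" "j < ?k" "p \<in> Vs ! j" by (auto simp: forest_set_def)
          then have "\<pi> j = \<pi> i" "s j p = q" using u \<tau>_eq[of j p] by auto
          then have "j = i" using \<pi>_inj jp i by (auto dest: inj_onD)
          then show "q \<in> s i ` (Vs ! i)" using jp \<open>s j p = q\<close> by auto
        qed
        then show "restrict (s i) (Vs ! i) ` (Vs ! i) = Ws ! \<pi> i" by simp
        fix u v assume "u \<in> Vs ! i" "v \<in> Vs ! i"
        then show "child_of (restrict (s i) (Vs ! i) u) (restrict (s i) (Vs ! i) v) \<longleftrightarrow> child_of u v"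
          using D(5)[of "i # u" "i # v"] i by (simp add: \<tau>_eq child_of_Cons)
      qed simp
      ultimately show "?enc \<tau> \<in> ?B"
        by (auto simp: \<pi>_def s_def)
    qed
    show "?dec ` ?B \<subseteq> ?A"
    proof (rule image_subsetI)
      fix b assume "b \<in> ?B"
      then obtain \<pi> s where b: "b = (\<pi>, s)" and \<pi>: "\<pi> \<in> bijections {..<?k} {..<?l}"
        and s: "s \<in> (\<Pi>\<^sub>E i\<in>{..<?k}. vertex_isos (Vs ! i) (Ws ! \<pi> i))"
        by auto
      have \<pi>_inj: "inj_on \<pi> {..<?k}" and \<pi>_im: "\<pi> ` {..<?k} = {..<?l}"
        using \<pi> by (auto simp: bijections_def bij_betw_def)
      have s_iso: "s i \<in> vertex_isos (Vs ! i) (Ws ! \<pi> i)" if "i < ?k" for i using s that by auto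
      let ?\<tau> = "restrict (\<lambda>v. \<pi> (hd v) # s (hd v) (tl v)) ?V"
      have "?\<tau> \<in> ?A"
      proof (rule vertex_isosI)
        show "inj_on ?\<tau> ?V"
        proof (rule inj_onI)
          fix u v assume u: "u \<in> ?V" and v: "v \<in> ?V" and eq: "?\<tau> u = ?\<tau> v"
          obtain i p where ip: "u = i # p" "i < ?k" "p \<in> Vs ! i" using u by (auto simp: forest_set_def)
          obtain j q where jq: "v = j # q" "j < ?k" "q \<in> Vs ! j" using v by (auto simp: forest_set_def)
          have "\<pi> i = \<pi> j" "s i p = s j q" using eq ip jq by auto
          then show "u = v"
            using \<pi>_inj ip jq vertex_isosD(2)[OF s_iso, of i] by (auto dest: inj_onD)
        qed
        show "?\<tau> ` ?V = ?W"
        proof (intro equalityI subsetI)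
          fix w assume "w \<in> ?\<tau> ` ?V"
          then obtain u where u: "u \<in> ?V" "w = ?\<tau> u" by auto
          then obtain i p where ip: "u = i # p" "i < ?k" "p \<in> Vs ! i" by (auto simp: forest_set_def)
          then have "\<pi> i < ?l" using \<pi>_im by auto
          then show "w \<in> ?W" using u ip vertex_isosD(4)[OF s_iso, of i p] by simp
        next
          fix w assume "w \<in> ?W"
          then obtain j q where jq: "w = j # q" "j < ?l" "q \<in> Ws ! j" by (auto simp: forest_set_def)
          then have "j \<in> \<pi> ` {..<?k}" using \<pi>_im by simp
          then obtain i where i: "i < ?k" "j = \<pi> i" by auto
          then have "q \<in> s i ` (Vs ! i)" using jq vertex_isosD(3)[OF s_iso, of i] by simp
          then obtain p where "p \<in> Vs ! i" "q = s i p" by auto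
          then have "?\<tau> (i # p) = w" "i # p \<in> ?V" using i jq by auto
          then show "w \<in> ?\<tau> ` ?V" by blast
        qed
        fix u v assume u: "u \<in> ?V" and v: "v \<in> ?V"
        obtain i p where ip: "u = i # p" "i < ?k" "p \<in> Vs ! i" using u by (auto simp: forest_set_def)
        obtain j q where jq: "v = j # q" "j < ?k" "q \<in> Vs ! j" using v by (auto simp: forest_set_def)
        have "\<pi> i = \<pi> j \<longleftrightarrow> i = j" using \<pi>_inj ip jq by (auto dest: inj_onD)
        then show "child_of (?\<tau> u) (?\<tau> v) \<longleftrightarrow> child_of u v"
          using u v ip jq vertex_isosD(5)[OF s_iso, of i p q] by (auto simp: child_of_Cons)
      qed simp
      then show "?dec b \<in> ?A" unfolding b by simp
    qed
  qed
  then have "card ?A = card ?B" by (rule bij_betw_same_card)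
  also have "\<dots> = (\<Sum>\<pi>\<in>bijections {..<?k} {..<?l}. card (\<Pi>\<^sub>E i\<in>{..<?k}. vertex_isos (Vs ! i) (Ws ! \<pi> i)))"
  proof (rule card_SigmaI)
    show "\<forall>\<pi>\<in>bijections {..<?k} {..<?l}. finite (\<Pi>\<^sub>E i\<in>{..<?k}. vertex_isos (Vs ! i) (Ws ! \<pi> i))"
    proof (intro ballI finite_PiE)
      fix \<pi> i assume "\<pi> \<in> bijections {..<?k} {..<?l}" "i \<in> {..<?k}"
      then have "\<pi> i < ?l" by (auto simp: bijections_def bij_betw_def)
      with \<open>i \<in> {..<?k}\<close> show "finite (vertex_isos (Vs ! i) (Ws ! \<pi> i))"
        using fin nth_mem[of i Vs] nth_mem[of "\<pi> i" Ws]
        by (intro finite_vertex_isos) simp_all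
    qed simp
  qed (simp add: finite_bijections)
  finally show ?thesis by (simp add: card_PiE)
qed

section \<open>Symmetry factors by recursion\<close>

primrec tree_sym :: "rtree \<Rightarrow> nat" where
  "tree_sym (Node M) = mfact M * prod_mset (image_mset tree_sym M)"

definition forest_sym :: "forest \<Rightarrow> nat" where
  "forest_sym F = mfact F * prod_mset (image_mset tree_sym F)"

lemma tree_sym_Node: "tree_sym (Node M) = forest_sym M"
  by (simp add: forest_sym_def)

text \<open>The hypothesis compares trees of \<open>Ts\<close> with arbitrary trees, as the
  induction hypothesis on subtrees does; it makes the sum over bijections diagonal.\<close>

lemma card_vertex_isos_lists:
  assumes "\<And>T T'. T \<in> set Ts \<Longrightarrow> card (vertex_isos (tree_vertices T) (tree_vertices T')) = (if T = T' then tree_sym T else 0)"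
  shows "card (vertex_isos (forest_set (map tree_vertices Ts)) (forest_set (map tree_vertices Us))) =
    (if mset Ts = mset Us then forest_sym (mset Ts) else 0)"
proof -
  have "card (vertex_isos (forest_set (map tree_vertices Ts)) (forest_set (map tree_vertices Us))) =
      (\<Sum>\<pi>\<in>bijections {..<length Ts} {..<length Us}. \<Prod>i<length Ts.
        card (vertex_isos (map tree_vertices Ts ! i) (map tree_vertices Us ! \<pi> i)))"
    by (subst card_vertex_isos_forest) (auto simp: prefix_closed_tree_vertices finite_tree_vertices)
  also have "\<dots> = (\<Sum>\<pi>\<in>bijections {..<length Ts} {..<length Us}. \<Prod>i<length Ts.
      if Ts ! i = Us ! \<pi> i then tree_sym (Ts ! i) else 0)"
  proof (intro sum.cong prod.cong refl)
    fix \<pi> i assume "\<pi> \<in> bijections {..<length Ts} {..<length Us}" "i \<in> {..<length Ts}"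
    then have "i < length Ts" "\<pi> i < length Us" by (auto simp: bijections_def bij_betw_def)
    then show "card (vertex_isos (map tree_vertices Ts ! i) (map tree_vertices Us ! \<pi> i)) =
        (if Ts ! i = Us ! \<pi> i then tree_sym (Ts ! i) else 0)"
      using assms[of "Ts ! i"] by simp
  qed
  also have "\<dots> = (if mset Ts = mset Us then forest_sym (mset Ts) else 0)"
    by (simp add: sum_bijections_diagonal forest_sym_def)
  finally show ?thesis .
qed

text \<open>Automorphisms of \<open>Node M\<close> may exchange subtrees, so the recursion has to
  compare different trees; hence the statement on pairs, which includes that unequal trees are not
  isomorphic.\<close>

lemma card_vertex_isos_tree:
  "card (vertex_isos (tree_vertices T) (tree_vertices T')) = (if T = T' then tree_sym T else 0)"
proof (induction T arbitrary: T')
  case (Node M)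
  obtain M' where T': "T' = Node M'" by (cases T')
  obtain Ts where Ts: "mset Ts = M" "tree_vertices (Node M) = insert [] (forest_set (map tree_vertices Ts))"
    by (rule obtain_forest_enumeration)
  obtain Us where Us: "mset Us = M'" "tree_vertices (Node M') = insert [] (forest_set (map tree_vertices Us))"
    by (rule obtain_forest_enumeration)
  have "card (vertex_isos (tree_vertices (Node M)) (tree_vertices T')) =
      card (vertex_isos (forest_set (map tree_vertices Ts)) (forest_set (map tree_vertices Us)))"
    unfolding T' Ts(2) Us(2) by (rule card_vertex_isos_graft) (auto simp: prefix_closed_tree_vertices)
  also have "\<dots> = (if mset Ts = mset Us then forest_sym (mset Ts) else 0)"
    by (rule card_vertex_isos_lists) (use Node Ts(1) in auto)
  finally show ?case
    by (simp only: Ts(1) Us(1) T' tree_sym_Node rtree.inject)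
qed

lemma sym_factor_eq: "sym_factor F = forest_sym F"
proof -
  obtain Ts where Ts: "mset Ts = F" "forest_vertices F = forest_set (map tree_vertices Ts)"
    by (rule obtain_forest_enumeration)
  show ?thesis
    unfolding sym_factor_eq_card_vertex_isos Ts(2)
    by (subst card_vertex_isos_lists) (simp_all add: card_vertex_isos_tree Ts(1))
qed

lemma tree_sym_pos: "tree_sym T > 0"
proof (induction T)
  case (Node M)
  then have "prod_mset (image_mset tree_sym M) > 0" by (induction M) auto
  then show ?case by (simp add: mfact_pos)
qed

lemma forest_sym_add_mset: "forest_sym (add_mset T F) = Suc (count F T) * tree_sym T * forest_sym F"
  by (simp add: forest_sym_def mfact_add_mset algebra_simps)

lemma forest_sym_pos: "forest_sym F > 0"
  using tree_sym_pos[of "Node F"] by (simp only: tree_sym_Node)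


section \<open>Power series in countably many variables\<close>

text \<open>A separate type, so that the Cauchy product can be a ring instance; powers, finite
  products and the binomial theorem then come from the type class.\<close>

typedef 'a mseries = "UNIV :: (exponent \<Rightarrow> 'a) set" morphisms coef Mseries
  by simp

lemma coef_Mseries [simp]: "coef (Mseries g) = g"
  by (simp add: Mseries_inverse)

lemma mseries_eqI: "(\<And>\<alpha>. coef P \<alpha> = coef Q \<alpha>) \<Longrightarrow> P = Q"
  by (metis coef_inverse ext)

definition splits :: "exponent \<Rightarrow> (exponent \<times> exponent) set" where
  "splits \<alpha> = {(\<beta>, \<gamma>). \<beta> + \<gamma> = \<alpha>}"

lemma finite_splits [simp]: "finite (splits \<alpha>)"
  unfolding splits_def by (rule finite_exponent_splits)

instantiation mseries :: (comm_ring_1) comm_ring_1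
begin

definition "0 = Mseries (\<lambda>\<alpha>. 0)"
definition "1 = Mseries (\<lambda>\<alpha>. if \<alpha> = 0 then 1 else 0)"
definition "P + Q = Mseries (\<lambda>\<alpha>. coef P \<alpha> + coef Q \<alpha>)"
definition "- P = Mseries (\<lambda>\<alpha>. - coef P \<alpha>)"
definition "P - Q = Mseries (\<lambda>\<alpha>. coef P \<alpha> - coef Q \<alpha>)"
definition "P * Q = Mseries (\<lambda>\<alpha>. \<Sum>(\<beta>, \<gamma>)\<in>splits \<alpha>. coef P \<beta> * coef Q \<gamma>)"

text \<open>Both sides run over the decompositions of \<alpha> into three exponents.\<close>

lemma sum_splits_assoc:
  "(\<Sum>(\<beta>, \<gamma>)\<in>splits \<alpha>. \<Sum>(\<delta>, \<epsilon>)\<in>splits \<beta>. h \<delta> \<epsilon> \<gamma>) = (\<Sum>(\<delta>, \<beta>)\<in>splits \<alpha>. \<Sum>(\<epsilon>, \<gamma>)\<in>splits \<beta>. (h \<delta> \<epsilon> \<gamma> :: 'b::comm_monoid_add))"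
proof -
  have "(\<Sum>(\<beta>, \<gamma>)\<in>splits \<alpha>. \<Sum>(\<delta>, \<epsilon>)\<in>splits \<beta>. h \<delta> \<epsilon> \<gamma>) =
      (\<Sum>((\<beta>, \<gamma>), (\<delta>, \<epsilon>))\<in>Sigma (splits \<alpha>) (\<lambda>(\<beta>, \<gamma>). splits \<beta>). h \<delta> \<epsilon> \<gamma>)"
    by (simp add: case_prod_unfold sum.Sigma)
  also have "\<dots> = (\<Sum>((\<delta>, \<beta>), (\<epsilon>, \<gamma>))\<in>Sigma (splits \<alpha>) (\<lambda>(\<delta>, \<beta>). splits \<beta>). h \<delta> \<epsilon> \<gamma>)"
    by (rule sum.reindex_bij_witness[where
          i = "\<lambda>((\<delta>, \<beta>), (\<epsilon>, \<gamma>)). ((\<delta> + \<epsilon>, \<gamma>), (\<delta>, \<epsilon>))" and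
          j = "\<lambda>((\<beta>, \<gamma>), (\<delta>, \<epsilon>)). ((\<delta>, \<epsilon> + \<gamma>), (\<epsilon>, \<gamma>))"])
      (auto simp: splits_def add.assoc)
  also have "\<dots> = (\<Sum>(\<delta>, \<beta>)\<in>splits \<alpha>. \<Sum>(\<epsilon>, \<gamma>)\<in>splits \<beta>. h \<delta> \<epsilon> \<gamma>)"
    by (simp add: case_prod_unfold sum.Sigma)
  finally show ?thesis .
qed

instance
proof
  fix a b c :: "'a mseries"
  show "a + b + c = a + (b + c)" "a + b = b + a" "0 + a = a" "- a + a = 0" "a - b = a + - b"
    by (simp_all add: plus_mseries_def zero_mseries_def uminus_mseries_def minus_mseries_def add_ac coef_inverse)
  show "a * b * c = a * (b * c)"
  proof (rule mseries_eqI)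
    fix \<alpha>
    have "coef (a * b * c) \<alpha> = (\<Sum>(\<beta>, \<gamma>)\<in>splits \<alpha>. \<Sum>(\<delta>, \<epsilon>)\<in>splits \<beta>. coef a \<delta> * coef b \<epsilon> * coef c \<gamma>)"
      by (simp add: times_mseries_def sum_distrib_right case_prod_unfold)
    also have "\<dots> = (\<Sum>(\<delta>, \<beta>)\<in>splits \<alpha>. \<Sum>(\<epsilon>, \<gamma>)\<in>splits \<beta>. coef a \<delta> * coef b \<epsilon> * coef c \<gamma>)"
      by (rule sum_splits_assoc)
    also have "\<dots> = coef (a * (b * c)) \<alpha>"
      by (simp add: times_mseries_def sum_distrib_left case_prod_unfold mult.assoc)
    finally show "coef (a * b * c) \<alpha> = coef (a * (b * c)) \<alpha>" .
  qed
  show "a * b = b * a"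
  proof (rule mseries_eqI)
    fix \<alpha>
    have "coef (a * b) \<alpha> = (\<Sum>(\<beta>, \<gamma>)\<in>splits \<alpha>. coef a \<beta> * coef b \<gamma>)"
      by (simp add: times_mseries_def)
    also have "\<dots> = (\<Sum>(\<beta>, \<gamma>)\<in>splits \<alpha>. coef b \<beta> * coef a \<gamma>)"
      by (rule sum.reindex_bij_witness[where i = "\<lambda>(\<beta>, \<gamma>). (\<gamma>, \<beta>)" and j = "\<lambda>(\<beta>, \<gamma>). (\<gamma>, \<beta>)"])
        (auto simp: splits_def add.commute mult.commute)
    also have "\<dots> = coef (b * a) \<alpha>"
      by (simp add: times_mseries_def)
    finally show "coef (a * b) \<alpha> = coef (b * a) \<alpha>" .
  qed
  show "1 * a = a"
  proof (rule mseries_eqI)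
    fix \<alpha>
    have "coef (1 * a) \<alpha> = (\<Sum>x\<in>splits \<alpha>. if x = (0, \<alpha>) then coef a \<alpha> else 0)"
      unfolding times_mseries_def coef_Mseries
      by (rule sum.cong[OF refl]) (auto simp: one_mseries_def splits_def split: if_splits)
    moreover have "(0, \<alpha>) \<in> splits \<alpha>"
      by (simp add: splits_def)
    ultimately show "coef (1 * a) \<alpha> = coef a \<alpha>" by simp
  qed
  show "(a + b) * c = a * c + b * c"
    by (rule mseries_eqI) (simp add: times_mseries_def plus_mseries_def distrib_right case_prod_unfold sum.distrib)
  have "coef (0 :: 'a mseries) 0 \<noteq> coef 1 0"
    by (simp add: zero_mseries_def one_mseries_def)
  then show "(0 :: 'a mseries) \<noteq> 1" by metis
qed

end

lemma coef_simps [simp]: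
  "coef 0 \<alpha> = 0" "coef (P + Q) \<alpha> = coef P \<alpha> + coef Q \<alpha>" "coef (P - Q) \<alpha> = coef P \<alpha> - coef Q \<alpha>"
  "coef (- P) \<alpha> = - coef P \<alpha>" "coef 1 \<alpha> = (if \<alpha> = 0 then 1 else 0)"
  by (simp_all add: zero_mseries_def plus_mseries_def minus_mseries_def uminus_mseries_def one_mseries_def)

lemma coef_mult: "coef (P * Q) \<alpha> = (\<Sum>(\<beta>, \<gamma>)\<in>splits \<alpha>. coef P \<beta> * coef Q \<gamma>)"
  by (simp add: times_mseries_def)

lemma coef_sum: "coef (sum g A) \<alpha> = (\<Sum>x\<in>A. coef (g x) \<alpha>)"
  by (induction A rule: infinite_finite_induct) simp_all

definition monom_series :: "exponent \<Rightarrow> 'a \<Rightarrow> 'a::comm_ring_1 mseries" where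
  "monom_series \<beta> c = Mseries (\<lambda>\<alpha>. if \<alpha> = \<beta> then c else 0)"

lemma coef_monom_series: "coef (monom_series \<beta> c) \<alpha> = (if \<alpha> = \<beta> then c else 0)"
  by (simp add: monom_series_def)

lemma monom_series_mult: "monom_series \<beta> c * monom_series \<gamma> d = monom_series (\<beta> + \<gamma>) (c * d)"
proof (rule mseries_eqI)
  fix \<alpha>
  have "coef (monom_series \<beta> c * monom_series \<gamma> d) \<alpha> =
      (\<Sum>x\<in>splits \<alpha>. if x = (\<beta>, \<gamma>) then c * d else 0)"
    unfolding coef_mult by (rule sum.cong[OF refl]) (auto simp: coef_monom_series split: if_splits)
  also have "\<dots> = coef (monom_series (\<beta> + \<gamma>) (c * d)) \<alpha>"
    by (subst sum.delta, rule finite_splits) (auto simp: coef_monom_series splits_def)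
  finally show "coef (monom_series \<beta> c * monom_series \<gamma> d) \<alpha> = coef (monom_series (\<beta> + \<gamma>) (c * d)) \<alpha>" .
qed

lemma monom_series_one: "monom_series 0 1 = 1"
  by (rule mseries_eqI) (simp add: coef_monom_series)

lemma monom_series_add: "monom_series \<beta> (c + d) = monom_series \<beta> c + monom_series \<beta> d"
  by (rule mseries_eqI) (simp add: coef_monom_series)

lemma monom_series_of_nat: "monom_series 0 (of_nat n) = of_nat n"
proof (induction n)
  case 0
  show ?case by (rule mseries_eqI) (simp add: coef_monom_series)
qed (simp add: monom_series_add monom_series_one)

lemma coef_const_mult: "coef (monom_series 0 c * P) \<alpha> = c * coef P \<alpha>"
proof -
  have "coef (monom_series 0 c * P) \<alpha> = (\<Sum>x\<in>splits \<alpha>. if x = (0, \<alpha>) then c * coef P \<alpha> else 0)"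
    unfolding coef_mult by (rule sum.cong[OF refl]) (auto simp: coef_monom_series splits_def split: if_splits)
  also have "(\<Sum>x\<in>splits \<alpha>. if x = (0, \<alpha>) then c * coef P \<alpha> else 0) = c * coef P \<alpha>"
    by (subst sum.delta, rule finite_splits) (simp add: splits_def)
  finally show ?thesis .
qed

lemma coef_monom_mult_const: "coef (monom_series \<beta> c * monom_series 0 d) \<alpha> = (if \<alpha> = \<beta> then c * d else 0)"
  by (simp add: monom_series_mult coef_monom_series)

section \<open>Total degree and agreement of series up to a degree\<close>

definition edeg :: "exponent \<Rightarrow> nat" where
  "edeg \<alpha> = (\<Sum>i\<in>Poly_Mapping.keys \<alpha>. Poly_Mapping.lookup \<alpha> i)"

lemma edeg_superset:
  "finite A \<Longrightarrow> Poly_Mapping.keys \<alpha> \<subseteq> A \<Longrightarrow> edeg \<alpha> = (\<Sum>i\<in>A. Poly_Mapping.lookup \<alpha> i)"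
  unfolding edeg_def by (rule sum.mono_neutral_left) (auto simp: in_keys_iff)

lemma edeg_add [simp]: "edeg (\<alpha> + \<beta>) = edeg \<alpha> + edeg \<beta>"
proof -
  let ?A = "Poly_Mapping.keys \<alpha> \<union> Poly_Mapping.keys \<beta>"
  have "edeg (\<alpha> + \<beta>) = (\<Sum>i\<in>?A. Poly_Mapping.lookup (\<alpha> + \<beta>) i)"
    by (rule edeg_superset) (simp_all add: keys_add)
  then show ?thesis
    by (simp add: lookup_add sum.distrib edeg_superset[of ?A])
qed

lemma edeg_zero [simp]: "edeg 0 = 0"
  by (simp add: edeg_def)

lemma edeg_single [simp]: "edeg (Poly_Mapping.single i n) = n"
  by (simp add: edeg_def)

lemma edeg_sum_mset: "edeg (sum_mset M) = sum_mset (image_mset edeg M)"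
  by (induction M) simp_all

lemma edeg_eq_0_iff [simp]: "edeg \<alpha> = 0 \<longleftrightarrow> \<alpha> = 0"
  by (auto simp: edeg_def in_keys_iff poly_mapping_eq_iff fun_eq_iff)

lemma edeg_splits: "(\<beta>, \<gamma>) \<in> splits \<alpha> \<Longrightarrow> edeg \<alpha> = edeg \<beta> + edeg \<gamma>"
  by (auto simp: splits_def)

text \<open>Equations between series are proved degree by degree, with finite sums that are correct
  up to degree \<open>n\<close> in place of infinite ones.\<close>

definition agree :: "nat \<Rightarrow> 'a mseries \<Rightarrow> 'a mseries \<Rightarrow> bool" where
  "agree n P Q \<longleftrightarrow> (\<forall>\<alpha>. edeg \<alpha> \<le> n \<longrightarrow> coef P \<alpha> = coef Q \<alpha>)"

lemma agree_refl [simp]: "agree n P P"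
  by (simp add: agree_def)

lemma agree_sym: "agree n P Q \<Longrightarrow> agree n Q P"
  by (simp add: agree_def)

lemma agree_trans [trans]: "agree n P Q \<Longrightarrow> agree n Q R \<Longrightarrow> agree n P R"
  by (simp add: agree_def)

lemma agree_eqI: "(\<And>n. agree n P Q) \<Longrightarrow> P = Q"
  by (rule mseries_eqI) (auto simp: agree_def)

lemma agree_sum:
  fixes g g' :: "'b \<Rightarrow> 'a::comm_ring_1 mseries"
  shows "(\<And>x. x \<in> A \<Longrightarrow> agree n (g x) (g' x)) \<Longrightarrow> agree n (sum g A) (sum g' A)"
  by (auto simp: agree_def coef_sum intro!: sum.cong)

lemma agree_mult:
  fixes P P' Q Q' :: "'a::comm_ring_1 mseries"
  assumes "agree n P P'" "agree n Q Q'"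
  shows "agree n (P * Q) (P' * Q')"
  unfolding agree_def coef_mult
  by (intro allI impI sum.cong refl) (use assms in \<open>auto simp: agree_def edeg_splits\<close>)

lemma agree_power: "agree n P (P' :: 'a::comm_ring_1 mseries) \<Longrightarrow> agree n (P ^ k) (P' ^ k)"
  by (induction k) (simp_all add: agree_mult)

text \<open>The contraction property behind the uniqueness proofs: a factor without constant term
  gains one degree of agreement.\<close>

lemma agree_Suc_mult:
  fixes P Q G :: "'a::comm_ring_1 mseries"
  assumes "agree n P Q" "coef G 0 = 0"
  shows "agree (Suc n) (G * P) (G * Q)"
  unfolding agree_def coef_mult
proof (intro allI impI sum.cong refl)
  fix \<alpha> x assume \<alpha>: "edeg \<alpha> \<le> Suc n" and x: "x \<in> splits \<alpha>"
  obtain \<beta> \<gamma> where [simp]: "x = (\<beta>, \<gamma>)" by (cases x)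
  show "(case x of (\<beta>, \<gamma>) \<Rightarrow> coef G \<beta> * coef P \<gamma>) = (case x of (\<beta>, \<gamma>) \<Rightarrow> coef G \<beta> * coef Q \<gamma>)"
  proof (cases "\<beta> = 0")
    case False
    then have "edeg \<beta> \<noteq> 0" by simp
    moreover have "edeg \<alpha> = edeg \<beta> + edeg \<gamma>" using x by (auto dest: edeg_splits)
    ultimately have "edeg \<gamma> \<le> n" using \<alpha> by linarith
    then show ?thesis using assms(1) by (simp add: agree_def)
  qed (use assms(2) in simp)
qed

definition order_ge :: "nat \<Rightarrow> 'a::zero mseries \<Rightarrow> bool" where
  "order_ge n P \<longleftrightarrow> (\<forall>\<alpha>. edeg \<alpha> < n \<longrightarrow> coef P \<alpha> = 0)"

lemma order_ge_0 [simp]: "order_ge 0 P"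
  by (simp add: order_ge_def)

lemma order_ge_1_iff: "order_ge 1 P \<longleftrightarrow> coef P 0 = 0"
  by (auto simp: order_ge_def)

lemma order_ge_mult:
  fixes P Q :: "'a::comm_ring_1 mseries"
  assumes "order_ge m P" "order_ge n Q"
  shows "order_ge (m + n) (P * Q)"
  unfolding order_ge_def coef_mult
proof (intro allI impI sum.neutral ballI)
  fix \<alpha> x assume \<alpha>: "edeg \<alpha> < m + n" and x: "x \<in> splits \<alpha>"
  obtain \<beta> \<gamma> where [simp]: "x = (\<beta>, \<gamma>)" by (cases x)
  have "edeg \<beta> < m \<or> edeg \<gamma> < n" using \<alpha> x by (auto dest: edeg_splits)
  then show "(case x of (\<beta>, \<gamma>) \<Rightarrow> coef P \<beta> * coef Q \<gamma>) = 0"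
    using assms by (auto simp: order_ge_def)
qed

lemma order_ge_power: "order_ge 1 P \<Longrightarrow> order_ge k ((P :: 'a::comm_ring_1 mseries) ^ k)"
  using order_ge_mult[of 1 P] by (induction k) auto

definition map_series :: "('a \<Rightarrow> 'b) \<Rightarrow> 'a mseries \<Rightarrow> 'b mseries" where
  "map_series \<phi> P = Mseries (\<lambda>\<alpha>. \<phi> (coef P \<alpha>))"

lemma coef_map_series [simp]: "coef (map_series \<phi> P) \<alpha> = \<phi> (coef P \<alpha>)"
  by (simp add: map_series_def)

lemma agree_map_series: "agree n P Q \<Longrightarrow> agree n (map_series \<phi> P) (map_series \<phi> Q)"
  by (simp add: agree_def)


section \<open>Sums over all rooted trees\<close>

lemma edeg_N_exponent_Node: "edeg (N_exponent (Node M)) = Suc (\<Sum>T\<in>#M. edeg (N_exponent T))"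
  by (simp add: N_exponent_Node edeg_sum_mset multiset.map_comp o_def)

text \<open>Each vertex contributes one variable, so this is the number of vertices of
  \<open>T\<close>.\<close>

abbreviation tree_deg :: "rtree \<Rightarrow> nat" where
  "tree_deg T \<equiv> edeg (N_exponent T)"

lemma tree_deg_pos: "tree_deg T > 0"
  by (cases T) (simp add: edeg_N_exponent_Node)

lemma size_le_sum_tree_deg: "size M \<le> (\<Sum>T\<in>#M. tree_deg T)"
proof (induction M)
  case (add T M)
  then show ?case using tree_deg_pos[of T] by simp
qed simp

definition msets_of :: "'a set \<Rightarrow> nat \<Rightarrow> 'a multiset set" where
  "msets_of S k = {M. set_mset M \<subseteq> S \<and> size M = k}"

lemma msets_of_eq: "msets_of S k = mset ` {xs. set xs \<subseteq> S \<and> length xs = k}"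
proof (intro equalityI subsetI)
  fix M assume "M \<in> msets_of S k"
  moreover obtain xs where "mset xs = M" using ex_mset by blast
  ultimately show "M \<in> mset ` {xs. set xs \<subseteq> S \<and> length xs = k}"
    by (auto simp: msets_of_def intro!: image_eqI[of _ _ xs])
qed (auto simp: msets_of_def)

lemma finite_msets_of: "finite S \<Longrightarrow> finite (msets_of S k)"
  unfolding msets_of_eq by (simp add: finite_lists_length_eq)

text \<open>The power expands into a sum over words; words with the same underlying multiset have
  equal products, so they are counted by the orderings of that multiset.\<close>

lemma multinomial:
  fixes d :: "'b \<Rightarrow> 'a::comm_semiring_1"
  assumes "finite S"
  shows "(\<Sum>T\<in>S. d T) ^ k =
    (\<Sum>M\<in>msets_of S k. of_nat (card (permutations_of_multiset M)) * prod_mset (image_mset d M))"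
proof -
  let ?L = "\<lambda>k. {xs. set xs \<subseteq> S \<and> length xs = k}"
  have lists: "(\<Sum>T\<in>S. d T) ^ k = (\<Sum>xs\<in>?L k. prod_list (map d xs))" for k
  proof (induction k)
    case 0
    have "?L 0 = {[]}" by auto
    then show ?case by simp
  next
    case (Suc k)
    have L: "?L (Suc k) = (\<lambda>(T, xs). T # xs) ` (S \<times> ?L k)"
      by (auto simp: length_Suc_conv image_iff)
    have inj: "inj_on (\<lambda>(T, xs). T # xs) (S \<times> ?L k)" by (auto simp: inj_on_def)
    have "(\<Sum>T\<in>S. d T) ^ Suc k = (\<Sum>T\<in>S. \<Sum>xs\<in>?L k. d T * prod_list (map d xs))"
      by (simp add: Suc sum_product)
    also have "\<dots> = (\<Sum>xs\<in>?L (Suc k). prod_list (map d xs))"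
      unfolding L sum.reindex[OF inj] by (simp add: sum.cartesian_product case_prod_unfold)
    finally show ?case .
  qed
  have "(\<Sum>xs\<in>?L k. prod_list (map d xs)) = (\<Sum>M\<in>mset ` ?L k. \<Sum>xs\<in>{xs \<in> ?L k. mset xs = M}. prod_list (map d xs))"
    using assms by (intro sum.image_gen) (simp add: finite_lists_length_eq)
  also have "\<dots> = (\<Sum>M\<in>msets_of S k. of_nat (card (permutations_of_multiset M)) * prod_mset (image_mset d M))"
  proof (intro sum.cong)
    fix M assume M: "M \<in> msets_of S k"
    then have "{xs \<in> ?L k. mset xs = M} = permutations_of_multiset M"
      by (auto simp: msets_of_def permutations_of_multiset_def)
    moreover have "prod_list (map d xs) = prod_mset (image_mset d M)" if "xs \<in> permutations_of_multiset M" for xs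
      using that by (auto simp: permutations_of_multiset_def prod_mset_prod_list simp flip: mset_map)
    ultimately show "(\<Sum>xs\<in>{xs \<in> ?L k. mset xs = M}. prod_list (map d xs)) =
        of_nat (card (permutations_of_multiset M)) * prod_mset (image_mset d M)"
      by simp
  qed (simp add: msets_of_eq)
  finally show ?thesis by (simp add: lists)
qed

definition trees_upto :: "nat \<Rightarrow> rtree set" where
  "trees_upto n = {T. tree_deg T \<le> n}"

text \<open>A tree with at most \<open>n + 1\<close> vertices is a root with at most
  \<open>n\<close> subtrees, each from \<open>trees_upto n\<close>.\<close>

lemma finite_trees_upto: "finite (trees_upto n)"
proof (induction n)
  case 0
  have "T \<notin> trees_upto 0" for T using tree_deg_pos[of T] by (auto simp: trees_upto_def)
  then have "trees_upto 0 = {}" by blast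
  then show ?case by simp
next
  case (Suc n)
  have "trees_upto (Suc n) \<subseteq> Node ` (\<Union>k\<le>n. msets_of (trees_upto n) k)"
  proof
    fix T assume T: "T \<in> trees_upto (Suc n)"
    obtain M where M: "T = Node M" by (cases T)
    have s: "(\<Sum>T\<in>#M. tree_deg T) \<le> n" using T M by (simp add: trees_upto_def edeg_N_exponent_Node)
    have "set_mset M \<subseteq> trees_upto n"
    proof
      fix T' assume "T' \<in># M"
      then obtain M' where "M = add_mset T' M'" by (metis mset_add)
      with s show "T' \<in> trees_upto n" by (simp add: trees_upto_def)
    qed
    then have "M \<in> msets_of (trees_upto n) (size M)" by (simp add: msets_of_def)
    moreover have "size M \<le> n" using size_le_sum_tree_deg[of M] s by simp
    ultimately show "T \<in> Node ` (\<Union>k\<le>n. msets_of (trees_upto n) k)" using M by auto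
  qed
  moreover have "finite (Node ` (\<Union>k\<le>n. msets_of (trees_upto n) k))"
    using Suc by (simp add: finite_msets_of)
  ultimately show ?case by (rule finite_subset)
qed

text \<open>The condition under which the sum of \<open>y T\<close> over all trees is a formal
  series: only finitely many trees contribute to each coefficient.\<close>

definition graded :: "(rtree \<Rightarrow> 'a::zero mseries) \<Rightarrow> bool" where
  "graded y \<longleftrightarrow> (\<forall>T. order_ge (tree_deg T) (y T))"

definition tree_sum :: "(rtree \<Rightarrow> 'a::comm_ring_1 mseries) \<Rightarrow> 'a mseries" where
  "tree_sum y = Mseries (\<lambda>\<alpha>. \<Sum>T\<in>trees_upto (edeg \<alpha>). coef (y T) \<alpha>)"

lemma coef_tree_sum:
  assumes "graded y" "edeg \<alpha> \<le> n"
  shows "coef (tree_sum y) \<alpha> = (\<Sum>T\<in>trees_upto n. coef (y T) \<alpha>)"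
  unfolding tree_sum_def coef_Mseries
proof (rule sum.mono_neutral_left)
  show "finite (trees_upto n)" by (rule finite_trees_upto)
qed (use assms in \<open>auto simp: trees_upto_def graded_def order_ge_def\<close>)

lemma agree_tree_sum: "graded y \<Longrightarrow> agree n (tree_sum y) (\<Sum>T\<in>trees_upto n. y T)"
  by (simp add: agree_def coef_sum coef_tree_sum)

lemma order_ge_tree_sum: "graded y \<Longrightarrow> order_ge 1 (tree_sum y)"
  using tree_deg_pos by (auto simp: order_ge_1_iff tree_sum_def graded_def order_ge_def intro!: sum.neutral)

lemma tree_sum_add: "tree_sum (\<lambda>T. y T + z T) = tree_sum y + tree_sum z"
  by (rule mseries_eqI) (simp add: tree_sum_def sum.distrib)

text \<open>Truncation at an arbitrary \<open>N \<ge> n\<close> stands for the infinite sum over \<open>k\<close>.\<close>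

lemma tree_sum_exponential:
  fixes y d :: "rtree \<Rightarrow> ('k::comm_monoid_add \<Rightarrow>\<^sub>0 complex) mseries"
    and \<phi> :: "('k \<Rightarrow>\<^sub>0 complex) \<Rightarrow> ('k \<Rightarrow>\<^sub>0 complex)"
  assumes d: "graded d" and y: "graded y" and lin: "plinear \<phi>"
    and rec: "\<And>M. y (Node M) = monom_series 0 (Poly_Mapping.single 0 (1 / of_nat (mfact M))) *
        (G (size M) * map_series \<phi> (prod_mset (image_mset d M)))"
    and G: "\<And>k. coef (G k) 0 = 0" and "n \<le> N"
  shows "agree n (tree_sum y) (\<Sum>k\<le>N. monom_series 0 (Poly_Mapping.single 0 (1 / fact k)) *
      (G k * map_series \<phi> (tree_sum d ^ k)))"
proof (cases n)
  case 0
  have "coef (G k * Q) 0 = 0" for k Q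
    using order_ge_mult[of 1 "G k" 0 Q] G by (simp add: order_ge_1_iff[symmetric])
  moreover have "coef (tree_sum y) 0 = 0"
    using order_ge_tree_sum[OF y] unfolding order_ge_1_iff .
  ultimately show ?thesis
    using 0 by (auto simp: agree_def coef_sum coef_const_mult)
next
  case (Suc m)
  let ?c = "\<lambda>z :: complex. monom_series 0 (Poly_Mapping.single 0 z) :: ('k \<Rightarrow>\<^sub>0 complex) mseries"
  \<comment> \<open>The root takes one degree: in a tree of degree at most \<open>n = m + 1\<close>
    all subtrees at the root have degree at most \<open>m\<close>.\<close>
  let ?S = "trees_upto m"
  let ?D = "\<Sum>T\<in>?S. d T"
  let ?U = "\<Union>k\<le>N. msets_of ?S k"
  have pow: "map_series \<phi> (?D ^ k) = (\<Sum>M\<in>msets_of ?S k. ?c (of_nat (card (permutations_of_multiset M))) *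
      map_series \<phi> (prod_mset (image_mset d M)))" for k
  proof -
    have of_nat: "of_nat j = ?c (of_nat j)" for j
      by (simp add: monom_series_of_nat)
    show ?thesis
      unfolding multinomial[OF finite_trees_upto] of_nat by (rule mseries_eqI)
      (simp add: coef_sum plinear_sum[OF lin] coef_const_mult plinear_pscale[OF lin]
          del: single_of_nat flip: pscale_conv_mult)
  qed
  \<comment> \<open>As \<open>M\<close> has \<open>k! / mfact M\<close> orderings, the weights
    \<open>1 / mfact M\<close> of the trees \<open>Node M\<close> with \<open>k\<close> subtrees
    produce \<open>1 / k!\<close> times a \<open>k\<close>-th power.\<close>
  have level: "(\<Sum>M\<in>msets_of ?S k. y (Node M)) = ?c (1 / fact k) * (G k * map_series \<phi> (?D ^ k))" for k
  proof -
    have "y (Node M) = ?c (1 / fact k) * (G k * (?c (of_nat (card (permutations_of_multiset M))) *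
        map_series \<phi> (prod_mset (image_mset d M))))" if "M \<in> msets_of ?S k" for M
    proof -
      have "card (permutations_of_multiset M) * mfact M = fact (size M)"
        unfolding mfact_def by (rule card_permutations_of_multiset_aux)
      then have "of_nat (card (permutations_of_multiset M)) * of_nat (mfact M) = (fact k :: complex)"
        using that by (metis (mono_tags, lifting) mem_Collect_eq msets_of_def of_nat_fact of_nat_mult)
      then have "(1 / fact k) * of_nat (card (permutations_of_multiset M)) = 1 / (of_nat (mfact M) :: complex)"
        using mfact_pos[of M] by (simp add: field_simps)
      then have "?c (1 / of_nat (mfact M)) = ?c (1 / fact k) * ?c (of_nat (card (permutations_of_multiset M)))"
        by (simp add: monom_series_mult mult_single del: single_of_nat)
      then show ?thesis
        using that by (simp add: rec msets_of_def mult_ac)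
    qed
    then show ?thesis
      unfolding pow by (simp add: sum_distrib_left)
  qed
  have "agree n (tree_sum y) (\<Sum>T\<in>Node ` ?U. y T)"
    unfolding agree_def
  proof (intro allI impI)
    fix \<alpha> assume \<alpha>: "edeg \<alpha> \<le> n"
    have sub: "trees_upto n \<subseteq> Node ` ?U"
    proof
      fix T assume T: "T \<in> trees_upto n"
      obtain M where M: "T = Node M" by (cases T)
      have s: "(\<Sum>T\<in>#M. tree_deg T) \<le> m" using T M Suc by (simp add: trees_upto_def edeg_N_exponent_Node)
      have "set_mset M \<subseteq> ?S"
      proof
        fix T' assume "T' \<in># M"
        then obtain M' where "M = add_mset T' M'" by (metis mset_add)
        with s show "T' \<in> ?S" by (simp add: trees_upto_def)
      qed
      then have "M \<in> msets_of ?S (size M)" by (simp add: msets_of_def)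
      moreover have "size M \<le> N" using size_le_sum_tree_deg[of M] s Suc \<open>n \<le> N\<close> by simp
      ultimately show "T \<in> Node ` ?U" using M by auto
    qed
    have "coef (tree_sum y) \<alpha> = (\<Sum>T\<in>trees_upto n. coef (y T) \<alpha>)"
      using y \<alpha> by (rule coef_tree_sum)
    also have "\<dots> = (\<Sum>T\<in>Node ` ?U. coef (y T) \<alpha>)"
    proof (rule sum.mono_neutral_left)
      show "finite (Node ` ?U)" by (intro finite_imageI finite_UN_I) (auto intro: finite_msets_of finite_trees_upto)
      show "\<forall>T\<in>Node ` ?U - trees_upto n. coef (y T) \<alpha> = 0"
        using y \<alpha> by (auto simp: trees_upto_def graded_def order_ge_def)
    qed (rule sub)
    finally show "coef (tree_sum y) \<alpha> = coef (\<Sum>T\<in>Node ` ?U. y T) \<alpha>"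
      by (simp only: coef_sum)
  qed
  also have "(\<Sum>T\<in>Node ` ?U. y T) = (\<Sum>M\<in>?U. y (Node M))"
    by (subst sum.reindex) (auto simp: inj_on_def)
  also have "\<dots> = (\<Sum>k\<le>N. \<Sum>M\<in>msets_of ?S k. y (Node M))"
    by (rule sum.UNION_disjoint) (auto simp: finite_msets_of finite_trees_upto, auto simp: msets_of_def)
  also have "\<dots> = (\<Sum>k\<le>N. ?c (1 / fact k) * (G k * map_series \<phi> (?D ^ k)))"
    by (simp add: level)
  \<comment> \<open>The finite sum \<open>?D\<close> agrees with \<open>tree_sum d\<close> up to
    degree \<open>m\<close> only; the factor \<open>G k\<close> supplies the missing degree.\<close>
  also have "agree n \<dots> (\<Sum>k\<le>N. ?c (1 / fact k) * (G k * map_series \<phi> (tree_sum d ^ k)))"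
    unfolding Suc
    by (intro agree_sum agree_mult agree_refl agree_Suc_mult agree_map_series agree_power G
        agree_sym[OF agree_tree_sum[OF d]])
  finally show ?thesis .
qed


section \<open>Weighted families of trees\<close>

text \<open>The monomial with exponent \<alpha> evaluated at \<open>g\<close>; for series
  \<open>g\<close> this is the substitution of \<open>g i\<close> for the \<open>i\<close>-th
  variable.\<close>

definition epow :: "(nat \<Rightarrow> 'a::comm_monoid_mult) \<Rightarrow> exponent \<Rightarrow> 'a" where
  "epow g \<alpha> = (\<Prod>i\<in>Poly_Mapping.keys \<alpha>. g i ^ Poly_Mapping.lookup \<alpha> i)"

lemma epow_superset:
  "finite A \<Longrightarrow> Poly_Mapping.keys \<alpha> \<subseteq> A \<Longrightarrow> epow g \<alpha> = (\<Prod>i\<in>A. g i ^ Poly_Mapping.lookup \<alpha> i)"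
  unfolding epow_def by (rule prod.mono_neutral_left) (auto simp: in_keys_iff)

lemma epow_zero [simp]: "epow g 0 = 1"
  by (simp add: epow_def)

lemma epow_single [simp]: "epow g (Poly_Mapping.single i 1) = g i"
  by (simp add: epow_def)

lemma epow_add: "epow g (\<alpha> + \<beta>) = epow g \<alpha> * epow g \<beta>"
proof -
  let ?A = "Poly_Mapping.keys \<alpha> \<union> Poly_Mapping.keys \<beta>"
  have "epow g (\<alpha> + \<beta>) = (\<Prod>i\<in>?A. g i ^ Poly_Mapping.lookup (\<alpha> + \<beta>) i)"
    by (rule epow_superset) (simp_all add: keys_add)
  then show ?thesis
    by (simp add: lookup_add power_add prod.distrib epow_superset[of ?A])
qed

lemma epow_sum_mset: "epow g (sum_mset M) = prod_mset (image_mset (epow g) M)"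
  by (induction M) (simp_all add: epow_add)

lemma epow_N_exponent_Node:
  "epow g (N_exponent (Node M)) = g (size M) * (\<Prod>T\<in>#M. epow g (N_exponent T))"
  by (simp add: N_exponent_Node epow_add epow_sum_mset multiset.map_comp o_def del: One_nat_def)

lemma exponent_sum_singles:
  "finite A \<Longrightarrow> Poly_Mapping.keys \<alpha> \<subseteq> A \<Longrightarrow> \<alpha> = (\<Sum>i\<in>A. Poly_Mapping.single i (Poly_Mapping.lookup \<alpha> i))"
  by (rule poly_mapping_eqI) (auto simp: lookup_sum lookup_single when_def in_keys_iff)

lemma monom_series_power: "monom_series (Poly_Mapping.single i 1) c ^ n = monom_series (Poly_Mapping.single i n) (c ^ n)"
  by (induction n) (simp_all add: monom_series_one monom_series_mult flip: single_add)

lemma epow_monom_series: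
  "epow (\<lambda>i. monom_series (Poly_Mapping.single i 1) (c i)) \<alpha> = monom_series \<alpha> (epow c \<alpha>)"
proof -
  have "(\<Prod>i\<in>A. monom_series (Poly_Mapping.single i 1) (c i) ^ n i) =
      monom_series (\<Sum>i\<in>A. Poly_Mapping.single i (n i)) (\<Prod>i\<in>A. c i ^ n i)" if "finite A" for A n
    using that
    by induction (simp_all add: monom_series_one monom_series_mult monom_series_power del: One_nat_def)
  from this[of "Poly_Mapping.keys \<alpha>" "Poly_Mapping.lookup \<alpha>"] show ?thesis
    by (simp add: epow_def flip: exponent_sum_singles)
qed

lemma epow_single_zero: "epow (\<lambda>i. Poly_Mapping.single 0 (c i) :: 'k::comm_monoid_add \<Rightarrow>\<^sub>0 complex) \<alpha> = Poly_Mapping.single 0 (epow c \<alpha>)"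
proof -
  have pow: "Poly_Mapping.single 0 z ^ n = (Poly_Mapping.single 0 (z ^ n) :: 'k \<Rightarrow>\<^sub>0 complex)" for z n
    by (induction n) (simp_all add: mult_single)
  have "(\<Prod>i\<in>A. Poly_Mapping.single 0 (h i)) = (Poly_Mapping.single 0 (\<Prod>i\<in>A. h i) :: 'k \<Rightarrow>\<^sub>0 complex)" if "finite A" for A :: "nat set" and h
    using that by induction (simp_all add: mult_single)
  then show ?thesis
    by (simp add: epow_def pow)
qed

lemma order_ge_epow:
  fixes G :: "nat \<Rightarrow> 'a::comm_ring_1 mseries"
  assumes "\<And>k. coef (G k) 0 = 0"
  shows "order_ge (edeg \<alpha>) (epow G \<alpha>)"
proof -
  have "order_ge (\<Sum>i\<in>A. n i) (\<Prod>i\<in>A. G i ^ n i)" if "finite A" for A and n :: "nat \<Rightarrow> nat"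
    using that
  proof induction
    case (insert i A)
    have "order_ge (n i) (G i ^ n i)"
      by (rule order_ge_power) (simp only: order_ge_1_iff assms)
    from order_ge_mult[OF this insert.IH] insert.hyps show ?case by simp
  qed simp
  then show ?thesis
    unfolding epow_def edeg_def by simp
qed

text \<open>The coefficients of \<open>P\<close> behave like scalars for \<phi>. For
  \<open>tensor_map Bplus id\<close> this includes series with coefficients
  \<open>1 \<otimes> h\<close>.\<close>

definition commutes :: "('a::times \<Rightarrow> 'a) \<Rightarrow> 'a mseries \<Rightarrow> bool" where
  "commutes \<phi> P \<longleftrightarrow> (\<forall>\<alpha> q. \<phi> (coef P \<alpha> * q) = coef P \<alpha> * \<phi> q)"

lemma map_series_commutes:
  fixes P Q :: "('k::comm_monoid_add \<Rightarrow>\<^sub>0 complex) mseries"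
  assumes "plinear \<phi>" "commutes \<phi> P"
  shows "map_series \<phi> (P * Q) = P * map_series \<phi> Q"
  using assms(2)
  by (intro mseries_eqI) (simp add: coef_mult plinear_sum[OF assms(1)] case_prod_unfold commutes_def)

lemma commutes_mult:
  fixes P Q :: "('k::comm_monoid_add \<Rightarrow>\<^sub>0 complex) mseries"
  assumes "plinear \<phi>" "commutes \<phi> P" "commutes \<phi> Q"
  shows "commutes \<phi> (P * Q)"
  using assms(2,3) unfolding commutes_def coef_mult
  by (simp add: sum_distrib_right plinear_sum[OF assms(1)] case_prod_unfold mult.assoc)

lemma commutes_one:
  fixes \<phi> :: "('k::comm_monoid_add \<Rightarrow>\<^sub>0 complex) \<Rightarrow> ('k \<Rightarrow>\<^sub>0 complex)"
  assumes "plinear \<phi>"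
  shows "commutes \<phi> 1"
  by (simp add: commutes_def plinear_zero[OF assms])

lemma commutes_add:
  fixes P Q :: "('k::comm_monoid_add \<Rightarrow>\<^sub>0 complex) mseries"
  assumes "plinear \<phi>" "commutes \<phi> P" "commutes \<phi> Q"
  shows "commutes \<phi> (P + Q)"
  using assms(2,3) unfolding commutes_def
  by (simp add: distrib_right plinear_add[OF assms(1)])

lemma commutes_zero:
  fixes \<phi> :: "('k::comm_monoid_add \<Rightarrow>\<^sub>0 complex) \<Rightarrow> ('k \<Rightarrow>\<^sub>0 complex)"
  assumes "plinear \<phi>"
  shows "commutes \<phi> 0"
  by (simp add: commutes_def plinear_zero[OF assms])

lemma commutes_sum:
  fixes g :: "'b \<Rightarrow> ('k::comm_monoid_add \<Rightarrow>\<^sub>0 complex) mseries"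
  assumes "plinear \<phi>" "\<And>x. x \<in> A \<Longrightarrow> commutes \<phi> (g x)"
  shows "commutes \<phi> (sum g A)"
  using assms(2)
  by (induction A rule: infinite_finite_induct) (simp_all add: commutes_zero commutes_add assms(1))

lemma commutes_power:
  fixes P :: "('k::comm_monoid_add \<Rightarrow>\<^sub>0 complex) mseries"
  assumes "plinear \<phi>" "commutes \<phi> P"
  shows "commutes \<phi> (P ^ n)"
  by (induction n) (simp_all add: commutes_one commutes_mult assms)

lemma commutes_epow:
  fixes G :: "nat \<Rightarrow> ('k::comm_monoid_add \<Rightarrow>\<^sub>0 complex) mseries"
  assumes "plinear \<phi>" "\<And>k. commutes \<phi> (G k)"
  shows "commutes \<phi> (epow G \<alpha>)"
proof -
  have "commutes \<phi> (\<Prod>i\<in>A. G i ^ n i)" if "finite A" for A n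
    using that by induction (simp_all add: commutes_one commutes_mult commutes_power assms)
  then show ?thesis by (simp add: epow_def)
qed

lemma commutes_monom_single:
  fixes \<phi> :: "('k::comm_monoid_add \<Rightarrow>\<^sub>0 complex) \<Rightarrow> ('k \<Rightarrow>\<^sub>0 complex)"
  assumes "plinear \<phi>"
  shows "commutes \<phi> (monom_series \<alpha> (Poly_Mapping.single 0 c))"
  by (simp add: commutes_def coef_monom_series plinear_zero[OF assms] plinear_pscale[OF assms] flip: pscale_conv_mult)

text \<open>The term of \<open>T\<close> in a series of trees after substituting \<open>G i\<close>
  for the \<open>i\<close>-th variable; \<open>tree_sym T\<close> is the number of automorphisms of
  \<open>T\<close>.\<close>

definition weighted_tree ::
  "(nat \<Rightarrow> ('k::comm_monoid_add \<Rightarrow>\<^sub>0 complex) mseries) \<Rightarrow> (rtree \<Rightarrow> ('k \<Rightarrow>\<^sub>0 complex)) \<Rightarrow> rtree \<Rightarrow> ('k \<Rightarrow>\<^sub>0 complex) mseries" where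
  "weighted_tree G e T = epow G (N_exponent T) * monom_series 0 (pscale (1 / of_nat (tree_sym T)) (e T))"

lemma graded_weighted_tree:
  assumes "\<And>k. coef (G k) 0 = 0"
  shows "graded (weighted_tree G e)"
  unfolding graded_def weighted_tree_def
  using order_ge_mult[OF order_ge_epow[OF assms] order_ge_0] by simp

text \<open>The symmetry factor of \<open>Node M\<close> is \<open>mfact M\<close> times those of
  its subtrees, and all scalars for \<phi> leave it. The families \<open>e\<close> and
  \<open>e'\<close> may differ, because the reduced coproduct of \<open>Node M\<close> is built from
  the full coproducts of its subtrees.\<close>

lemma weighted_tree_Node:
  fixes \<phi> :: "('k::comm_monoid_add \<Rightarrow>\<^sub>0 complex) \<Rightarrow> ('k \<Rightarrow>\<^sub>0 complex)"
  assumes lin: "plinear \<phi>" and G: "\<And>k. commutes \<phi> (G k)"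
    and e': "e' (Node M) = \<phi> (\<Prod>T\<in>#M. e T)"
  shows "weighted_tree G e' (Node M) = monom_series 0 (Poly_Mapping.single 0 (1 / of_nat (mfact M))) *
      (G (size M) * map_series \<phi> (\<Prod>T\<in>#M. weighted_tree G e T))"
proof -
  let ?s = "\<lambda>T. 1 / complex_of_nat (tree_sym T)"
  have prod_K: "(\<Prod>T\<in>#M. monom_series 0 (h T)) = monom_series 0 (\<Prod>T\<in>#M. h T)" for h :: "rtree \<Rightarrow> ('k \<Rightarrow>\<^sub>0 complex)"
    by (induction M) (simp_all add: monom_series_one monom_series_mult)
  have prod_scale: "(\<Prod>T\<in>#M. pscale (?s T) (e T)) = pscale (\<Prod>T\<in>#M. ?s T) (\<Prod>T\<in>#M. e T)"
    by (induction M) (simp_all add: pscale_mult_left pscale_mult_right mult.commute)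
  have prod_sym: "(\<Prod>T\<in>#M. ?s T) / of_nat (mfact M) = ?s (Node M)"
  proof -
    have "(\<Prod>T\<in>#M. ?s T) = 1 / of_nat (\<Prod>T\<in>#M. tree_sym T)"
      by (induction M) simp_all
    then show ?thesis by (simp add: mult.commute)
  qed
  have "(\<Prod>T\<in>#M. weighted_tree G e T) = (\<Prod>T\<in>#M. epow G (N_exponent T)) *
      monom_series 0 (pscale (\<Prod>T\<in>#M. ?s T) (\<Prod>T\<in>#M. e T))"
    unfolding weighted_tree_def by (simp add: prod_mset.distrib prod_K prod_scale)
  moreover have "commutes \<phi> (\<Prod>T\<in>#M. epow G (N_exponent T))"
    by (induction M) (simp_all add: commutes_one commutes_mult commutes_epow lin G)
  moreover have "map_series \<phi> (monom_series 0 q) = monom_series 0 (\<phi> q)" for q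
    by (rule mseries_eqI) (simp add: coef_monom_series plinear_zero[OF lin])
  ultimately have "map_series \<phi> (\<Prod>T\<in>#M. weighted_tree G e T) = (\<Prod>T\<in>#M. epow G (N_exponent T)) *
      monom_series 0 (pscale (\<Prod>T\<in>#M. ?s T) (e' (Node M)))"
    by (simp add: map_series_commutes[OF lin] plinear_pscale[OF lin] e')
  moreover have "monom_series 0 (Poly_Mapping.single 0 (1 / of_nat (mfact M))) *
      monom_series 0 (pscale (\<Prod>T\<in>#M. ?s T) (e' (Node M))) = monom_series 0 (pscale (?s (Node M)) (e' (Node M)))"
    unfolding prod_sym[symmetric] by (simp add: monom_series_mult flip: pscale_conv_mult)
  ultimately show ?thesis
    unfolding weighted_tree_def[of G e' "Node M"] epow_N_exponent_Node by (simp add: mult_ac)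
qed

definition tree_component :: "(rtree \<Rightarrow> ('k \<Rightarrow>\<^sub>0 complex)) \<Rightarrow> exponent \<Rightarrow> ('k \<Rightarrow>\<^sub>0 complex)" where
  "tree_component e \<alpha> = (\<Sum>T | N_exponent T = \<alpha>. pscale (1 / of_nat (tree_sym T)) (e T))"

lemma finite_trees_N_exponent: "finite {T. N_exponent T = \<alpha>}"
  by (rule finite_subset[OF _ finite_trees_upto[of "edeg \<alpha>"]]) (auto simp: trees_upto_def)

text \<open>A variable times a number: the numbers carry the coefficients of the equation, or switch
  off all variables above a bound.\<close>

definition scaled_var :: "(nat \<Rightarrow> complex) \<Rightarrow> nat \<Rightarrow> ('k::comm_monoid_add \<Rightarrow>\<^sub>0 complex) mseries" where
  "scaled_var c i = monom_series (Poly_Mapping.single i 1) (Poly_Mapping.single 0 (c i))"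

lemma coef_scaled_var_0: "coef (scaled_var c i) 0 = 0"
  by (auto simp: scaled_var_def coef_monom_series dest: arg_cong[where f = edeg])

lemma coef_weighted_tree_scaled_var:
  "coef (weighted_tree (scaled_var c) e T) \<alpha> =
     (if \<alpha> = N_exponent T then pscale (epow c \<alpha>) (pscale (1 / of_nat (tree_sym T)) (e T)) else 0)"
  unfolding weighted_tree_def scaled_var_def[abs_def] epow_monom_series epow_single_zero coef_monom_mult_const
  by (simp flip: pscale_conv_mult)

lemma coef_tree_sum_scaled_var:
  "coef (tree_sum (weighted_tree (scaled_var c) e)) \<alpha> = pscale (epow c \<alpha>) (tree_component e \<alpha>)"
proof -
  have "coef (tree_sum (weighted_tree (scaled_var c) e)) \<alpha> =
      (\<Sum>T\<in>trees_upto (edeg \<alpha>). if \<alpha> = N_exponent T then pscale (epow c \<alpha>) (pscale (1 / of_nat (tree_sym T)) (e T)) else 0)"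
    by (subst coef_tree_sum[OF graded_weighted_tree order_refl])
      (simp_all add: coef_scaled_var_0 coef_weighted_tree_scaled_var)
  also have "\<dots> = (\<Sum>T | N_exponent T = \<alpha>. pscale (epow c \<alpha>) (pscale (1 / of_nat (tree_sym T)) (e T)))"
    by (rule sum.mono_neutral_cong_right) (auto simp: finite_trees_upto, auto simp: trees_upto_def)
  finally show ?thesis
    by (simp add: tree_component_def pscale.scale_sum_right)
qed


section \<open>The solution of the Dyson-Schwinger equation\<close>

definition tree_gen :: "exponent \<Rightarrow> hck" where
  "tree_gen = tree_component (\<lambda>T. basis {#T#})"

lemma series_mult_coef: "series_mult (coef P) (coef Q) = coef (P * Q)"
  by (rule ext) (simp add: series_mult_def coef_mult splits_def)

lemma series_power_coef: "series_power (coef P) n = coef (P ^ n)"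
  by (induction n) (auto simp: series_mult_coef)

lemma var_coef: "var i = coef (monom_series (Poly_Mapping.single i 1) 1)"
  by (rule ext) (simp add: var_def coef_monom_series)

lemma coef_var_mult_zero:
  assumes "i \<notin> Poly_Mapping.keys \<alpha>"
  shows "coef (monom_series (Poly_Mapping.single i 1) c * P) \<alpha> = 0"
  unfolding coef_mult
proof (intro sum.neutral ballI)
  fix x assume x: "x \<in> splits \<alpha>"
  obtain \<beta> \<gamma> where [simp]: "x = (\<beta>, \<gamma>)" by (cases x)
  have "\<beta> \<noteq> Poly_Mapping.single i 1"
    using x assms by (auto simp: splits_def in_keys_iff lookup_add)
  then show "(case x of (\<beta>, \<gamma>) \<Rightarrow> coef (monom_series (Poly_Mapping.single i 1) c) \<beta> * coef P \<gamma>) = 0"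
    by (simp add: coef_monom_series)
qed

text \<open>The \<open>k\<close>-th summand reaches the coefficient at \<alpha> only if
  \<open>k\<close> lies in the support of \<alpha>, so the sum may be cut at any bound of the
  support. \<open>Bplus\<close> acts on coefficients and passes the variables.\<close>

lemma dse_rhs_coef:
  assumes "Poly_Mapping.keys \<alpha> \<subseteq> {..N}"
  shows "dse_rhs f (coef F) \<alpha> =
    coef (\<Sum>k\<le>N. scaled_var (fps_nth f) k * map_series Bplus (F ^ k)) \<alpha>"
proof -
  let ?X = "\<lambda>i. monom_series (Poly_Mapping.single i 1) 1 :: hck mseries"
  have "dse_rhs f (coef F) \<alpha> = Bplus (Sum_any (\<lambda>i. pscale (fps_nth f i) (coef (?X i * F ^ i) \<alpha>)))"
    by (simp add: dse_rhs_def var_coef series_power_coef series_mult_coef)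
  also have "\<dots> = Bplus (\<Sum>i\<le>N. pscale (fps_nth f i) (coef (?X i * F ^ i) \<alpha>))"
  proof (subst Sum_any.expand_superset[of "{..N}"])
    show "{i. pscale (fps_nth f i) (coef (?X i * F ^ i) \<alpha>) \<noteq> 0} \<subseteq> {..N}"
      using assms coef_var_mult_zero[of _ \<alpha> 1] by fastforce
  qed simp_all
  also have "\<dots> = (\<Sum>i\<le>N. pscale (fps_nth f i) (coef (map_series Bplus (?X i * F ^ i)) \<alpha>))"
    by (simp add: plinear_sum[OF plinear_Bplus] plinear_pscale[OF plinear_Bplus])
  also have "\<dots> = coef (\<Sum>k\<le>N. scaled_var (fps_nth f) k * map_series Bplus (F ^ k)) \<alpha>"
    unfolding coef_sum
  proof (intro sum.cong refl)
    fix i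
    have "commutes Bplus (?X i)"
      using commutes_monom_single[OF plinear_Bplus, of "Poly_Mapping.single i 1" 1] by simp
    then have "map_series Bplus (?X i * F ^ i) = ?X i * map_series Bplus (F ^ i)"
      by (rule map_series_commutes[OF plinear_Bplus])
    moreover have "scaled_var (fps_nth f) i = monom_series 0 (Poly_Mapping.single 0 (fps_nth f i)) * ?X i"
      by (simp add: scaled_var_def monom_series_mult)
    ultimately show "pscale (fps_nth f i) (coef (map_series Bplus (?X i * F ^ i)) \<alpha>) =
        coef (scaled_var (fps_nth f) i * map_series Bplus (F ^ i)) \<alpha>"
      by (simp add: mult.assoc coef_const_mult pscale_conv_mult)
  qed
  finally show ?thesis .
qed

lemma exponent_keys_bounded: "\<exists>N\<ge>n. Poly_Mapping.keys (\<alpha> :: exponent) \<subseteq> {..N}"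
proof -
  have "Poly_Mapping.keys \<alpha> \<subseteq> {..max n (Max (insert 0 (Poly_Mapping.keys \<alpha>)))}"
    by (auto simp: le_max_iff_disj)
  then show ?thesis by (meson max.cobounded1)
qed

text \<open>Each summand has a variable as a factor, so solutions that agree up to degree
  \<open>n\<close> agree up to degree \<open>n + 1\<close>.\<close>

lemma dse_unique:
  assumes "coef F = dse_rhs f (coef F)" "coef F' = dse_rhs f (coef F')"
  shows "F = F'"
proof (rule agree_eqI)
  fix n
  show "agree n F F'"
  proof (induction n)
    case 0
    have "coef P 0 = 0" if "coef P = dse_rhs f (coef P)" for P
    proof -
      have "coef (scaled_var (fps_nth f) 0 * Q) 0 = 0" for Q
        unfolding scaled_var_def by (rule coef_var_mult_zero) simp
      moreover have "coef P 0 = coef (\<Sum>k\<le>0. scaled_var (fps_nth f) k * map_series Bplus (P ^ k)) 0"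
        by (subst that) (rule dse_rhs_coef, simp)
      ultimately show ?thesis by simp
    qed
    then show ?case using assms by (simp add: agree_def)
  next
    case (Suc n)
    show ?case
      unfolding agree_def
    proof (intro allI impI)
      fix \<alpha> :: exponent assume \<alpha>: "edeg \<alpha> \<le> Suc n"
      obtain N where N: "Poly_Mapping.keys \<alpha> \<subseteq> {..N}" using exponent_keys_bounded by blast
      have "agree (Suc n) (\<Sum>k\<le>N. scaled_var (fps_nth f) k * map_series Bplus (F ^ k))
          (\<Sum>k\<le>N. scaled_var (fps_nth f) k * map_series Bplus (F' ^ k))"
        by (intro agree_sum agree_Suc_mult agree_map_series agree_power Suc coef_scaled_var_0)
      then have "dse_rhs f (coef F) \<alpha> = dse_rhs f (coef F') \<alpha>"
        using \<alpha> unfolding dse_rhs_coef[OF N] agree_def by blast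
      then show "coef F \<alpha> = coef F' \<alpha>"
        using assms by simp
    qed
  qed
qed

definition dse_weight :: "complex fps \<Rightarrow> exponent \<Rightarrow> complex" where
  "dse_weight f = epow (\<lambda>i. fps_nth f i * fact i)"

text \<open>The series of all trees with variables rescaled by \<open>i! a_i\<close> solves the
  equation; uniqueness then evaluates the definite description in
  \<open>dse_solution\<close>.\<close>

theorem dse_solution_eq: "dse_solution f \<alpha> = pscale (dse_weight f \<alpha>) (tree_gen \<alpha>)"
proof -
  let ?c = "\<lambda>i. fps_nth f i * fact i"
  let ?y = "weighted_tree (scaled_var ?c) (\<lambda>T. basis {#T#}) :: rtree \<Rightarrow> hck mseries"
  let ?F = "tree_sum ?y"
  have graded: "graded ?y"
    by (rule graded_weighted_tree) (rule coef_scaled_var_0)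
  have com: "commutes Bplus (scaled_var ?c k)" for k
    unfolding scaled_var_def by (rule commutes_monom_single[OF plinear_Bplus])
  have Node: "basis {#Node M#} = Bplus (\<Prod>T\<in>#M. basis {#T#})" for M
  proof -
    have "(\<Prod>T\<in>#M. basis {#T#}) = (basis M :: hck)"
      by (induction M) (simp_all add: basis_zero basis_mult)
    then show ?thesis by simp
  qed
  have rec: "?y (Node M) = monom_series 0 (Poly_Mapping.single 0 (1 / of_nat (mfact M))) *
      (scaled_var ?c (size M) * map_series Bplus (\<Prod>T\<in>#M. ?y T))" for M
    by (rule weighted_tree_Node[OF plinear_Bplus com]) (rule Node)
  have sol: "coef ?F = dse_rhs f (coef ?F)"
  proof
    fix \<alpha>
    \<comment> \<open>\<open>N\<close> bounds the degree, for the exponential formula, and the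
      support, for cutting the right-hand side.\<close>
    obtain N where N: "edeg \<alpha> \<le> N" "Poly_Mapping.keys \<alpha> \<subseteq> {..N}" using exponent_keys_bounded by blast
    have "agree (edeg \<alpha>) ?F (\<Sum>k\<le>N. monom_series 0 (Poly_Mapping.single 0 (1 / fact k)) *
        (scaled_var ?c k * map_series Bplus (?F ^ k)))"
      by (rule tree_sum_exponential[OF graded graded plinear_Bplus rec coef_scaled_var_0 N(1)])
    then have "coef ?F \<alpha> = coef (\<Sum>k\<le>N. monom_series 0 (Poly_Mapping.single 0 (1 / fact k)) *
        (scaled_var ?c k * map_series Bplus (?F ^ k))) \<alpha>"
      by (simp add: agree_def)
    also have "(\<Sum>k\<le>N. monom_series 0 (Poly_Mapping.single 0 (1 / fact k)) *
        (scaled_var ?c k * map_series Bplus (?F ^ k))) = (\<Sum>k\<le>N. scaled_var (fps_nth f) k * map_series Bplus (?F ^ k))"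
    proof (intro sum.cong refl)
      fix k
      \<comment> \<open>The \<open>k!\<close> in the rescaling is there to cancel the
        \<open>1 / k!\<close> from counting orderings.\<close>
      have "monom_series 0 (Poly_Mapping.single 0 (1 / fact k)) * scaled_var ?c k = (scaled_var (fps_nth f) k :: hck mseries)"
        by (simp add: scaled_var_def monom_series_mult mult_single)
      then show "monom_series 0 (Poly_Mapping.single 0 (1 / fact k)) * (scaled_var ?c k * map_series Bplus (?F ^ k)) =
          scaled_var (fps_nth f) k * map_series Bplus (?F ^ k)"
        by (simp flip: mult.assoc)
    qed
    also have "coef \<dots> \<alpha> = dse_rhs f (coef ?F) \<alpha>"
      by (rule dse_rhs_coef[OF N(2), symmetric])
    finally show "coef ?F \<alpha> = dse_rhs f (coef ?F) \<alpha>" .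
  qed
  have "dse_solution f = coef ?F"
    unfolding dse_solution_def
  proof (rule the_equality)
    fix F assume "F = dse_rhs f F"
    then have "Mseries F = ?F"
      using dse_unique[of "Mseries F" f ?F] sol by simp
    then show "F = coef ?F" by (metis coef_Mseries)
  qed (rule sol)
  then show ?thesis
    by (simp add: coef_tree_sum_scaled_var dse_weight_def tree_gen_def)
qed

lemma dse_weight_eq_0_iff: "dse_weight f \<alpha> = 0 \<longleftrightarrow> (\<exists>i\<in>Poly_Mapping.keys \<alpha>. fps_nth f i = 0)"
  by (auto simp: dse_weight_def epow_def in_keys_iff)

lemma N_exponent_nonzero: "N_exponent T \<noteq> 0"
  using tree_deg_pos[of T] by auto

lemma tree_gen_zero: "tree_gen 0 = 0"
  by (simp add: tree_gen_def tree_component_def N_exponent_nonzero)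

definition fertility_algebra :: "nat set \<Rightarrow> hck set" where
  "fertility_algebra I = subalgebra hull (tree_gen ` {\<alpha>. Poly_Mapping.keys \<alpha> \<subseteq> I})"

text \<open>If all coefficients indexed by the support of \<alpha> are nonzero, the component of the
  solution is a nonzero multiple of \<open>tree_gen \<alpha>\<close>; otherwise it is zero.\<close>

lemma H_sub_eq: "H_sub f = fertility_algebra {i. fps_nth f i \<noteq> 0}"
proof
  let ?I = "{i. fps_nth f i \<noteq> 0}"
  show "H_sub f \<subseteq> fertility_algebra ?I"
    unfolding H_sub_def
  proof (rule hull_minimal)
    show "dse_solution f ` Lambda \<subseteq> fertility_algebra ?I"
    proof (rule image_subsetI)
      fix \<alpha>
      show "dse_solution f \<alpha> \<in> fertility_algebra ?I"
      proof (cases "Poly_Mapping.keys \<alpha> \<subseteq> ?I")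
        case True
        then have "tree_gen \<alpha> \<in> fertility_algebra ?I"
          unfolding fertility_algebra_def by (intro hull_inc) simp
        then show ?thesis
          unfolding dse_solution_eq fertility_algebra_def by (rule subalgebra_pscale[OF subalgebra_hull])
      next
        case False
        then have "dse_weight f \<alpha> = 0" by (auto simp: dse_weight_eq_0_iff)
        then show ?thesis
          unfolding dse_solution_eq fertility_algebra_def by (simp add: subalgebra_zero[OF subalgebra_hull])
      qed
    qed
  qed (simp add: fertility_algebra_def subalgebra_hull)
  show "fertility_algebra ?I \<subseteq> H_sub f"
    unfolding fertility_algebra_def
  proof (rule hull_minimal)
    show "tree_gen ` {\<alpha>. Poly_Mapping.keys \<alpha> \<subseteq> ?I} \<subseteq> H_sub f"
    proof (rule image_subsetI)
      fix \<alpha> :: exponent assume "\<alpha> \<in> {\<alpha>. Poly_Mapping.keys \<alpha> \<subseteq> ?I}"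
      then have w: "dse_weight f \<alpha> \<noteq> 0" by (auto simp: dse_weight_eq_0_iff)
      show "tree_gen \<alpha> \<in> H_sub f"
      proof (cases "\<alpha> = 0")
        case True
        then show ?thesis by (simp add: tree_gen_zero H_sub_def subalgebra_zero[OF subalgebra_hull])
      next
        case False
        then have "dse_solution f \<alpha> \<in> H_sub f"
          unfolding H_sub_def by (intro hull_inc) (simp add: Lambda_def)
        then have "pscale (1 / dse_weight f \<alpha>) (dse_solution f \<alpha>) \<in> H_sub f"
          unfolding H_sub_def by (rule subalgebra_pscale[OF subalgebra_hull])
        then show ?thesis using w by (simp add: dse_solution_eq)
      qed
    qed
  qed (simp add: H_sub_def subalgebra_hull)
qed


section \<open>The coproduct of the generators\<close>

abbreviation graft :: "(forest \<times> forest \<Rightarrow>\<^sub>0 complex) \<Rightarrow> (forest \<times> forest \<Rightarrow>\<^sub>0 complex)" where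
  "graft \<equiv> tensor_map Bplus id"

text \<open>\<open>graft\<close> changes the left leg only, so elements \<open>1 \<otimes> h\<close>
  are scalars for it.\<close>

lemma graft_one_tensor_mult: "graft (tensor 1 h * q) = tensor 1 h * graft q"
proof (induction q rule: basis_induct)
  case (basis k)
  obtain a b where k: "k = (a, b)" by (cases k)
  show ?case
    unfolding k tensor_basis[symmetric] tensor_mult tensor_map_tensor[OF plinear_Bplus plinear_id(1)] by simp
qed (simp_all add: distrib_left pscale_mult_right plinear_add[OF plinear_tensor_map]
    plinear_pscale[OF plinear_tensor_map] plinear_zero[OF plinear_tensor_map])

lemma weighted_tree_add:
  "weighted_tree G (\<lambda>T. e T + e' T) = (\<lambda>T. weighted_tree G e T + weighted_tree G e' T)"
  by (rule ext) (simp add: weighted_tree_def pscale.scale_right_distrib monom_series_add distrib_left)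

lemma tree_component_linear: "plinear \<phi> \<Longrightarrow> tree_component (\<lambda>T. \<phi> (e T)) \<alpha> = \<phi> (tree_component e \<alpha>)"
  by (simp add: tree_component_def plinear_sum plinear_pscale)

text \<open>As \<open>G\<close> vanishes beyond \<open>m\<close>, the exponential formula holds up
  to every degree with the same finite sum, hence as an equation of series.\<close>

lemma tree_sum_graft:
  assumes lin: "plinear \<phi>" and "\<And>k. commutes \<phi> (G k)" and G0: "\<And>k. coef (G k) 0 = 0"
    and "\<And>M. e' (Node M) = \<phi> (\<Prod>T\<in>#M. e T)" and vanish: "\<And>k. m < k \<Longrightarrow> G k = 0"
  shows "tree_sum (weighted_tree G e') = (\<Sum>k\<le>m. monom_series 0 (Poly_Mapping.single 0 (1 / fact k)) *
      (G k * map_series \<phi> (tree_sum (weighted_tree G e) ^ k)))"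
proof (rule agree_eqI)
  fix n
  let ?t = "\<lambda>k. monom_series 0 (Poly_Mapping.single 0 (1 / fact k)) *
      (G k * map_series \<phi> (tree_sum (weighted_tree G e) ^ k))"
  have "agree n (tree_sum (weighted_tree G e')) (\<Sum>k\<le>max n m. ?t k)"
    by (rule tree_sum_exponential[OF graded_weighted_tree graded_weighted_tree lin weighted_tree_Node])
      (use assms in simp_all)
  also have "(\<Sum>k\<le>max n m. ?t k) = (\<Sum>k\<le>m. ?t k)"
    by (rule sum.mono_neutral_right) (auto simp: vanish)
  finally show "agree n (tree_sum (weighted_tree G e')) (\<Sum>k\<le>m. ?t k)" .
qed

text \<open>Each summand contains some \<open>G k\<close> without constant term and so gains a
  degree of agreement.\<close>

lemma graft_equation_unique:
  fixes Y Y' :: "('k::comm_monoid_add \<Rightarrow>\<^sub>0 complex) mseries"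
  assumes G0: "\<And>k. coef (G k) 0 = 0"
    and Y: "Y = (\<Sum>k\<le>m. c k * (G k * map_series \<phi> (Y ^ k)))"
    and Y': "Y' = (\<Sum>k\<le>m. c k * (G k * map_series \<phi> (Y' ^ k)))"
  shows "Y = Y'"
proof (rule agree_eqI)
  fix n
  have zero: "coef (c k * (G k * Q)) 0 = 0" for k Q
    using order_ge_mult[OF order_ge_0 order_ge_mult[OF _ order_ge_0], of 1 "G k" "c k" Q] G0
    unfolding order_ge_1_iff[symmetric] by simp
  show "agree n Y Y'"
  proof (induction n)
    case 0
    have "coef Y 0 = 0" "coef Y' 0 = 0"
      by (subst Y Y', simp only: coef_sum zero sum.neutral_const)+
    then show ?case by (simp add: agree_def)
  next
    case (Suc n)
    have "agree (Suc n) (\<Sum>k\<le>m. c k * (G k * map_series \<phi> (Y ^ k))) (\<Sum>k\<le>m. c k * (G k * map_series \<phi> (Y' ^ k)))"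
      by (intro agree_sum agree_mult agree_refl agree_Suc_mult agree_map_series agree_power Suc G0)
    then show ?case using Y Y' by simp
  qed
qed

text \<open>The Taylor formula for divided powers: the shift by \<open>A\<close> leaves \<phi>
  because the coefficients of \<open>A\<close> are scalars for it.\<close>

lemma divided_binomial:
  fixes A Y :: "('k::comm_monoid_add \<Rightarrow>\<^sub>0 complex) mseries"
  assumes lin: "plinear \<phi>" and A: "commutes \<phi> A"
  shows "monom_series 0 (Poly_Mapping.single 0 (1 / fact k)) * map_series \<phi> ((Y + A) ^ k) =
    (\<Sum>j\<le>k. monom_series 0 (Poly_Mapping.single 0 (1 / fact j)) *
      (monom_series 0 (Poly_Mapping.single 0 (1 / fact (k - j))) * A ^ (k - j) * map_series \<phi> (Y ^ j)))"
proof -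
  let ?c = "\<lambda>z :: complex. monom_series 0 (Poly_Mapping.single 0 z) :: ('k \<Rightarrow>\<^sub>0 complex) mseries"
  have com: "commutes \<phi> (?c z)" for z
    by (rule commutes_monom_single[OF lin])
  have "(Y + A) ^ k = (\<Sum>j\<le>k. (?c (of_nat (k choose j)) * A ^ (k - j)) * Y ^ j)"
    by (simp add: binomial_ring monom_series_of_nat mult_ac)
  moreover have "map_series \<phi> (sum g S) = (\<Sum>x\<in>S. map_series \<phi> (g x))" for g :: "nat \<Rightarrow> _" and S
    by (rule mseries_eqI) (simp add: coef_sum plinear_sum[OF lin])
  ultimately have expand: "map_series \<phi> ((Y + A) ^ k) =
      (\<Sum>j\<le>k. (?c (of_nat (k choose j)) * A ^ (k - j)) * map_series \<phi> (Y ^ j))"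
    by (simp add: map_series_commutes[OF lin] commutes_mult[OF lin] commutes_power[OF lin] com A del: single_of_nat)
  have coeff: "?c (1 / fact k) * ?c (of_nat (k choose j)) = ?c (1 / fact j) * ?c (1 / fact (k - j))" if "j \<le> k" for j
    using that by (simp add: monom_series_mult mult_single binomial_fact del: single_of_nat)
  show ?thesis
    unfolding expand sum_distrib_left
    by (intro sum.cong refl) (simp only: mult.assoc[symmetric] coeff atMost_iff)
qed

section \<open>Series with coefficients in a subalgebra\<close>

definition coefs_in :: "'a set \<Rightarrow> 'a mseries \<Rightarrow> bool" where
  "coefs_in B P \<longleftrightarrow> (\<forall>\<alpha>. coef P \<alpha> \<in> B)"

context
  fixes B :: "('k::comm_monoid_add \<Rightarrow>\<^sub>0 complex) set"
  assumes B: "subalgebra B"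
begin

lemma coefs_in_mult: "coefs_in B P \<Longrightarrow> coefs_in B Q \<Longrightarrow> coefs_in B (P * Q)"
  unfolding coefs_in_def coef_mult
  by (auto intro!: subalgebra_sum[OF B] subalgebra_mult[OF B])

lemma coefs_in_sum: "(\<And>x. x \<in> S \<Longrightarrow> coefs_in B (g x)) \<Longrightarrow> coefs_in B (sum g S)"
  by (auto simp: coefs_in_def coef_sum intro: subalgebra_sum[OF B])

lemma coefs_in_one: "coefs_in B 1"
  by (simp add: coefs_in_def subalgebra_one[OF B] subalgebra_zero[OF B])

lemma coefs_in_power: "coefs_in B P \<Longrightarrow> coefs_in B (P ^ n)"
  by (induction n) (simp_all add: coefs_in_one coefs_in_mult)

lemma coefs_in_epow:
  assumes "\<And>i. coefs_in B (g i)"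
  shows "coefs_in B (epow g \<alpha>)"
proof -
  have "coefs_in B (\<Prod>i\<in>A. g i ^ n i)" if "finite A" for A n
    using that by induction (simp_all add: coefs_in_one coefs_in_mult coefs_in_power assms)
  then show ?thesis by (simp add: epow_def)
qed

lemma coefs_in_monom_single: "coefs_in B (monom_series \<alpha> (Poly_Mapping.single 0 c))"
proof -
  have "Poly_Mapping.single 0 c = pscale c (1 :: 'k \<Rightarrow>\<^sub>0 complex)"
    by (simp add: pscale_conv_mult)
  then show ?thesis
    by (simp add: coefs_in_def coef_monom_series subalgebra_pscale[OF B] subalgebra_one[OF B] subalgebra_zero[OF B])
qed

end

text \<open>Let \<open>A\<close> be the generating series of \<open>1 \<otimes> T\<close> and \<open>X k\<close> the \<open>k\<close>-th variable. Both the series of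
  the reduced coproducts and the result of substituting \<open>G j = \<Sum>k. X (j + k) * A ^ k / k!\<close> for the
  variables in the series of all \<open>T \<otimes> 1\<close> satisfy \<open>Y = \<Sum>j. G j * graft (Y ^ j) / j!\<close>.\<close>

lemma coproduct_tree_gen:
  assumes I: "{..m} \<subseteq> I" and \<alpha>: "Poly_Mapping.keys \<alpha> \<subseteq> {..m}"
  shows "coproduct (tree_gen \<alpha>) \<in> tensor_square (fertility_algebra I)"
proof -
  let ?H = "fertility_algebra I"
  let ?B = "tensor_square ?H"
  have H: "subalgebra ?H"
    by (simp add: fertility_algebra_def subalgebra_hull)
  then have B: "subalgebra ?B" by (rule subalgebra_tensor_square)
  have gen: "tree_gen \<beta> \<in> ?H" if "Poly_Mapping.keys \<beta> \<subseteq> {..m}" for \<beta>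
    unfolding fertility_algebra_def using that I by (intro hull_inc) auto
  let ?K = "\<lambda>z :: complex. monom_series 0 (Poly_Mapping.single 0 z) :: (forest \<times> forest \<Rightarrow>\<^sub>0 complex) mseries"
  \<comment> \<open>Switches off the variables above \<open>m\<close>; the coefficient at \<alpha>
    is unaffected, as \<alpha> is supported in \<open>{..m}\<close>.\<close>
  define c where "c = (\<lambda>i. if i \<le> m then 1 else 0 :: complex)"
  have epow_c: "epow c \<beta> = (if Poly_Mapping.keys \<beta> \<subseteq> {..m} then 1 else 0)" for \<beta>
    by (auto simp: epow_def c_def in_keys_iff intro!: prod.neutral prod_zero)
  define X :: "nat \<Rightarrow> (forest \<times> forest \<Rightarrow>\<^sub>0 complex) mseries" where "X = scaled_var c"
  have X0: "coef (X k) 0 = 0" for k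
    by (simp add: X_def coef_scaled_var_0)
  have X_vanish: "X k = 0" if "m < k" for k
    using that by (intro mseries_eqI) (simp add: X_def scaled_var_def c_def coef_monom_series)
  have X_com: "commutes graft (X k)" for k
    unfolding X_def scaled_var_def by (rule commutes_monom_single[OF plinear_tensor_map])
  define right :: "rtree \<Rightarrow> (forest \<times> forest \<Rightarrow>\<^sub>0 complex)" where "right T = tensor 1 (basis {#T#})" for T
  \<comment> \<open>The part of the coproduct whose left leg contains the root; the subtracted term
    is the total cut.\<close>
  define trunk where "trunk T = coproduct_tree T - right T" for T
  define D where "D = tree_sum (weighted_tree X coproduct_tree)"
  define A where "A = tree_sum (weighted_tree X right)"
  define Y where "Y = tree_sum (weighted_tree X trunk)"
  \<comment> \<open>What multiplies the \<open>j\<close>-th divided power of \<open>Y\<close> after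
    Taylor expansion in \<open>A\<close>; for \<open>j > m\<close> the sum is empty.\<close>
  define G where "G j = (\<Sum>k\<in>{j..m}. ?K (1 / fact (k - j)) * (X k * A ^ (k - j)))" for j
  define S where "S = tree_sum (weighted_tree G (\<lambda>T. basis ({#T#}, {#})))"
  have D_eq: "D = Y + A"
  proof -
    have "D = tree_sum (weighted_tree X (\<lambda>T. trunk T + right T))"
      unfolding D_def by (simp add: trunk_def)
    then show ?thesis
      unfolding Y_def A_def weighted_tree_add tree_sum_add .
  qed
  have coef_A: "coef A \<beta> = pscale (epow c \<beta>) (tensor 1 (tree_gen \<beta>))" for \<beta>
    unfolding A_def X_def coef_tree_sum_scaled_var right_def tree_gen_def
    by (simp add: tree_component_linear[OF plinear_tensor_right])
  have A_com: "commutes graft A"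
    unfolding commutes_def coef_A
    by (simp add: pscale_mult_left plinear_pscale[OF plinear_tensor_map] graft_one_tensor_mult)
  have G_com: "commutes graft (G j)" for j
    unfolding G_def
    by (intro commutes_sum commutes_mult commutes_power commutes_monom_single plinear_tensor_map X_com A_com)
  have G0: "coef (G j) 0 = 0" for j
  proof -
    have "coef (X k * Q) 0 = 0" for k Q
      using order_ge_mult[of 1 "X k" 0 Q] X0 unfolding order_ge_1_iff[symmetric] by simp
    then show ?thesis by (simp add: G_def coef_sum coef_const_mult)
  qed
  have G_vanish: "G j = 0" if "m < j" for j
    using that by (simp add: G_def)
  have Y_eq: "Y = (\<Sum>j\<le>m. ?K (1 / fact j) * (G j * map_series graft (Y ^ j)))"
  proof -
    \<comment> \<open>Subtrees enter with their full coproduct, so \<open>D\<close> stands on the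
      right; replacing it by \<open>Y + A\<close> closes the equation for \<open>Y\<close>.\<close>
    have "trunk (Node M) = graft (\<Prod>T\<in>#M. coproduct_tree T)" for M
      by (simp add: trunk_def right_def coproduct_tree_Node cop_def)
    then have "Y = (\<Sum>k\<le>m. ?K (1 / fact k) * (X k * map_series graft (D ^ k)))"
      unfolding Y_def D_def using X_vanish by (intro tree_sum_graft plinear_tensor_map X_com X0)
    also have "\<dots> = (\<Sum>k\<le>m. \<Sum>j | j \<in> {..m} \<and> j \<le> k. ?K (1 / fact j) *
        ((?K (1 / fact (k - j)) * (X k * A ^ (k - j))) * map_series graft (Y ^ j)))"
    proof (intro sum.cong refl)
      fix k assume "k \<in> {..m}"
      then have set: "{j. j \<in> {..m} \<and> j \<le> k} = {..k}" by auto
      have "?K (1 / fact k) * (X k * map_series graft (D ^ k)) =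
          X k * (?K (1 / fact k) * map_series graft ((Y + A) ^ k))"
        by (simp add: D_eq mult_ac)
      also have "\<dots> = (\<Sum>j\<le>k. X k * (?K (1 / fact j) * (?K (1 / fact (k - j)) * A ^ (k - j) * map_series graft (Y ^ j))))"
        unfolding divided_binomial[OF plinear_tensor_map A_com] sum_distrib_left ..
      also have "\<dots> = (\<Sum>j\<le>k. ?K (1 / fact j) *
        ((?K (1 / fact (k - j)) * (X k * A ^ (k - j))) * map_series graft (Y ^ j)))"
        by (intro sum.cong refl) (simp only: mult_ac)
      finally show "?K (1 / fact k) * (X k * map_series graft (D ^ k)) =
          (\<Sum>j | j \<in> {..m} \<and> j \<le> k. ?K (1 / fact j) *
        ((?K (1 / fact (k - j)) * (X k * A ^ (k - j))) * map_series graft (Y ^ j)))"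
        unfolding set .
    qed
    \<comment> \<open>Exchanging the sums over \<open>j \<le> k \<le> m\<close> collects the powers
      of \<open>A\<close> in \<open>G j\<close>.\<close>
    also have "\<dots> = (\<Sum>j\<le>m. \<Sum>k | k \<in> {..m} \<and> j \<le> k. ?K (1 / fact j) *
        ((?K (1 / fact (k - j)) * (X k * A ^ (k - j))) * map_series graft (Y ^ j)))"
      by (rule sum.swap_restrict) simp_all
    also have "\<dots> = (\<Sum>j\<le>m. ?K (1 / fact j) * (G j * map_series graft (Y ^ j)))"
    proof (intro sum.cong refl)
      fix j
      have "{k. k \<in> {..m} \<and> j \<le> k} = {j..m}" by auto
      then show "(\<Sum>k | k \<in> {..m} \<and> j \<le> k. ?K (1 / fact j) *
        ((?K (1 / fact (k - j)) * (X k * A ^ (k - j))) * map_series graft (Y ^ j))) =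
        ?K (1 / fact j) * (G j * map_series graft (Y ^ j))"
        by (simp only: G_def sum_distrib_left sum_distrib_right)
    qed
    finally show ?thesis .
  qed
  have S_eq: "S = (\<Sum>j\<le>m. ?K (1 / fact j) * (G j * map_series graft (S ^ j)))"
  proof -
    have "basis ({#Node M#}, {#}) = graft (\<Prod>T\<in>#M. basis ({#T#}, {#}))" for M
    proof -
      have "(\<Prod>T\<in>#M. basis ({#T#}, {#})) = (basis (M, {#}) :: forest \<times> forest \<Rightarrow>\<^sub>0 complex)"
        by (induction M) (simp_all add: basis_zero basis_mult flip: zero_prod_def)
      then show ?thesis by (simp add: tensor_map_basis tensor_basis)
    qed
    then show ?thesis
      unfolding S_def using G_vanish by (intro tree_sum_graft plinear_tensor_map G_com G0)
  qed
  have "Y = S"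
    using G0 Y_eq S_eq by (rule graft_equation_unique)
  have A_in: "coefs_in ?B A"
    unfolding coefs_in_def coef_A epow_c
    using gen tensor_in_tensor_square[OF subalgebra_one[OF H]]
    by (auto simp: subalgebra_zero[OF B])
  have G_in: "coefs_in ?B (G j)" for j
    unfolding G_def X_def scaled_var_def
    by (intro coefs_in_sum coefs_in_mult coefs_in_power coefs_in_monom_single A_in B)
  \<comment> \<open>Trees with the same exponent \<beta> share the factor
    \<open>epow G \<beta>\<close>, so grouping by \<beta> assembles the generators
    \<open>tensor (tree_gen \<beta>) 1\<close>.\<close>
  have S_in: "coef S \<alpha> \<in> ?B"
  proof -
    let ?T = "trees_upto (edeg \<alpha>)"
    let ?e = "\<lambda>T. pscale (1 / of_nat (tree_sym T)) (basis ({#T#}, {#})) :: forest \<times> forest \<Rightarrow>\<^sub>0 complex"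
    have "coef S \<alpha> = (\<Sum>T\<in>?T. ?e T * coef (epow G (N_exponent T)) \<alpha>)"
      unfolding S_def
      by (subst coef_tree_sum[OF graded_weighted_tree order_refl])
        (simp_all add: G0 weighted_tree_def mult.commute[of "epow _ _"] coef_const_mult)
    also have "\<dots> = (\<Sum>\<beta>\<in>N_exponent ` ?T. \<Sum>T\<in>{T \<in> ?T. N_exponent T = \<beta>}. ?e T * coef (epow G (N_exponent T)) \<alpha>)"
      by (rule sum.image_gen) (rule finite_trees_upto)
    also have "\<dots> = (\<Sum>\<beta>\<in>N_exponent ` ?T. tensor (tree_gen \<beta>) 1 * coef (epow G \<beta>) \<alpha>)"
    proof (intro sum.cong refl)
      fix \<beta> assume "\<beta> \<in> N_exponent ` ?T"
      \<comment> \<open>Trees with equal fertilities have equal degree, so the degree bound keeps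
        each group whole.\<close>
      then have set: "{T \<in> ?T. N_exponent T = \<beta>} = {T. N_exponent T = \<beta>}"
        by (auto simp: trees_upto_def)
      have "(\<Sum>T\<in>{T \<in> ?T. N_exponent T = \<beta>}. ?e T * coef (epow G (N_exponent T)) \<alpha>) =
          tree_component (\<lambda>T. basis ({#T#}, {#})) \<beta> * coef (epow G \<beta>) \<alpha>"
        unfolding tree_component_def set sum_distrib_right by (intro sum.cong) auto
      also have "tree_component (\<lambda>T. basis ({#T#}, {#})) \<beta> = tensor (tree_gen \<beta>) 1"
      proof -
        have "tree_component (\<lambda>T. tensor (basis {#T#}) (basis {#})) \<beta> = tensor (tree_gen \<beta>) (basis {#})"
          by (simp only: tree_gen_def tree_component_linear[OF plinear_tensor_left])
        then show ?thesis
          unfolding tensor_basis by (simp add: basis_zero)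
      qed
      finally show "(\<Sum>T\<in>{T \<in> ?T. N_exponent T = \<beta>}. ?e T * coef (epow G (N_exponent T)) \<alpha>) =
          tensor (tree_gen \<beta>) 1 * coef (epow G \<beta>) \<alpha>" .
    qed
    also have "\<dots> \<in> ?B"
    proof (rule subalgebra_sum[OF B])
      fix \<beta>
      show "tensor (tree_gen \<beta>) 1 * coef (epow G \<beta>) \<alpha> \<in> ?B"
      proof (cases "Poly_Mapping.keys \<beta> \<subseteq> {..m}")
        case True
        have "coefs_in ?B (epow G \<beta>)" by (rule coefs_in_epow[OF B G_in])
        then show ?thesis
          using gen[OF True] tensor_in_tensor_square[OF _ subalgebra_one[OF H]]
          by (auto simp: coefs_in_def intro: subalgebra_mult[OF B])
      next
        case False
        \<comment> \<open>A factor \<open>G i\<close> with \<open>i > m\<close> is zero, which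
          removes the exponents that might leave \<open>I\<close>.\<close>
        then obtain i where i: "i \<in> Poly_Mapping.keys \<beta>" "m < i" by (metis atMost_iff not_le subsetI)
        then have "epow G \<beta> = 0"
          unfolding epow_def by (intro prod_zero bexI[of _ i]) (simp_all add: G_vanish in_keys_iff zero_power)
        then show ?thesis by (simp add: subalgebra_zero[OF B])
      qed
    qed
    finally show ?thesis .
  qed
  have "coproduct (tree_gen \<alpha>) = tree_component coproduct_tree \<alpha>"
    unfolding tree_gen_def tree_component_linear[OF plinear_coproduct, symmetric] by simp
  also have "\<dots> = coef D \<alpha>"
    unfolding D_def X_def coef_tree_sum_scaled_var using \<alpha> by (simp add: epow_c)
  also have "\<dots> = coef S \<alpha> + coef A \<alpha>"
    by (simp add: D_eq \<open>Y = S\<close>)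
  also have "\<dots> \<in> ?B"
    using S_in A_in by (simp add: coefs_in_def subalgebra_add[OF B])
  finally show ?thesis .
qed

lemma lookup_sum_mset: "Poly_Mapping.lookup (sum_mset M) i = (\<Sum>p\<in>#M. Poly_Mapping.lookup p i)"
  by (induction M) (simp_all add: lookup_add)

lemma lookup_N_exponent_Node:
  "Poly_Mapping.lookup (N_exponent (Node M)) i =
     (if i = size M then 1 else 0) + (\<Sum>T\<in>#M. Poly_Mapping.lookup (N_exponent T) i)"
  by (simp add: N_exponent_Node lookup_add lookup_single when_def lookup_sum_mset multiset.map_comp o_def)

lemma lookup_N_exponent_subtree:
  "T \<in># M \<Longrightarrow> Poly_Mapping.lookup (N_exponent T) i \<le> Poly_Mapping.lookup (N_exponent (Node M)) i"
  by (auto simp: lookup_N_exponent_Node dest!: multi_member_split)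

text \<open>A finite tree has a leaf. Hence generators without 0 in their support vanish, which
  settles the case of a zero constant coefficient.\<close>

lemma zero_in_keys_N_exponent: "0 \<in> Poly_Mapping.keys (N_exponent T)"
proof (induction T)
  case (Node M)
  show ?case
  proof (cases "M = {#}")
    case False
    then obtain T where "T \<in># M" by (auto simp: multiset_nonemptyE)
    then show ?thesis
      using Node[of T] lookup_N_exponent_subtree[of T M 0] by (auto simp: in_keys_iff)
  qed (simp add: in_keys_iff lookup_N_exponent_Node)
qed

lemma tree_gen_eq_zero: "0 \<notin> Poly_Mapping.keys \<alpha> \<Longrightarrow> tree_gen \<alpha> = 0"
  unfolding tree_gen_def tree_component_def using zero_in_keys_N_exponent by (intro sum.neutral) auto

text \<open>Generators without 0 in their support vanish. Otherwise \<open>0 \<in> I\<close>, so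
  \<open>I\<close> is downward closed and contains all indices up to the largest one in
  \<alpha>.\<close>

lemma coproduct_fertility_algebra:
  assumes "0 \<notin> I \<or> (\<forall>i. Suc i \<in> I \<longrightarrow> i \<in> I)"
  shows "coproduct ` fertility_algebra I \<subseteq> tensor_square (fertility_algebra I)"
  unfolding fertility_algebra_def
proof (rule coproduct_subalgebra_hull, fold fertility_algebra_def)
  fix p assume "p \<in> tree_gen ` {\<alpha>. Poly_Mapping.keys \<alpha> \<subseteq> I}"
  then obtain \<alpha> where \<alpha>: "p = tree_gen \<alpha>" "Poly_Mapping.keys \<alpha> \<subseteq> I" by auto
  show "coproduct p \<in> tensor_square (fertility_algebra I)"
  proof (cases "0 \<in> Poly_Mapping.keys \<alpha>")
    case True
    let ?m = "Max (Poly_Mapping.keys \<alpha>)"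
    have "?m \<in> Poly_Mapping.keys \<alpha>" using True by (intro Max_in) auto
    then have "?m \<in> I" using \<alpha>(2) by auto
    have down: "\<forall>i. Suc i \<in> I \<longrightarrow> i \<in> I" using assms True \<alpha>(2) by blast
    have "i \<in> I" if "i \<le> ?m" for i
      using that by (induction rule: inc_induct) (use \<open>?m \<in> I\<close> down in auto)
    then show ?thesis
      unfolding \<alpha>(1) by (intro coproduct_tree_gen[of ?m]) auto
  next
    case False
    then show ?thesis
      unfolding \<alpha>(1) by (simp add: tree_gen_eq_zero plinear_zero[OF plinear_coproduct] pscale.subspace_0 subspace_tensor_square)
  qed
qed


section \<open>An obstruction to being a subcoalgebra\<close>

abbreviation leaf :: rtree where
  "leaf \<equiv> Node {#}"

definition corolla :: "nat \<Rightarrow> rtree" where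
  "corolla n = Node (replicate_mset n leaf)"

lemma corolla_inject [simp]: "corolla m = corolla n \<longleftrightarrow> m = n"
  by (auto simp: corolla_def dest: arg_cong[where f = size])

lemma N_exponent_corolla:
  "N_exponent (corolla n) = Poly_Mapping.single n 1 + Poly_Mapping.single 0 n"
proof -
  have "sum_mset (image_mset N_exponent (replicate_mset n leaf)) = Poly_Mapping.single 0 n"
    by (induction n) (simp_all add: N_exponent_Node flip: single_add)
  then show ?thesis
    by (simp add: corolla_def N_exponent_Node)
qed

text \<open>The index \<open>n > 0\<close> occurs, so the root has children; \<open>n\<close> is the
  only positive fertility available and the root uses up its single occurrence, so all other
  vertices are leaves.\<close>

lemma N_exponent_eq_corolla:
  assumes "N_exponent T = N_exponent (corolla n)" "n > 0"
  shows "T = corolla n"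
proof -
  obtain M where T: "T = Node M" by (cases T)
  have lookup: "Poly_Mapping.lookup (N_exponent (Node M)) i = (if i = n then 1 else 0) + (if i = 0 then n else 0)" for i
    using assms unfolding T by (auto simp: N_exponent_corolla lookup_add lookup_single when_def)
  have "M \<noteq> {#}"
  proof
    assume "M = {#}"
    then show False using lookup[of n] assms(2) by (simp add: lookup_N_exponent_Node)
  qed
  then have "size M \<noteq> 0" by simp
  moreover have "Poly_Mapping.lookup (N_exponent (Node M)) (size M) \<noteq> 0"
    by (simp add: lookup_N_exponent_Node)
  ultimately have size: "size M = n"
    using lookup[of "size M"] by (auto split: if_splits)
  have "T' = leaf" if "T' \<in># M" for T'
  proof -
    obtain M' where T': "T' = Node M'" by (cases T')
    have zero: "Poly_Mapping.lookup (N_exponent T') i = 0" if "i \<noteq> 0" for i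
    proof -
      have "Poly_Mapping.lookup (N_exponent T') i \<le> (\<Sum>T\<in>#M. Poly_Mapping.lookup (N_exponent T) i)"
        using \<open>T' \<in># M\<close> by (auto dest!: multi_member_split)
      also have "\<dots> = 0"
        using lookup[of i] that size by (auto simp: lookup_N_exponent_Node split: if_splits)
      finally show ?thesis by simp
    qed
    have nonzero: "Poly_Mapping.lookup (N_exponent T') (size M') \<noteq> 0"
      unfolding T' by (simp add: lookup_N_exponent_Node)
    have "size M' = 0"
    proof (rule ccontr)
      assume "size M' \<noteq> 0"
      from zero[OF this] nonzero show False by (rule notE[rotated])
    qed
    then show ?thesis by (simp add: T')
  qed
  then have "M = replicate_mset (size M) leaf"
    by (intro set_mset_subset_singletonD subsetI) (simp only: singleton_iff)
  then show ?thesis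
    by (simp add: T corolla_def size)
qed

lemma tree_gen_corolla:
  assumes "n > 0"
  shows "tree_gen (N_exponent (corolla n)) = pscale (1 / of_nat (tree_sym (corolla n))) (basis {#corolla n#})"
proof -
  have "{T. N_exponent T = N_exponent (corolla n)} = {corolla n}"
    using N_exponent_eq_corolla[OF _ assms] by auto
  then show ?thesis
    by (simp add: tree_gen_def tree_component_def)
qed

text \<open>The single vertex is primitive, so its powers have binomial coproducts.\<close>

lemma cop_replicate_leaf:
  "cop (replicate_mset n leaf) =
     (\<Sum>k\<le>n. pscale (of_nat (n choose k)) (basis (replicate_mset (n - k) leaf, replicate_mset k leaf)))"
proof -
  have "coproduct_tree leaf = basis ({#}, {#leaf#}) + basis ({#leaf#}, {#})"
  proof -
    have "coproduct_tree leaf = tensor (basis {#}) (basis {#leaf#}) + tensor_map Bplus id (basis ({#}, {#}))"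
      by (simp add: coproduct_tree_Node basis_zero flip: zero_prod_def)
    then show ?thesis
      unfolding tensor_map_basis by (simp add: tensor_basis)
  qed
  moreover have "basis ({#}, {#leaf#}) ^ k = (basis ({#}, replicate_mset k leaf) :: forest \<times> forest \<Rightarrow>\<^sub>0 complex)" for k
    by (induction k) (simp_all add: basis_zero basis_mult flip: zero_prod_def)
  moreover have "basis ({#leaf#}, {#}) ^ k = (basis (replicate_mset k leaf, {#}) :: forest \<times> forest \<Rightarrow>\<^sub>0 complex)" for k
    by (induction k) (simp_all add: basis_zero basis_mult flip: zero_prod_def)
  moreover have "cop (replicate_mset n leaf) = coproduct_tree leaf ^ n"
    by (induction n) (simp_all add: cop_def)
  ultimately show ?thesis
    by (simp add: binomial_ring basis_mult pscale_conv_mult mult.assoc)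
qed

text \<open>The term cuts off one of the \<open>i + 1\<close> leaves, which is \<open>k = 1\<close>
  in the binomial expansion; the total cut has an empty left leg and does not contribute.\<close>

lemma lookup_coproduct_corolla:
  "Poly_Mapping.lookup (coproduct_tree (corolla (Suc i))) ({#corolla i#}, {#leaf#}) = of_nat (Suc i)"
proof -
  let ?n = "Suc i"
  have expand: "tensor_map Bplus id (cop (replicate_mset ?n leaf)) =
      (\<Sum>k\<le>?n. pscale (of_nat (?n choose k)) (basis ({#corolla (?n - k)#}, replicate_mset k leaf)))"
    unfolding cop_replicate_leaf plinear_sum[OF plinear_tensor_map] plinear_pscale[OF plinear_tensor_map]
      tensor_map_basis
    by (simp add: tensor_basis corolla_def)
  have single: "replicate_mset k leaf = {#leaf#} \<longleftrightarrow> k = 1" for k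
  proof
    assume "replicate_mset k leaf = {#leaf#}"
    then have "size (replicate_mset k leaf) = size {#leaf#}" by (rule arg_cong)
    then show "k = 1" by simp
  qed simp
  have "Poly_Mapping.lookup (tensor_map Bplus id (cop (replicate_mset ?n leaf))) ({#corolla i#}, {#leaf#}) =
      (\<Sum>k\<le>?n. of_nat (?n choose k) *
        (if ({#corolla (?n - k)#}, replicate_mset k leaf) = ({#corolla i#}, {#leaf#}) then 1 else 0))"
    unfolding expand by (simp only: lookup_sum lookup_pscale lookup_basis)
  also have "\<dots> = (\<Sum>k\<le>?n. if k = 1 then of_nat ?n else 0)"
  proof (intro sum.cong refl)
    fix k
    show "of_nat (?n choose k) * (if ({#corolla (?n - k)#}, replicate_mset k leaf) = ({#corolla i#}, {#leaf#}) then 1 else 0) =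
        (if k = 1 then of_nat ?n else (0 :: complex))"
      unfolding prod.inject single by simp
  qed
  also have "\<dots> = of_nat ?n"
    by simp
  finally have graft_part: "Poly_Mapping.lookup (tensor_map Bplus id (cop (replicate_mset ?n leaf)))
      ({#corolla i#}, {#leaf#}) = of_nat ?n" .
  show ?thesis
    unfolding corolla_def[of "Suc i"] coproduct_tree_Node lookup_add graft_part
    by (simp add: lookup_one when_def)
qed

text \<open>Combinations of forests whose trees have fertilities in \<open>I\<close> only form a
  subalgebra that contains all generators.\<close>

lemma keys_fertility_algebra:
  assumes "p \<in> fertility_algebra I" "F \<in> Poly_Mapping.keys p" "T \<in># F"
  shows "Poly_Mapping.keys (N_exponent T) \<subseteq> I"
proof -
  let ?S = "{p :: hck. \<forall>F\<in>Poly_Mapping.keys p. \<forall>T\<in>#F. Poly_Mapping.keys (N_exponent T) \<subseteq> I}"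
  have "fertility_algebra I \<subseteq> ?S"
    unfolding fertility_algebra_def
  proof (rule hull_minimal)
    show "subalgebra ?S"
      unfolding subalgebra_def pscale.subspace_def
    proof (intro conjI ballI allI)
      fix p q :: hck assume p: "p \<in> ?S" and q: "q \<in> ?S"
      show "p + q \<in> ?S" using p q keys_add[of p q] by blast
      show "p * q \<in> ?S" using p q keys_mult[of p q] by fastforce
    next
      fix c and p :: hck assume "p \<in> ?S"
      moreover have "Poly_Mapping.keys (pscale c p) \<subseteq> Poly_Mapping.keys p" by (auto simp: in_keys_iff)
      ultimately show "pscale c p \<in> ?S" by blast
    qed auto
    show "tree_gen ` {\<alpha>. Poly_Mapping.keys \<alpha> \<subseteq> I} \<subseteq> ?S"
    proof (rule image_subsetI)
      fix \<alpha> :: exponent assume \<alpha>: "\<alpha> \<in> {\<alpha>. Poly_Mapping.keys \<alpha> \<subseteq> I}"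
      have "\<exists>T. F = {#T#} \<and> N_exponent T = \<alpha>" if "F \<in> Poly_Mapping.keys (tree_gen \<alpha>)" for F
      proof (rule ccontr)
        assume none: "\<not> ?thesis"
        have "Poly_Mapping.lookup (tree_gen \<alpha>) F = 0"
          unfolding tree_gen_def tree_component_def lookup_sum lookup_pscale lookup_basis
          by (rule sum.neutral) (use none in auto)
        with that show False by (simp add: in_keys_iff)
      qed
      with \<alpha> show "tree_gen \<alpha> \<in> ?S" by fastforce
    qed
  qed
  with assms show ?thesis by blast
qed

text \<open>The property holds for left legs of pure tensors and passes to linear
  combinations.\<close>

lemma keys_tensor_square_fertility_algebra:
  assumes "q \<in> tensor_square (fertility_algebra I)" "(F, F') \<in> Poly_Mapping.keys q" "T \<in># F"
  shows "Poly_Mapping.keys (N_exponent T) \<subseteq> I"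
proof -
  have "\<forall>F F' T. (F, F') \<in> Poly_Mapping.keys q \<longrightarrow> T \<in># F \<longrightarrow> Poly_Mapping.keys (N_exponent T) \<subseteq> I"
    using assms(1) unfolding tensor_square_def
  proof (induction rule: pscale.span_induct_alt)
    case (step c x y)
    obtain p p' where x: "x = tensor p p'" "p \<in> fertility_algebra I" using step.hyps by auto
    show ?case
    proof (intro allI impI)
      fix F F' T assume F: "(F, F') \<in> Poly_Mapping.keys (pscale c x + y)" "T \<in># F"
      then have "F \<in> Poly_Mapping.keys p \<or> (F, F') \<in> Poly_Mapping.keys y"
        by (auto simp: in_keys_iff lookup_add x(1))
      then show "Poly_Mapping.keys (N_exponent T) \<subseteq> I"
        using keys_fertility_algebra[OF x(2) _ F(2)] step.IH F(2) by blast
    qed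
  qed simp
  with assms show ?thesis by blast
qed

lemma coproduct_fertility_algebra_converse:
  assumes "coproduct ` fertility_algebra I \<subseteq> tensor_square (fertility_algebra I)" "0 \<in> I" "Suc i \<in> I"
  shows "i \<in> I"
proof -
  let ?C = "corolla (Suc i)"
  have "Poly_Mapping.keys (N_exponent ?C) \<subseteq> I"
    using assms(2,3) by (auto simp: N_exponent_corolla in_keys_iff lookup_add lookup_single when_def split: if_splits)
  then have "tree_gen (N_exponent ?C) \<in> fertility_algebra I"
    unfolding fertility_algebra_def by (intro hull_inc) auto
  then have "coproduct (tree_gen (N_exponent ?C)) \<in> tensor_square (fertility_algebra I)"
    using assms(1) by auto
  \<comment> \<open>The generator is a multiple of one tree, so the coefficient is
    \<open>i + 1\<close> over its symmetry factor and cannot cancel.\<close>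
  moreover have "({#corolla i#}, {#leaf#}) \<in> Poly_Mapping.keys (coproduct (tree_gen (N_exponent ?C)))"
    using tree_sym_pos[of ?C]
    by (simp add: tree_gen_corolla plinear_pscale[OF plinear_coproduct] in_keys_iff lookup_coproduct_corolla del: of_nat_Suc)
  ultimately have "Poly_Mapping.keys (N_exponent (corolla i)) \<subseteq> I"
    by (rule keys_tensor_square_fertility_algebra) simp
  then show ?thesis
    by (auto simp: N_exponent_corolla in_keys_iff lookup_add lookup_single when_def subset_iff)
qed


section \<open>The image of \<open>\<Psi>\<close>\<close>

definition gen_monomial :: "exponent multiset \<Rightarrow> hck" where
  "gen_monomial M = (\<Prod>\<alpha>\<in>#M. tree_gen \<alpha>)"

lemma lookup_basis_single_mult:
  "Poly_Mapping.lookup (basis {#T#} * p) F = (if T \<in># F then Poly_Mapping.lookup p (F - {#T#}) else 0)"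
proof (induction p rule: basis_induct)
  case (basis G)
  have "basis {#T#} * basis G = basis (add_mset T G)"
    by (simp add: basis_mult)
  then show ?case
    by (auto simp: lookup_basis dest: union_single_eq_member)
qed (simp_all add: distrib_left lookup_add pscale_mult_right)

text \<open>With one more generator, \<open>F\<close> arises by adding a tree \<open>T\<close> to
  \<open>F - {#T#}\<close>. The quotient of the symmetry factors turns the weight of
  \<open>T\<close> into its multiplicity in \<open>F\<close>; these multiplicities add up to that of
  \<alpha>, which is the factor by which \<open>mfact\<close> grows.\<close>

lemma lookup_gen_monomial:
  "Poly_Mapping.lookup (gen_monomial M) F =
     (if image_mset N_exponent F = M then of_nat (mfact M) / of_nat (forest_sym F) else 0)"
proof (induction M arbitrary: F)
  case empty
  show ?case
    by (auto simp: gen_monomial_def lookup_one when_def forest_sym_def)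
next
  case (add \<alpha> M)
  let ?S = "{T. N_exponent T = \<alpha>}"
  have "gen_monomial (add_mset \<alpha> M) = (\<Sum>T\<in>?S. pscale (1 / of_nat (tree_sym T)) (basis {#T#} * gen_monomial M))"
    by (simp add: gen_monomial_def tree_gen_def tree_component_def sum_distrib_right pscale_mult_left)
  then have lookup: "Poly_Mapping.lookup (gen_monomial (add_mset \<alpha> M)) F =
      (\<Sum>T\<in>?S. 1 / of_nat (tree_sym T) * (if T \<in># F then Poly_Mapping.lookup (gen_monomial M) (F - {#T#}) else 0))"
    by (simp add: lookup_sum lookup_basis_single_mult)
  show ?case
  proof (cases "image_mset N_exponent F = add_mset \<alpha> M")
    case False
    have "Poly_Mapping.lookup (gen_monomial M) (F - {#T#}) = 0" if "T \<in> ?S" "T \<in># F" for T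
    proof -
      have "image_mset N_exponent (F - {#T#}) \<noteq> M"
      proof
        assume "image_mset N_exponent (F - {#T#}) = M"
        then have "image_mset N_exponent (add_mset T (F - {#T#})) = add_mset \<alpha> M"
          using that(1) by simp
        with False that(2) show False by simp
      qed
      then show ?thesis by (simp add: add.IH)
    qed
    then have "Poly_Mapping.lookup (gen_monomial (add_mset \<alpha> M)) F = 0"
      unfolding lookup by (intro sum.neutral) auto
    then show ?thesis using False by simp
  next
    case True
    have "Poly_Mapping.lookup (gen_monomial (add_mset \<alpha> M)) F =
        (\<Sum>T\<in>?S. of_nat (count F T) * (of_nat (mfact M) / of_nat (forest_sym F)))"
      unfolding lookup
    proof (intro sum.cong refl)
      fix T assume T: "T \<in> ?S"
      show "1 / of_nat (tree_sym T) * (if T \<in># F then Poly_Mapping.lookup (gen_monomial M) (F - {#T#}) else 0) =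
          of_nat (count F T) * (of_nat (mfact M) / of_nat (forest_sym F) :: complex)"
      proof (cases "T \<in># F")
        case False
        then show ?thesis by (simp add: count_eq_zero_iff)
      next
        case in_F: True
        then obtain F' where F': "F = add_mset T F'" by (metis mset_add)
        then have "image_mset N_exponent F' = M" using True T by simp
        then have IH: "Poly_Mapping.lookup (gen_monomial M) (F - {#T#}) = of_nat (mfact M) / of_nat (forest_sym F')"
          by (simp add: add.IH F')
        have sym: "complex_of_nat (forest_sym F) = of_nat (count F T) * (of_nat (tree_sym T) * of_nat (forest_sym F'))"
          unfolding F' forest_sym_add_mset of_nat_mult by (simp del: of_nat_Suc)
        show ?thesis
          unfolding IH sym using in_F by (simp add: count_eq_zero_iff)
      qed
    qed
    also have "\<dots> = of_nat (\<Sum>T\<in>?S. count F T) * (of_nat (mfact M) / of_nat (forest_sym F))"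
      by (simp only: of_nat_sum sum_distrib_right)
    also have "(\<Sum>T\<in>?S. count F T) = count (image_mset N_exponent F) \<alpha>"
      unfolding count_image_mset
      by (rule sum.mono_neutral_right) (auto simp: finite_trees_N_exponent not_in_iff)
    also have "\<dots> = Suc (count M \<alpha>)"
      by (simp add: True)
    also have "of_nat (Suc (count M \<alpha>)) * (of_nat (mfact M) / of_nat (forest_sym F)) =
        (of_nat (mfact (add_mset \<alpha> M)) / of_nat (forest_sym F) :: complex)"
      unfolding mfact_add_mset of_nat_mult by simp
    finally show ?thesis using True by simp
  qed
qed

definition exponent_fact :: "exponent \<Rightarrow> complex" where
  "exponent_fact \<alpha> = monomial_pairing \<alpha> \<alpha>"

lemma exponent_fact_nonzero: "exponent_fact \<alpha> \<noteq> 0"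
  by (simp add: exponent_fact_def monomial_pairing_def)

definition Psi_basis :: "exponent multiset \<Rightarrow> hck" where
  "Psi_basis M = pscale (\<Prod>\<alpha>\<in>#M. exponent_fact \<alpha>) (gen_monomial M)"

lemma forest_pairing_basis: "forest_pairing p (basis F) = Poly_Mapping.lookup p F * of_nat (sym_factor F)"
  by (auto simp: forest_pairing_def bilin_ext_def lookup_basis in_keys_iff if_distrib cong: if_cong)

lemma sym_pairing_Theta_basis:
  "sym_pairing a (Theta (basis F)) = Poly_Mapping.lookup a (image_mset N_exponent F) *
     (of_nat (mfact (image_mset N_exponent F)) * (\<Prod>\<alpha>\<in>#image_mset N_exponent F. exponent_fact \<alpha>))"
  by (auto simp: Theta_def sym_pairing_def bilin_ext_def lookup_basis multiset_pairing_eq in_keys_iff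
      exponent_fact_def if_distrib cong: if_cong)

lemma lookup_lin_ext_Psi_basis:
  "Poly_Mapping.lookup (lin_ext Psi_basis a) F = Poly_Mapping.lookup a (image_mset N_exponent F) *
     ((\<Prod>\<alpha>\<in>#image_mset N_exponent F. exponent_fact \<alpha>) * (of_nat (mfact (image_mset N_exponent F)) / of_nat (forest_sym F)))"
proof -
  let ?N = "image_mset N_exponent F"
  have "Poly_Mapping.lookup (lin_ext Psi_basis a) F = (\<Sum>M\<in>Poly_Mapping.keys a. if M = ?N then
      Poly_Mapping.lookup a M * ((\<Prod>\<alpha>\<in>#M. exponent_fact \<alpha>) * (of_nat (mfact M) / of_nat (forest_sym F))) else 0)"
    unfolding lookup_lin_ext Psi_basis_def lookup_pscale lookup_gen_monomial by (intro sum.cong refl) auto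
  also have "\<dots> = (if ?N \<in> Poly_Mapping.keys a then Poly_Mapping.lookup a ?N *
      ((\<Prod>\<alpha>\<in>#?N. exponent_fact \<alpha>) * (of_nat (mfact ?N) / of_nat (forest_sym F))) else 0)"
    by (rule sum.delta) simp
  finally show ?thesis
    by (auto simp: in_keys_iff)
qed

text \<open>Pairing with \<open>F\<close> multiplies the coefficient of \<open>F\<close> by its
  nonzero symmetry factor, so at most one \<open>p\<close> qualifies. For the candidate that factor
  cancels, leaving the norm of the multiset of fertilities.\<close>

lemma Psi_eq: "Psi a = lin_ext Psi_basis a"
  unfolding Psi_def
proof (rule the_equality)
  show "\<forall>F. forest_pairing (lin_ext Psi_basis a) (basis F) = sym_pairing a (Theta (basis F))"
    using forest_sym_pos
    by (auto simp: forest_pairing_basis sym_pairing_Theta_basis lookup_lin_ext_Psi_basis sym_factor_eq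
        less_imp_neq[symmetric] dest: less_imp_neq)
  fix p assume p: "\<forall>F. forest_pairing p (basis F) = sym_pairing a (Theta (basis F))"
  show "p = lin_ext Psi_basis a"
  proof (rule poly_mapping_eqI)
    fix F
    have "Poly_Mapping.lookup p F * of_nat (forest_sym F) = sym_pairing a (Theta (basis F))"
      using p by (simp add: forest_pairing_basis sym_factor_eq)
    then show "Poly_Mapping.lookup p F = Poly_Mapping.lookup (lin_ext Psi_basis a) F"
      using forest_sym_pos[of F]
      by (simp add: sym_pairing_Theta_basis lookup_lin_ext_Psi_basis field_simps)
  qed
qed

lemma Psi_basis_union: "Psi_basis (M + N) = Psi_basis M * Psi_basis N"
  by (simp add: Psi_basis_def gen_monomial_def pscale_mult_left pscale_mult_right)

lemma subalgebra_Sym_plus: "subalgebra Sym_plus"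
  unfolding subalgebra_def pscale.subspace_def
proof (intro conjI ballI allI)
  fix p q :: sym_alg assume p: "p \<in> Sym_plus" and q: "q \<in> Sym_plus"
  show "p + q \<in> Sym_plus" using p q keys_add[of p q] unfolding Sym_plus_def by blast
  show "p * q \<in> Sym_plus" using p q keys_mult[of p q] unfolding Sym_plus_def by fastforce
next
  fix c and p :: sym_alg assume "p \<in> Sym_plus"
  moreover have "Poly_Mapping.keys (pscale c p) \<subseteq> Poly_Mapping.keys p" by (auto simp: in_keys_iff)
  ultimately show "pscale c p \<in> Sym_plus" unfolding Sym_plus_def by blast
qed (auto simp: Sym_plus_def)

lemma subalgebra_image:
  fixes \<phi> :: "('k::comm_monoid_add \<Rightarrow>\<^sub>0 complex) \<Rightarrow> ('l::comm_monoid_add \<Rightarrow>\<^sub>0 complex)"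
  assumes "plinear \<phi>" "\<phi> 1 = 1" "\<And>p q. \<phi> (p * q) = \<phi> p * \<phi> q" "subalgebra A"
  shows "subalgebra (\<phi> ` A)"
  unfolding subalgebra_def pscale.subspace_def
proof (intro conjI)
  show "0 \<in> \<phi> ` A"
    using plinear_zero[OF assms(1)] subalgebra_zero[OF assms(4)] by (metis image_eqI)
  show "1 \<in> \<phi> ` A"
    using assms(2) subalgebra_one[OF assms(4)] by (metis image_eqI)
  show "\<forall>x\<in>\<phi> ` A. \<forall>y\<in>\<phi> ` A. x + y \<in> \<phi> ` A"
    by (auto simp flip: plinear_add[OF assms(1)] intro: subalgebra_add[OF assms(4)])
  show "\<forall>c. \<forall>x\<in>\<phi> ` A. pscale c x \<in> \<phi> ` A"
    by (auto simp flip: plinear_pscale[OF assms(1)] intro: subalgebra_pscale[OF assms(4)])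
  show "\<forall>x\<in>\<phi> ` A. \<forall>y\<in>\<phi> ` A. x * y \<in> \<phi> ` A"
    by (auto simp flip: assms(3) intro: subalgebra_mult[OF assms(4)])
qed

text \<open>\<open>Psi\<close> is multiplicative, so its image is a subalgebra; it contains the
  generators because the factorials are invertible, and its values on basis elements are scalar
  multiples of products of generators.\<close>

lemma image_Psi: "Psi ` Sym_plus = fertility_algebra UNIV"
proof
  have H: "subalgebra (fertility_algebra UNIV)"
    by (simp add: fertility_algebra_def subalgebra_hull)
  have gen: "tree_gen \<alpha> \<in> fertility_algebra UNIV" for \<alpha>
    unfolding fertility_algebra_def by (intro hull_inc) simp
  have "gen_monomial M \<in> fertility_algebra UNIV" for M
    unfolding gen_monomial_def
    by (induction M) (auto intro: subalgebra_one[OF H] subalgebra_mult[OF H] gen)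
  then have "lin_ext Psi_basis a \<in> fertility_algebra UNIV" for a
    unfolding lin_ext_def Psi_basis_def by (intro subalgebra_sum[OF H] subalgebra_pscale[OF H])
  then show "Psi ` Sym_plus \<subseteq> fertility_algebra UNIV"
    by (auto simp: Psi_eq)
  have Psi_lin: "plinear Psi"
    unfolding Psi_eq[abs_def] by (rule plinear_lin_ext)
  have "subalgebra (Psi ` Sym_plus)"
  proof (rule subalgebra_image[OF Psi_lin])
    have "Psi (basis {#}) = 1"
      by (simp add: Psi_eq Psi_basis_def gen_monomial_def)
    then show "Psi 1 = 1" by (simp add: basis_zero)
    show "Psi (p * q) = Psi p * Psi q" for p q
      unfolding Psi_eq by (rule lin_ext_mult) (rule Psi_basis_union)
  qed (rule subalgebra_Sym_plus)
  moreover have "tree_gen \<alpha> \<in> Psi ` Sym_plus" for \<alpha>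
  proof (cases "\<alpha> = 0")
    case True
    \<comment> \<open>The exponent 0 is excluded from \<open>Lambda\<close>, but its generator is
      zero.\<close>
    have "0 = Psi 0" by (simp add: plinear_zero[OF Psi_lin])
    then show ?thesis
      using True subalgebra_zero[OF subalgebra_Sym_plus] by (auto simp: tree_gen_zero)
  next
    case False
    then have "pscale (1 / exponent_fact \<alpha>) (basis {#\<alpha>#}) \<in> Sym_plus"
      by (intro subalgebra_pscale[OF subalgebra_Sym_plus]) (simp add: Sym_plus_def Lambda_def)
    moreover have "Psi (pscale (1 / exponent_fact \<alpha>) (basis {#\<alpha>#})) = tree_gen \<alpha>"
      using exponent_fact_nonzero[of \<alpha>]
      by (simp add: plinear_pscale[OF Psi_lin]) (simp add: Psi_eq Psi_basis_def gen_monomial_def)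
    ultimately show ?thesis by (metis image_eqI)
  qed
  ultimately show "fertility_algebra UNIV \<subseteq> Psi ` Sym_plus"
    unfolding fertility_algebra_def by (intro hull_minimal) auto
qed

theorem theorem3p21:
  fixes f :: "complex fps"
  shows "(hopf_subalgebra (H_sub f) \<longleftrightarrow>
            fps_nth f 0 = 0 \<or> (\<forall>i. fps_nth f i = 0 \<longrightarrow> fps_nth f (i + 1) = 0))
       \<and> ((\<forall>i. fps_nth f i \<noteq> 0) \<longrightarrow> H_sub f = Psi ` Sym_plus)"
proof (intro conjI impI)
  let ?I = "{i. fps_nth f i \<noteq> 0}"
  have H: "subalgebra (fertility_algebra ?I)"
    by (simp add: fertility_algebra_def subalgebra_hull)
  show "hopf_subalgebra (H_sub f) \<longleftrightarrow>
      fps_nth f 0 = 0 \<or> (\<forall>i. fps_nth f i = 0 \<longrightarrow> fps_nth f (i + 1) = 0)"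
    \<comment> \<open>Only the set of indices with nonzero coefficient matters, and stability under
      the antipode is automatic.\<close>
    unfolding H_sub_eq hopf_subalgebra_iff[OF H]
  proof
    assume "coproduct ` fertility_algebra ?I \<subseteq> tensor_square (fertility_algebra ?I)"
    from coproduct_fertility_algebra_converse[OF this]
    show "fps_nth f 0 = 0 \<or> (\<forall>i. fps_nth f i = 0 \<longrightarrow> fps_nth f (i + 1) = 0)"
      by auto
  next
    assume "fps_nth f 0 = 0 \<or> (\<forall>i. fps_nth f i = 0 \<longrightarrow> fps_nth f (i + 1) = 0)"
    then show "coproduct ` fertility_algebra ?I \<subseteq> tensor_square (fertility_algebra ?I)"
      by (intro coproduct_fertility_algebra) auto
  qed
  assume "\<forall>i. fps_nth f i \<noteq> 0"
  then show "H_sub f = Psi ` Sym_plus"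
    by (simp add: H_sub_eq image_Psi)
qed

end
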